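(* Let $F\in\mathcal S(]-\infty,0],\mathbb R)$, extended to $\mathbb R$ as an even function. For every real $y>0$, $$\sum_{n=1}^{+\infty}d_nF(ny)=\frac1y\int_0^{+\infty}F(u)\Bigl(\ln\Bigl(\frac uy\Bigr)+2\gamma\Bigr)du+\frac{F(0)}{4}+\frac2y\sum_{n=1}^{+\infty}d_n\int_0^{+\infty}\cos\Bigl(\frac{4\pi^2n}{xy}\Bigr)\widehat F(x)\,\frac{dx}{x}.$$
   Context: $d_n$ is the number of positive divisors of $n$; $\gamma$ is Euler's constant. $\mathcal S(]-\infty,0],\mathbb R)$ is the space of real-valued functions $F\in C^\infty(]-\infty,0])$ (one-sided derivatives at $0$) such that $\lim_{t\to-\infty}|t|^mF^{(n)}(t)=0$ for all integers $n,m\ge 0$. The Fourier transform of the even function $F$ is $\widehat F(x)=\int_{\mathbb R}F(u)e^{-ixu}du=2\int_0^{+\infty}F(u)\cos(xu)\,du$. The integrals $\int_0^{+\infty}\cos(4\pi^2n/(xy))\widehat F(x)\frac{dx}{x}$ are improper (conditionally convergent) at $x=0^+$. *)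

theory Defs
  imports "HOL-Analysis.Analysis"
begin

(* The derivatives are taken within ]-oo,0], hence one-sided at 0; at points of
   ]-oo,0] they do not depend on the values of F on the positive half-line. *)
definition left_deriv :: "nat \<Rightarrow> (real \<Rightarrow> real) \<Rightarrow> real \<Rightarrow> real" where
  "left_deriv n F = ((\<lambda>G t. vector_derivative G (at t within {..0})) ^^ n) F"

definition smooth_left :: "(real \<Rightarrow> real) \<Rightarrow> bool" where
  "smooth_left F \<longleftrightarrow> (\<forall>n. left_deriv n F differentiable_on {..0})"

definition schwartz_left :: "(real \<Rightarrow> real) set" where
  "schwartz_left = {F. smooth_left F \<and>
     (\<forall>n m. ((\<lambda>t. \<bar>t\<bar> ^ m * left_deriv n F t) \<longlongrightarrow> 0) at_bot)}"

definition divisor_count :: "nat \<Rightarrow> nat" where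
  "divisor_count n = card {k. k dvd n}"

definition fourier :: "(real \<Rightarrow> real) \<Rightarrow> real \<Rightarrow> complex" where
  "fourier F x =
     (LINT u|lborel. complex_of_real (F u) * exp (- (\<i> * complex_of_real x * complex_of_real u)))"

(* Integrals over ]0,+oo[ that are improper at 0 only: absolutely convergent on
   each ]e,+oo[, with a limit as e tends to 0 from the right. *)
definition has_improper_integral :: "(real \<Rightarrow> complex) \<Rightarrow> complex \<Rightarrow> bool" where
  "has_improper_integral f I \<longleftrightarrow>
     (\<forall>e>0. set_integrable lborel {e<..} f) \<and>
     ((\<lambda>e. LINT x:{e<..}|lborel. f x) \<longlongrightarrow> I) (at_right 0)"

definition improper_integral :: "(real \<Rightarrow> complex) \<Rightarrow> complex" where
  "improper_integral f = (THE I. has_improper_integral f I)"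

definition voronoi_integrand :: "(real \<Rightarrow> real) \<Rightarrow> real \<Rightarrow> nat \<Rightarrow> real \<Rightarrow> complex" where
  "voronoi_integrand F y n x =
     complex_of_real (cos (4 * pi\<^sup>2 * real n / (x * y))) * fourier F x / complex_of_real x"

end

(* Write f(u) = F(uy) and let psi(t) = (2/t) times the cosine transform of f at 1/t. Poisson summation
   for the dilates of f gives, with psi_k(t) = psi(t/k)/k,
     sum_k f(kt) = -f(0)/2 + (1/t) int f + sum_k psi_k(t).
   Summing over t = 1, ..., M and applying Poisson summation to each psi_k on [0, M], the sums over the
   points turn into sum_{j,k} 2 J(jk), where J(n) = int cos(2 pi n t) psi(t) dt is the improper integral
   of the statement after the substitution x = 2 pi/(yt). What remains is int_0^M sum_k psi_k, which is
   evaluated through int_e^M sum_k f(kt) dt = int f(u) (H(u/e) - H(u/M)) du with H the summatory function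
   of 1/k; H(x) = ln x + gamma + o(1) produces the logarithm and one Euler constant, the other one comes
   from sum_{m <= M} (1/m) int f.
   All rearrangements are absolutely convergent because psi extends to a C^2 function on [0, oo), which
   gives J(n) = O(n^-2). Poisson summation itself is the Euler-Maclaurin formula of order two combined
   with the Fourier series of the second Bernoulli polynomial. *)

theory Submission
  imports Defs "HOL-Real_Asymp.Real_Asymp" "HOL-Probability.Sinc_Integral"
begin

section \<open>The Fourier series of the second Bernoulli polynomial\<close>

text \<open>The even extension of F has a corner at 0, since its odd one-sided derivatives need not
  vanish there. Hence psi is in general not a Schwartz function: near 0 it vanishes only to first
  order, with a slope proportional to f'(0), and at infinity it behaves like (2/t) int f. So psi is
  in general not integrable, and J(n) is only a conditionally convergent integral. For this reason
  Poisson summation is phrased as a limit of trapezoidal errors on [0, M], in which the sum and the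
  integral may diverge separately, and the class of functions asks for an integrable second
  derivative but not for an integrable function. The same formula serves for the dilates of f, where
  both parts do converge, and for psi_k. The term F(0)/4 comes from the far endpoint: sum_k psi_k(t)
  tends to f(0)/2, and the trapezoidal rule counts the point M with weight 1/2. The growing
  quantities M f(0)/2 and (int f) ln M cancel between the sum over the points and the integral over
  [0, M].\<close>

lemma Dirichlet_kernel:
  fixes u :: real
  shows "(1 + 2 * (\<Sum>j<N. cos (2 * pi * real (Suc j) * u))) * sin (pi * u) = sin ((2 * real N + 1) * pi * u)"
proof (induction N)
  case 0
  then show ?case by simp
next
  case (Suc N)
  have "2 * (cos (2 * pi * real (Suc N) * u) * sin (pi * u)) =
      sin (2 * pi * real (Suc N) * u + pi * u) - sin (2 * pi * real (Suc N) * u - pi * u)"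
    by (subst cos_times_sin) simp
  also have "2 * pi * real (Suc N) * u + pi * u = (2 * real (Suc N) + 1) * pi * u"
    by (simp add: algebra_simps)
  also have "2 * pi * real (Suc N) * u - pi * u = (2 * real N + 1) * pi * u"
    by (simp add: algebra_simps)
  finally have "2 * (cos (2 * pi * real (Suc N) * u) * sin (pi * u)) =
      sin ((2 * real (Suc N) + 1) * pi * u) - sin ((2 * real N + 1) * pi * u)" .
  with Suc show ?case unfolding sum.lessThan_Suc distrib_left distrib_right by linarith
qed

lemma has_integral_by_FTC:
  fixes G :: "real \<Rightarrow> real"
  assumes "a \<le> b" "\<And>x. x \<in> {a..b} \<Longrightarrow> (G has_real_derivative g x) (at x)"
  shows "(g has_integral (G b - G a)) {a..b}"
  using assms
  by (intro fundamental_theorem_of_calculus)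
    (auto simp: has_real_derivative_iff_has_vector_derivative[symmetric] intro: has_field_derivative_at_within)

text \<open>Only the difference from the series at 1/2 is evaluated, \<open>(-1) ^ Suc j\<close>
  being the cosine there: on [x, 1/2] the function \<open>sin (pi * u)\<close> stays away from its
  zeros, and the missing constant can be fixed afterwards.\<close>

lemma cos_series_diff_sums:
  fixes x :: real
  assumes x: "0 < x" "x \<le> 1 / 2"
  shows "(\<lambda>j. cos (2 * pi * real (Suc j) * x) / (pi * real (Suc j))\<^sup>2 - (-1) ^ Suc j / (pi * real (Suc j))\<^sup>2)
    sums (x - 1 / 2)\<^sup>2"
proof -
  \<comment> \<open>\<open>G N\<close> is an antiderivative of \<open>(u - x)\<close> times the Dirichlet kernel; one integration by
    parts against the smooth factor \<open>p\<close> (with \<open>p x = 0\<close>) shows that its increment is \<open>O(1/N)\<close>.\<close>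
  define c where "c j u = cos (2 * pi * real (Suc j) * u)" for j :: nat and u :: real
  define G where "G N u = (u - x)\<^sup>2 / 2 + 2 * (\<Sum>j<N. (u - x) * sin (2 * pi * real (Suc j) * u) / (2 * pi * real (Suc j))
      + c j u / (2 * pi * real (Suc j))\<^sup>2)" for N :: nat and u :: real
  define p where "p u = (u - x) / sin (pi * u)" for u
  define p' where "p' u = (sin (pi * u) - (u - x) * (pi * cos (pi * u))) / (sin (pi * u))\<^sup>2" for u
  have sin_pos: "sin (pi * u) > 0" if "u \<in> {x..1/2}" for u
  proof (rule sin_gt_zero)
    show "pi * u < pi" using that by auto
  qed (use that x in auto)
  have dG: "(G N has_real_derivative (u - x) * (1 + 2 * (\<Sum>j<N. c j u))) (at u)" for N u
  proof -
    have "(G N has_real_derivative (u - x) + 2 * (\<Sum>j<N. (u - x) * c j u)) (at u)"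
      unfolding G_def c_def
    proof (intro DERIV_add DERIV_cmult DERIV_sum)
      show "((\<lambda>u. (u - x)\<^sup>2 / 2) has_real_derivative u - x) (at u)"
        by (auto intro!: derivative_eq_intros)
      have "((\<lambda>u. (u - x) * sin (r * u) / r + cos (r * u) / r\<^sup>2) has_real_derivative (u - x) * cos (r * u)) (at u)"
        if "r > 0" for r
        using that by (auto intro!: derivative_eq_intros simp: power2_eq_square field_simps)
      from this[of "2 * pi * real (Suc _)"]
      show "((\<lambda>u. (u - x) * sin (2 * pi * real (Suc j) * u) / (2 * pi * real (Suc j)) + cos (2 * pi * real (Suc j) * u) / (2 * pi * real (Suc j))\<^sup>2)
          has_real_derivative (u - x) * cos (2 * pi * real (Suc j) * u)) (at u)" for j
        by simp
    qed
    then show ?thesis by (simp add: algebra_simps sum_distrib_left)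
  qed
  have i1: "((\<lambda>u. p u * sin ((2 * real N + 1) * pi * u)) has_integral (G N (1/2) - G N x)) {x..1/2}" for N
  proof -
    have "((\<lambda>u. (u - x) * (1 + 2 * (\<Sum>j<N. c j u))) has_integral (G N (1/2) - G N x)) {x..1/2}"
      using x dG by (intro has_integral_by_FTC) auto
    moreover have "(u - x) * (1 + 2 * (\<Sum>j<N. c j u)) = p u * sin ((2 * real N + 1) * pi * u)" if "u \<in> {x..1/2}" for u
      using sin_pos[OF that] by (simp add: p_def c_def flip: Dirichlet_kernel)
    ultimately show ?thesis by (rule has_integral_eq[rotated])
  qed
  have cp': "continuous_on {x..1/2} p'"
    unfolding p'_def using sin_pos by (intro continuous_intros) force+
  obtain K where "\<forall>w\<in>p' ` {x..1/2}. norm w \<le> K"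
    using compact_imp_bounded[OF compact_continuous_image[OF cp' compact_Icc]]
    unfolding bounded_iff by blast
  then have K: "\<bar>p' u\<bar> \<le> K" if "u \<in> {x..1/2}" for u
    using that by force
  have bound: "\<bar>G N (1/2) - G N x\<bar> \<le> K / ((2 * real N + 1) * pi)" for N
  proof -
    define w where "w = (2 * real N + 1) * pi"
    have w: "w > 0" unfolding w_def by (intro mult_pos_pos) auto
    define H where "H u = - p u * cos (w * u) / w" for u
    have dH: "(H has_real_derivative (p u * sin (w * u) - p' u * cos (w * u) / w)) (at u)" if "u \<in> {x..1/2}" for u
      using sin_pos[OF that] w unfolding H_def p_def p'_def
      by (auto intro!: derivative_eq_intros simp: field_simps power2_eq_square)
    have "((\<lambda>u. p u * sin (w * u) - p' u * cos (w * u) / w) has_integral (H (1/2) - H x)) {x..1/2}"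
      using x dH by (intro has_integral_by_FTC) auto
    \<comment> \<open>\<open>w / 2\<close> is an odd multiple of pi / 2, which is the reason for the
      endpoint 1/2; at x the factor \<open>u - x\<close> in \<open>p\<close> removes the other
      boundary term.\<close>
    moreover have "cos (w * (1/2)) = 0"
      unfolding w_def cos_zero_iff
      by (rule disjI1, rule exI[of _ "2 * N + 1"]) (auto simp: algebra_simps)
    then have "H (1/2) = 0" by (simp add: H_def)
    moreover have "H x = 0" by (simp add: H_def p_def)
    ultimately have "((\<lambda>u. p u * sin (w * u) - p' u * cos (w * u) / w) has_integral 0) {x..1/2}" by simp
    from has_integral_diff[OF i1[of N, folded w_def] this]
    have i2: "((\<lambda>u. p' u * cos (w * u) / w) has_integral (G N (1/2) - G N x)) {x..1/2}" by simp
    have "norm (G N (1/2) - G N x) \<le> K / w * measure lborel (cbox x (1/2))"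
    proof (rule has_integral_bound)
      show "0 \<le> K / w" using K[of x] x w by (intro divide_nonneg_pos) auto
      show "((\<lambda>u. p' u * cos (w * u) / w) has_integral (G N (1/2) - G N x)) (cbox x (1/2))"
        using i2 by simp
      show "norm (p' u * cos (w * u) / w) \<le> K / w" if "u \<in> cbox x (1/2)" for u
      proof -
        have "\<bar>p' u\<bar> * \<bar>cos (w * u)\<bar> \<le> K * 1"
          using that K[of u] by (intro mult_mono) (auto intro: order_trans[OF abs_ge_zero])
        then show ?thesis using w by (simp add: abs_mult divide_right_mono)
      qed
    qed
    also have "\<dots> \<le> K / w * 1"
      using x K[of x] w by (intro mult_left_mono divide_nonneg_pos) auto
    finally show ?thesis by (simp add: w_def)
  qed
  have "(\<lambda>N. K / ((2 * real N + 1) * pi)) \<longlonglongrightarrow> 0"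
    by real_asymp
  then have lim: "(\<lambda>N. G N (1/2) - G N x) \<longlonglongrightarrow> 0"
    by (rule Lim_null_comparison[rotated]) (use bound in auto)
  \<comment> \<open>The sine terms of \<open>G\<close> drop out at both endpoints, at x because of
    their factor \<open>u - x\<close>.\<close>
  have diff: "G N (1/2) - G N x = (x - 1 / 2)\<^sup>2 / 2 - (\<Sum>j<N. cos (2 * pi * real (Suc j) * x) / (pi * real (Suc j))\<^sup>2 - (-1) ^ Suc j / (pi * real (Suc j))\<^sup>2) / 2" for N
  proof -
    have "sin (2 * pi * real (Suc j) * (1/2)) = 0" for j
      using sin_npi2[of "Suc j"] by simp
    moreover have "c j (1/2) = (-1) ^ Suc j" for j
      using cos_npi2[of "Suc j"] by (simp add: c_def)
    ultimately have "G N (1/2) - G N x = (1/2 - x)\<^sup>2 / 2 + (\<Sum>j<N. 2 * ((-1) ^ Suc j / (2 * pi * real (Suc j))\<^sup>2)) - (\<Sum>j<N. 2 * (cos (2 * pi * real (Suc j) * x) / (2 * pi * real (Suc j))\<^sup>2))"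
      by (simp only: G_def sum_distrib_left) (simp add: c_def)
    also have "\<dots> = (x - 1 / 2)\<^sup>2 / 2 + ((\<Sum>j<N. 2 * ((-1) ^ Suc j / (2 * pi * real (Suc j))\<^sup>2)) - (\<Sum>j<N. 2 * (cos (2 * pi * real (Suc j) * x) / (2 * pi * real (Suc j))\<^sup>2)))"
      by (simp add: power2_commute)
    also have "\<dots> = (x - 1 / 2)\<^sup>2 / 2 - (\<Sum>j<N. (cos (2 * pi * real (Suc j) * x) / (pi * real (Suc j))\<^sup>2 - (-1) ^ Suc j / (pi * real (Suc j))\<^sup>2) / 2)"
      unfolding sum_subtractf[symmetric]
      unfolding diff_conv_add_uminus[of "(x - 1/2)\<^sup>2 / 2"] sum_negf[symmetric]
      by (intro arg_cong2[of _ _ _ _ "(+)"] refl sum.cong) (simp add: power_mult_distrib diff_divide_distrib add_divide_distrib)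
    finally show ?thesis by (simp add: sum_divide_distrib)
  qed
  have "(\<lambda>N. (x - 1 / 2)\<^sup>2 - 2 * (G N (1/2) - G N x)) \<longlonglongrightarrow> (x - 1 / 2)\<^sup>2 - 2 * 0"
    by (intro tendsto_intros lim)
  then show ?thesis unfolding sums_def diff by simp
qed

lemma summable_inverse_Suc_squares: "summable (\<lambda>j. c / (real (Suc j))\<^sup>2)"
  using summable_mult[OF sums_summable[OF inverse_squares_sums], of c] by (simp add: add.commute)

text \<open>The right-hand side is the Bernoulli polynomial B_2. The difference formula gives it on
  ]0, 1/2] up to a constant; uniform convergence carries this to 0, where the Basel sum fixes the
  constant; the symmetry between x and 1 - x covers the other half.\<close>

theorem Bernoulli2_Fourier_series:
  fixes x :: real
  assumes x: "0 \<le> x" "x \<le> 1"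
  shows "(\<lambda>j. cos (2 * pi * real (Suc j) * x) / (pi * real (Suc j))\<^sup>2) sums (x\<^sup>2 - x + 1 / 6)"
proof -
  define c where "c x j = cos (2 * pi * real (Suc j) * x) / (pi * real (Suc j))\<^sup>2" for x j
  have bnd: "norm (c x j) \<le> (1 / pi\<^sup>2) / (real (Suc j))\<^sup>2" for x j
    by (auto simp: c_def power_mult_distrib divide_simps)
  have smb: "summable (\<lambda>j. (1 / pi\<^sup>2) / (real (Suc j))\<^sup>2)" by (rule summable_inverse_Suc_squares)
  have sm: "summable (c x)" for x
    by (rule summable_comparison_test'[OF smb bnd])
  define T where "T x = suminf (c x)" for x
  have unif: "uniform_limit UNIV (\<lambda>n x. \<Sum>j<n. c x j) T sequentially"
    unfolding T_def using bnd smb by (intro Weierstrass_m_test) auto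
  have contT: "continuous_on UNIV T"
    by (rule uniform_limit_theorem[OF _ unif]) (auto simp: c_def intro!: always_eventually continuous_intros)
  have sma: "summable (\<lambda>j. (-1) ^ Suc j / (pi * real (Suc j))\<^sup>2)"
    by (rule summable_comparison_test'[OF smb, of 0]) (auto simp: power_mult_distrib divide_simps)
  define a where "a = (\<Sum>j. (-1) ^ Suc j / (pi * real (Suc j))\<^sup>2)"
  have half: "T x = (x - 1 / 2)\<^sup>2 + a" if "0 < x" "x \<le> 1 / 2" for x
    using sums_unique2[OF cos_series_diff_sums[OF that]] sums_diff[OF summable_sums[OF sm[of x]] summable_sums[OF sma]]
    unfolding T_def a_def c_def by fastforce
  have half': "T x = (x - 1 / 2)\<^sup>2 + a" if "0 \<le> x" "x \<le> 1 / 2" for x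
  proof -
    have "T x - (x - 1 / 2)\<^sup>2 - a = 0"
    proof (rule continuous_constant_on_closure[where S = "{0<..1/2::real}" and f = "\<lambda>x. T x - (x - 1 / 2)\<^sup>2 - a"])
      show "continuous_on (closure {0<..1/2}) (\<lambda>x. T x - (x - 1 / 2)\<^sup>2 - a)"
        by (intro continuous_intros continuous_on_subset[OF contT]) auto
    qed (use that half in auto)
    then show ?thesis by simp
  qed
  have "c 0 = (\<lambda>j. (1 / pi\<^sup>2) * (1 / (real j + 1)\<^sup>2))"
    by (auto simp: c_def power_mult_distrib add.commute)
  then have "c 0 sums ((1 / pi\<^sup>2) * (pi\<^sup>2 / 6))"
    using sums_mult[OF inverse_squares_sums, of "1 / pi\<^sup>2"] by (simp add: add.commute)
  then have "T 0 = 1 / 6" unfolding T_def by (simp add: sums_iff)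
  with half'[of 0] have a: "a = - 1 / 12" by (simp add: power2_eq_square)
  have sym: "T (1 - x) = T x"
  proof -
    have "cos (2 * pi * real (Suc j) * (1 - x)) = cos (2 * pi * real (Suc j) * x)" for j
    proof -
      have "cos (2 * pi * real (Suc j) * (1 - x)) = cos (2 * pi * real (Suc j) - 2 * pi * real (Suc j) * x)"
        by (simp add: algebra_simps)
      also have "\<dots> = cos (2 * pi * real (Suc j) * x)"
        using cos_npi2[of "2 * Suc j"] sin_npi2[of "2 * Suc j"] unfolding cos_diff
        by (simp add: mult_ac)
      finally show ?thesis .
    qed
    then show ?thesis unfolding T_def c_def by (simp only:)
  qed
  have "T x = (x - 1 / 2)\<^sup>2 + a"
  proof (cases "x \<le> 1 / 2")
    case False
    then show ?thesis using half'[of "1 - x"] x sym by (simp add: power2_eq_square algebra_simps)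
  qed (use half' x in auto)
  then have "x\<^sup>2 - x + 1 / 6 = T x" using a by (simp add: power2_eq_square algebra_simps)
  then show ?thesis
    using summable_sums[OF sm[of x]] unfolding T_def c_def by (simp only:)
qed

section \<open>Poisson summation on the half-line\<close>

lemma set_integrable_mult_bounded:
  fixes f g :: "real \<Rightarrow> real"
  assumes f: "set_integrable lborel A f" and g: "g \<in> borel_measurable borel" and K: "\<And>x. \<bar>g x\<bar> \<le> K"
  shows "set_integrable lborel A (\<lambda>x. f x * g x)"
    and "\<bar>LINT x:A|lborel. f x * g x\<bar> \<le> K * (LINT x:A|lborel. \<bar>f x\<bar>)"
proof -
  have f': "integrable lborel (\<lambda>x. indicator A x * f x)"
    using f by (simp add: set_integrable_def)
  have bnd: "\<bar>(indicator A x * f x) * g x\<bar> \<le> K * (indicator A x * \<bar>f x\<bar>)" for x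
  proof -
    have "\<bar>indicator A x * f x\<bar> * \<bar>g x\<bar> \<le> \<bar>indicator A x * f x\<bar> * K"
      by (intro mult_left_mono K) auto
    then show ?thesis by (simp add: abs_mult mult_ac)
  qed
  have iK: "integrable lborel (\<lambda>x. K * (indicator A x * \<bar>f x\<bar>))"
    using integrable_norm[OF f'] by (intro integrable_mult_right) (simp add: abs_mult)
  have m: "(\<lambda>x. (indicator A x * f x) * g x) \<in> borel_measurable lborel"
    by (rule borel_measurable_times[OF borel_measurable_integrable[OF f']]) (use g in simp)
  have int: "integrable lborel (\<lambda>x. (indicator A x * f x) * g x)"
    by (rule Bochner_Integration.integrable_bound[OF iK m]) (use bnd in \<open>auto intro: order_trans[OF _ abs_ge_self]\<close>)
  then show "set_integrable lborel A (\<lambda>x. f x * g x)"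
    by (simp add: set_integrable_def mult_ac)
  have "\<bar>LINT x|lborel. (indicator A x * f x) * g x\<bar> \<le> (LINT x|lborel. \<bar>(indicator A x * f x) * g x\<bar>)"
    by (rule integral_abs_bound)
  also have "\<dots> \<le> (LINT x|lborel. K * (indicator A x * \<bar>f x\<bar>))"
    using int bnd by (intro integral_mono iK integrable_abs) auto
  finally show "\<bar>LINT x:A|lborel. f x * g x\<bar> \<le> K * (LINT x:A|lborel. \<bar>f x\<bar>)"
    by (simp add: set_lebesgue_integral_def mult_ac)
qed

text \<open>The derivative is asked for only in the open interval, because the functions below are
  differentiated only at positive points while the intervals may start at 0.\<close>

lemma LINT_Icc_FTC:
  fixes G g :: "real \<Rightarrow> real"
  assumes "a \<le> b" "continuous_on {a..b} G"
    and "\<And>x. a < x \<Longrightarrow> x < b \<Longrightarrow> (G has_real_derivative g x) (at x)"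
    and "set_integrable lborel {a..b} g"
  shows "(LINT x:{a..b}|lborel. g x) = G b - G a"
proof -
  have "(g has_integral (G b - G a)) {a..b}"
    using assms
    by (intro fundamental_theorem_of_calculus_interior)
      (auto simp: has_real_derivative_iff_has_vector_derivative[symmetric])
  then show ?thesis
    using set_borel_integral_eq_integral(2)[OF assms(4)] by (simp add: integral_unique)
qed

lemma LINT_Icc_split:
  fixes f :: "real \<Rightarrow> real"
  assumes "a \<le> b" "b \<le> c" "set_integrable lborel {a..c} f"
  shows "(LINT x:{a..c}|lborel. f x) = (LINT x:{a..b}|lborel. f x) + (LINT x:{b..c}|lborel. f x)"
proof -
  have "set_integrable lborel {a..b} f" "set_integrable lborel {b..c} f"
    using assms by (auto intro: set_integrable_subset[OF assms(3)])
  then show ?thesis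
    using assms Henstock_Kurzweil_Integration.integral_combine[of a b c f]
    by (simp add: set_borel_integral_eq_integral)
qed

lemma trig_integer_period:
  "cos (2 * pi * real j * real k) = 1" "sin (2 * pi * real j * real k) = 0"
proof -
  have "2 * pi * real j * real k = real (2 * j * k) * pi" by simp
  then show "cos (2 * pi * real j * real k) = 1" "sin (2 * pi * real j * real k) = 0"
    by (simp_all only: cos_npi sin_npi) simp
qed

text \<open>\<open>h2 0\<close> is irrelevant; the derivatives at \<open>0\<close> enter only through the continuity of \<open>h1\<close>.\<close>

locale decaying_C2 =
  fixes h h1 h2 :: "real \<Rightarrow> real"
  assumes cont: "continuous_on {0..} h" and cont1: "continuous_on {0..} h1"
    and der: "\<And>t. t > 0 \<Longrightarrow> (h has_real_derivative h1 t) (at t)"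
    and der1: "\<And>t. t > 0 \<Longrightarrow> (h1 has_real_derivative h2 t) (at t)"
    and int2: "set_integrable lborel {0..} h2"
    and lim: "(h \<longlongrightarrow> 0) at_top" and lim1: "(h1 \<longlongrightarrow> 0) at_top"
begin

lemma set_integrable_cos [intro]:
  assumes "0 \<le> a"
  shows "set_integrable lborel {a..b} (\<lambda>t. h t * cos (w * t))"
  by (intro borel_integrable_atLeastAtMost' continuous_intros continuous_on_subset[OF cont]) (use assms in auto)

lemma set_integrable_h [intro]: "0 \<le> a \<Longrightarrow> set_integrable lborel {a..b} h"
  using set_integrable_cos[of a b 0] by simp

lemma set_integrable_h2: "0 \<le> a \<Longrightarrow> set_integrable lborel {a..b} h2"
  by (rule set_integrable_subset[OF int2]) auto

lemma set_integrable_h2_cos: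
  "set_integrable lborel {0..} (\<lambda>t. h2 t * cos (w * t))"
  "0 \<le> a \<Longrightarrow> set_integrable lborel {a..b} (\<lambda>t. h2 t * cos (w * t))"
  by (intro set_integrable_mult_bounded(1)[where K = 1] int2 set_integrable_h2; simp)+

text \<open>Both integrations by parts are done at once: in the derivative of \<open>G\<close> the
  two terms with \<open>h1 t * sin (w * t) / w\<close> cancel.\<close>

lemma LINT_cos:
  assumes ab: "0 \<le> a" "a \<le> b" and w: "w \<noteq> 0"
  shows "(LINT t:{a..b}|lborel. h t * cos (w * t)) =
    (h1 b * cos (w * b) - h1 a * cos (w * a)) / w\<^sup>2 + (h b * sin (w * b) - h a * sin (w * a)) / w
      - (LINT t:{a..b}|lborel. h2 t * cos (w * t)) / w\<^sup>2"
proof -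
  define G where "G t = h1 t * cos (w * t) / w\<^sup>2 + h t * sin (w * t) / w" for t
  have "(LINT t:{a..b}|lborel. h t * cos (w * t) + (h2 t * cos (w * t)) / w\<^sup>2) = G b - G a"
  proof (rule LINT_Icc_FTC)
    show "continuous_on {a..b} G"
      unfolding G_def using w ab
      by (intro continuous_intros continuous_on_subset[OF cont] continuous_on_subset[OF cont1]) auto
    show "set_integrable lborel {a..b} (\<lambda>t. h t * cos (w * t) + h2 t * cos (w * t) / w\<^sup>2)"
      using ab by (intro set_integral_add set_integrable_divide set_integrable_cos set_integrable_h2_cos)
    fix t assume "a < t"
    then have "t > 0" using ab by simp
    with w show "(G has_real_derivative h t * cos (w * t) + h2 t * cos (w * t) / w\<^sup>2) (at t)"
      unfolding G_def
      by (auto intro!: derivative_eq_intros der der1 simp: power2_eq_square field_simps)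
  qed (use ab in auto)
  moreover have "(LINT t:{a..b}|lborel. h t * cos (w * t) + (h2 t * cos (w * t)) / w\<^sup>2) =
      (LINT t:{a..b}|lborel. h t * cos (w * t)) + (LINT t:{a..b}|lborel. h2 t * cos (w * t)) / w\<^sup>2"
    using ab by (subst set_integral_add) (auto intro: set_integrable_h2_cos)
  ultimately show ?thesis
    by (simp add: G_def diff_divide_distrib add_divide_distrib)
qed

lemma LINT_h2: "0 \<le> a \<Longrightarrow> a \<le> b \<Longrightarrow> (LINT t:{a..b}|lborel. h2 t) = h1 b - h1 a"
  by (rule LINT_Icc_FTC) (auto intro: set_integrable_h2 der1 continuous_on_subset[OF cont1])

lemma abs_LINT_h2_cos_le:
  assumes "0 \<le> a"
  shows "\<bar>LINT t:{a..b}|lborel. h2 t * cos (w * t)\<bar> \<le> (LINT t:{0..}|lborel. \<bar>h2 t\<bar>)"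
proof -
  have "\<bar>LINT t:{a..b}|lborel. h2 t * cos (w * t)\<bar> \<le> 1 * (LINT t:{a..b}|lborel. \<bar>h2 t\<bar>)"
    using assms by (intro set_integrable_mult_bounded(2) set_integrable_h2) auto
  also have "\<dots> \<le> (LINT t:{0..}|lborel. \<bar>h2 t\<bar>)"
    using set_integrable_abs[OF int2] set_integrable_abs[OF set_integrable_h2[OF assms, of b]] assms
    by (auto simp: set_integrable_def set_lebesgue_integral_def intro!: integral_mono split: split_indicator)
  finally show ?thesis .
qed

lemma abs_h1_le: "0 \<le> b \<Longrightarrow> \<bar>h1 b\<bar> \<le> \<bar>h1 0\<bar> + (LINT t:{0..}|lborel. \<bar>h2 t\<bar>)"
  using LINT_h2[of 0 b] abs_LINT_h2_cos_le[of 0 b 0] by simp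

text \<open>The Euler-Maclaurin formula of order two on one period. After two integrations by parts
  each cosine integral is an integral against \<open>h2\<close>; summing over j turns the cosines
  into B_2(t - m), and integrating by parts back recovers the trapezoidal error.\<close>

lemma sums_unit_interval:
  "(\<lambda>j. 2 * (LINT t:{real m..real m + 1}|lborel. h t * cos (2 * pi * real (Suc j) * t)))
     sums ((h (real m) + h (real m + 1)) / 2 - (LINT t:{real m..real m + 1}|lborel. h t))"
proof -
  define I where "I = {real m..real m + 1}"
  define b where "b j = 1 / (pi * real (Suc j))\<^sup>2" for j
  define f where "f j t = h2 t * (b j * cos (2 * pi * real (Suc j) * t))" for j t
  have b0: "b j \<ge> 0" for j by (simp add: b_def)
  have bs: "b sums (1 / 6)"
    using Bernoulli2_Fourier_series[of 0] unfolding b_def[abs_def] by simp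
  have iI: "set_integrable lborel I h2" unfolding I_def by (rule set_integrable_h2) simp
  note trig = trig_integer_period[of "Suc _"]
  have summand: "2 * (LINT t:I|lborel. h t * cos (2 * pi * real (Suc j) * t)) =
      (h1 (real m + 1) - h1 (real m)) / 2 * b j - (LINT t:I|lborel. f j t) / 2" for j
  proof -
    have "(LINT t:I|lborel. f j t) = b j * (LINT t:I|lborel. h2 t * cos (2 * pi * real (Suc j) * t))"
      unfolding f_def by (subst set_integral_mult_right[symmetric]) (simp add: mult_ac)
    moreover define w where "w = 2 * pi * real (Suc j)"
    moreover have "b j = 4 / w\<^sup>2" by (simp add: b_def w_def power_mult_distrib)
    moreover have "cos (w * real m) = 1" "sin (w * real m) = 0" "cos (w * (real m + 1)) = 1" "sin (w * (real m + 1)) = 0" "w \<noteq> 0"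
      using trig[of j m] trig[of j "Suc m"] by (simp_all add: w_def add.commute)
    moreover have "2 * ((x - y - L) / W) = (x - y) / 2 * (4 / W) - 4 / W * L / 2" for x y L W :: real
      by (simp add: diff_divide_distrib add_divide_distrib algebra_simps)
    ultimately show ?thesis
      using LINT_cos[of "real m" "real m + 1" w] by (simp add: I_def del: of_nat_Suc flip: diff_divide_distrib)
  qed
  have bern: "(\<lambda>j. b j * cos (2 * pi * real (Suc j) * t)) sums ((t - real m)\<^sup>2 - (t - real m) + 1 / 6)" if "t \<in> I" for t
  proof -
    have "cos (2 * pi * real (Suc j) * t) = cos (2 * pi * real (Suc j) * (t - real m))" for j
      using trig[of j m] by (simp add: right_diff_distrib cos_diff del: of_nat_Suc)
    then show ?thesis
      using Bernoulli2_Fourier_series[of "t - real m"] that by (simp add: I_def b_def del: of_nat_Suc)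
  qed
  have fint: "set_integrable lborel I (f j)" for j
    unfolding f_def
  proof (rule set_integrable_mult_bounded(1)[OF iI])
    show "\<bar>b j * cos (2 * pi * real (Suc j) * t)\<bar> \<le> b j" for t
      using b0[of j] mult_left_mono[of "\<bar>cos (2 * pi * real (Suc j) * t)\<bar>" 1 "b j"] by (simp add: abs_mult)
  qed simp
  have fle: "\<bar>f j t\<bar> \<le> b j * \<bar>h2 t\<bar>" for j t
    using mult_left_mono[of "\<bar>cos (2 * pi * real (Suc j) * t)\<bar>" 1 "\<bar>h2 t\<bar> * b j"] b0[of j]
    by (simp add: f_def abs_mult mult_ac)
  \<comment> \<open>Exchange of sum and integral with the majorants
    \<open>b j * \<bar>h2 t\<bar>\<close>, where the \<open>b j\<close> add up to 1/6.\<close>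
  have "(\<lambda>j. LINT t|lborel. indicator I t *\<^sub>R f j t) sums (LINT t|lborel. (\<Sum>j. indicator I t *\<^sub>R f j t))"
  proof (rule sums_integral)
    show "integrable lborel (\<lambda>t. indicator I t *\<^sub>R f j t)" for j
      using fint by (simp add: set_integrable_def)
    show "AE t in lborel. summable (\<lambda>j. norm (indicator I t *\<^sub>R f j t))"
    proof (rule AE_I2)
      fix t
      show "summable (\<lambda>j. norm (indicator I t *\<^sub>R f j t))"
        by (rule summable_comparison_test'[OF summable_mult2[OF sums_summable[OF bs], of "\<bar>h2 t\<bar>"], of 0])
          (use fle in \<open>auto split: split_indicator simp: b0\<close>)
    qed
    show "summable (\<lambda>j. LINT t|lborel. norm (indicator I t *\<^sub>R f j t))"
    proof (rule summable_comparison_test'[OF summable_mult2[OF sums_summable[OF bs], of "LINT t:I|lborel. \<bar>h2 t\<bar>"], of 0])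
      fix j
      have "(LINT t|lborel. norm (indicator I t *\<^sub>R f j t)) \<le> (LINT t:I|lborel. b j * \<bar>h2 t\<bar>)"
        unfolding set_lebesgue_integral_def
      proof (rule integral_mono)
        show "integrable lborel (\<lambda>t. norm (indicator I t *\<^sub>R f j t))"
          using fint[of j] unfolding set_integrable_def by (rule integrable_norm)
        show "integrable lborel (\<lambda>t. indicator I t *\<^sub>R (b j * \<bar>h2 t\<bar>))"
          using set_integrable_mult_right[OF set_integrable_abs[OF iI], of "b j"] by (simp add: set_integrable_def)
      qed (use fle in \<open>auto split: split_indicator\<close>)
      then show "norm (LINT t|lborel. norm (indicator I t *\<^sub>R f j t)) \<le> b j * (LINT t:I|lborel. \<bar>h2 t\<bar>)"
        by (simp add: Bochner_Integration.integral_nonneg)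
    qed
  qed
  also have "(LINT t|lborel. (\<Sum>j. indicator I t *\<^sub>R f j t)) = (LINT t:I|lborel. h2 t * ((t - real m)\<^sup>2 - (t - real m) + 1 / 6))"
    unfolding set_lebesgue_integral_def
  proof (intro Bochner_Integration.integral_cong refl)
    fix t
    show "(\<Sum>j. indicator I t *\<^sub>R f j t) = indicator I t *\<^sub>R (h2 t * ((t - real m)\<^sup>2 - (t - real m) + 1 / 6))"
      using sums_mult[OF bern, of t "h2 t"] by (auto split: split_indicator simp: f_def sums_iff)
  qed
  finally have fs: "(\<lambda>j. LINT t:I|lborel. f j t) sums (LINT t:I|lborel. h2 t * ((t - real m)\<^sup>2 - (t - real m) + 1 / 6))"
    by (simp add: set_lebesgue_integral_def)
  define P where "P = (LINT t:I|lborel. h2 t * ((t - real m)\<^sup>2 - (t - real m) + 1 / 6))"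
  have Pint: "set_integrable lborel I (\<lambda>t. h2 t * ((t - real m)\<^sup>2 - (t - real m) + 1 / 6))"
  proof -
    \<comment> \<open>The polynomial is bounded only on \<open>I\<close>, whereas the multiplication
      lemma wants a global bound; clamping to [-1, 1] changes nothing on \<open>I\<close>.\<close>
    have "set_integrable lborel I (\<lambda>t. h2 t * max (-1) (min 1 ((t - real m)\<^sup>2 - (t - real m) + 1 / 6)))"
      by (rule set_integrable_mult_bounded(1)[OF iI, where K = 1]) auto
    moreover have "max (-1) (min 1 ((t - real m)\<^sup>2 - (t - real m) + 1 / 6)) = (t - real m)\<^sup>2 - (t - real m) + 1 / 6" if "t \<in> I" for t
    proof -
      have "(t - real m)\<^sup>2 \<le> t - real m"
        using that mult_left_le[of "t - real m" "t - real m"] by (auto simp: I_def power2_eq_square)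
      moreover have "(t - real m)\<^sup>2 \<ge> 0" "t - real m \<le> 1" using that by (auto simp: I_def)
      ultimately have "(t - real m)\<^sup>2 - (t - real m) + 1 / 6 \<le> 1" "-1 \<le> (t - real m)\<^sup>2 - (t - real m) + 1 / 6"
        by linarith+
      then show ?thesis by (simp only: min_absorb2 max_absorb2)
    qed
    ultimately show ?thesis by (simp cong: set_integrable_cong)
  qed
  \<comment> \<open>\<open>t - m - 1/2\<close> is B_1, half the derivative of B_2, so the terms with
    \<open>h1\<close> cancel in the derivative of \<open>G\<close>. The values 1/6 of B_2 and -1/2,
    1/2 of B_1 at the endpoints give the boundary terms.\<close>
  define G where "G t = ((t - real m)\<^sup>2 - (t - real m) + 1 / 6) * h1 t / 2 - (t - real m - 1 / 2) * h t" for t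
  have hint: "set_integrable lborel I h" unfolding I_def by auto
  have "(LINT t:I|lborel. h2 t * ((t - real m)\<^sup>2 - (t - real m) + 1 / 6) / 2 - h t) = G (real m + 1) - G (real m)"
    unfolding I_def
  proof (rule LINT_Icc_FTC)
    show "continuous_on {real m..real m + 1} G" unfolding G_def
      by (intro continuous_intros continuous_on_subset[OF cont] continuous_on_subset[OF cont1]) auto
    show "set_integrable lborel {real m..real m + 1} (\<lambda>t. h2 t * ((t - real m)\<^sup>2 - (t - real m) + 1 / 6) / 2 - h t)"
      using set_integral_diff(1)[OF set_integrable_divide[OF Pint, of 2] hint] by (simp add: I_def)
    fix t assume "real m < t"
    then have "t > 0" by (rule order_le_less_trans[rotated]) simp
    then show "(G has_real_derivative h2 t * ((t - real m)\<^sup>2 - (t - real m) + 1 / 6) / 2 - h t) (at t)"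
      unfolding G_def
      by (auto intro!: derivative_eq_intros der der1 simp: power2_eq_square field_simps)
  qed simp
  moreover have "(LINT t:I|lborel. h2 t * ((t - real m)\<^sup>2 - (t - real m) + 1 / 6) / 2 - h t) = P / 2 - (LINT t:I|lborel. h t)"
    unfolding P_def using set_integral_diff(2)[OF set_integrable_divide[OF Pint, of 2] hint] by simp
  ultimately have P: "P / 2 = (LINT t:I|lborel. h t) + (h1 (real m + 1) - h1 (real m)) / 12 - (h (real m) + h (real m + 1)) / 2"
    by (simp add: G_def field_simps)
  have "(\<lambda>j. (h1 (real m + 1) - h1 (real m)) / 2 * b j - (LINT t:I|lborel. f j t) / 2) sums
      ((h1 (real m + 1) - h1 (real m)) / 2 * (1 / 6) - P / 2)"
    unfolding P_def by (intro sums_diff sums_mult bs sums_divide fs)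
  also have "(h1 (real m + 1) - h1 (real m)) / 2 * (1 / 6) - P / 2 = (h (real m) + h (real m + 1)) / 2 - (LINT t:I|lborel. h t)"
    unfolding P by simp
  finally show ?thesis unfolding summand[symmetric] unfolding I_def .
qed

definition trapezoid_error :: "nat \<Rightarrow> real" where
  "trapezoid_error M = (\<Sum>m<M. (h (real m) + h (real m + 1)) / 2) - (LINT t:{0..real M}|lborel. h t)"

lemma sums_trapezoid_error:
  "(\<lambda>j. 2 * (LINT t:{0..real M}|lborel. h t * cos (2 * pi * real (Suc j) * t))) sums trapezoid_error M"
proof (induction M)
  case 0
  have "(LINT t:{0::real}|lborel. f t) = 0" for f :: "real \<Rightarrow> real"
    unfolding set_lebesgue_integral_def
    by (rule integral_eq_zero_AE, rule AE_mp[OF AE_lborel_singleton[of 0]]) auto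
  then show ?case by (simp add: trapezoid_error_def)
next
  case (Suc M)
  have split: "(LINT t:{0..real (Suc M)}|lborel. h t * cos (w * t)) =
    (LINT t:{0..real M}|lborel. h t * cos (w * t)) + (LINT t:{real M..real M + 1}|lborel. h t * cos (w * t))" for w
    using LINT_Icc_split[of 0 "real M" "real M + 1" "\<lambda>t. h t * cos (w * t)"] by (auto simp: add.commute)
  have "trapezoid_error (Suc M) = trapezoid_error M + ((h (real M) + h (real M + 1)) / 2 - (LINT t:{real M..real M + 1}|lborel. h t))"
    using split[of 0] by (simp add: trapezoid_error_def)
  then show ?case
    unfolding split distrib_left using sums_add[OF Suc sums_unit_interval[of M]] by simp
qed

text \<open>The improper integral of \<open>h t * cos (w * t)\<close> over the half-line, in the form obtained by two
  integrations by parts; \<open>h\<close> itself need not be integrable.\<close>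

definition cos_coeff :: "real \<Rightarrow> real" where
  "cos_coeff w = - (h1 0 + (LINT t:{0..}|lborel. h2 t * cos (w * t))) / w\<^sup>2"

lemma LINT_cos_tendsto:
  assumes w: "w \<noteq> 0"
  shows "((\<lambda>T. LINT t:{0..T}|lborel. h t * cos (w * t)) \<longlongrightarrow> cos_coeff w) at_top"
proof -
  have z: "((\<lambda>T. h T * sin (w * T)) \<longlongrightarrow> 0) at_top" "((\<lambda>T. h1 T * cos (w * T)) \<longlongrightarrow> 0) at_top"
    by (rule Lim_null_comparison[OF _ tendsto_rabs_zero[OF lim]] Lim_null_comparison[OF _ tendsto_rabs_zero[OF lim1]];
      auto simp: abs_mult intro!: always_eventually mult_left_le)+
  have i: "((\<lambda>T. LINT t:{0..T}|lborel. h2 t * cos (w * t)) \<longlongrightarrow> (LINT t:{0..}|lborel. h2 t * cos (w * t))) at_top"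
    by (rule tendsto_set_lebesgue_integral_at_top) (auto intro: set_integrable_h2_cos)
  have "((\<lambda>T. (h1 T * cos (w * T) - h1 0 * cos (w * 0)) / w\<^sup>2 + (h T * sin (w * T) - h 0 * sin (w * 0)) / w
      - (LINT t:{0..T}|lborel. h2 t * cos (w * t)) / w\<^sup>2) \<longlongrightarrow>
      (0 - h1 0 * cos (w * 0)) / w\<^sup>2 + (0 - h 0 * sin (w * 0)) / w - (LINT t:{0..}|lborel. h2 t * cos (w * t)) / w\<^sup>2) at_top"
    using w by (intro tendsto_intros z i) auto
  also have "(0 - h1 0 * cos (w * 0)) / w\<^sup>2 + (0 - h 0 * sin (w * 0)) / w - (LINT t:{0..}|lborel. h2 t * cos (w * t)) / w\<^sup>2 = cos_coeff w"
    by (simp add: cos_coeff_def add_divide_distrib diff_divide_distrib)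
  finally show ?thesis
  proof (rule Lim_transform_eventually)
    show "\<forall>\<^sub>F T in at_top. (h1 T * cos (w * T) - h1 0 * cos (w * 0)) / w\<^sup>2 + (h T * sin (w * T) - h 0 * sin (w * 0)) / w
      - (LINT t:{0..T}|lborel. h2 t * cos (w * t)) / w\<^sup>2 = (LINT t:{0..T}|lborel. h t * cos (w * t))"
      using eventually_ge_at_top[of 0] by eventually_elim (use w in \<open>subst LINT_cos; simp\<close>)
  qed
qed

text \<open>A seminorm that controls the Fourier coefficients and the trapezoidal error. Passing
  from h(t) to c h(rt) multiplies it by c r, which is the inverse square of the index for psi_k;
  this makes the sum over k converge.\<close>

definition C2_norm :: real where
  "C2_norm = \<bar>h1 0\<bar> + (LINT t:{0..}|lborel. \<bar>h2 t\<bar>)"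

lemma abs_cos_coeff_le: "\<bar>cos_coeff w\<bar> \<le> C2_norm / w\<^sup>2"
proof -
  have "\<bar>LINT t:{0..}|lborel. h2 t * cos (w * t)\<bar> \<le> 1 * (LINT t:{0..}|lborel. \<bar>h2 t\<bar>)"
    by (intro set_integrable_mult_bounded(2) int2) auto
  then show ?thesis
    unfolding cos_coeff_def C2_norm_def abs_divide by (auto intro!: divide_right_mono)
qed

text \<open>At the integer M the boundary terms containing a sine vanish. The bound does not depend
  on M and is the majorant for Tannery's theorem in \<open>half_line_Poisson\<close>.\<close>

lemma abs_LINT_cos_le:
  "\<bar>2 * (LINT t:{0..real M}|lborel. h t * cos (2 * pi * real (Suc j) * t))\<bar> \<le> C2_norm * (1 / (pi * real (Suc j))\<^sup>2)"
proof -
  note trig = trig_integer_period[of "Suc j" M]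
  define w where "w = 2 * pi * real (Suc j)"
  have w: "w \<noteq> 0" by (simp add: w_def)
  have eq: "(LINT t:{0..real M}|lborel. h t * cos (w * t)) =
     (h1 (real M) - h1 0 - (LINT t:{0..real M}|lborel. h2 t * cos (w * t))) / w\<^sup>2"
    using LINT_cos[of 0 "real M" w] w trig[folded w_def] by (simp add: diff_divide_distrib)
  have "\<bar>h1 (real M) - h1 0 - (LINT t:{0..real M}|lborel. h2 t * cos (w * t))\<bar> \<le> 2 * C2_norm"
  proof -
    have "\<bar>a - b - c\<bar> \<le> 2 * (\<bar>b\<bar> + I)" if "\<bar>a\<bar> \<le> \<bar>b\<bar> + I" "\<bar>c\<bar> \<le> I" for a b c I :: real
      using that by (smt (verit))
    from this[OF abs_h1_le abs_LINT_h2_cos_le] show ?thesis unfolding C2_norm_def by simp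
  qed
  then have "\<bar>2 * (LINT t:{0..real M}|lborel. h t * cos (w * t))\<bar> \<le> 2 * (2 * C2_norm / w\<^sup>2)"
    unfolding eq abs_mult abs_divide by (auto intro!: divide_right_mono)
  also have "\<dots> = C2_norm * (1 / (pi * real (Suc j))\<^sup>2)"
    by (simp add: w_def power_mult_distrib)
  finally show ?thesis by (simp add: w_def)
qed

text \<open>The factor 1/6 is the sum of the majorants, that is B_2(0). Uniformity in M later
  permits summing over k before M tends to infinity.\<close>

lemma abs_trapezoid_error_le: "\<bar>trapezoid_error M\<bar> \<le> C2_norm / 6"
proof -
  have s: "(\<lambda>j. C2_norm * (1 / (pi * real (Suc j))\<^sup>2)) sums (C2_norm * (1 / 6))"
    using Bernoulli2_Fourier_series[of 0] by (intro sums_mult) simp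
  have "norm (\<Sum>j. 2 * (LINT t:{0..real M}|lborel. h t * cos (2 * pi * real (Suc j) * t))) \<le>
      (\<Sum>j. C2_norm * (1 / (pi * real (Suc j))\<^sup>2))"
    by (rule norm_suminf_le) (use abs_LINT_cos_le sums_summable[OF s] in auto)
  then show ?thesis using sums_unique[OF sums_trapezoid_error[of M]] sums_unique[OF s] by simp
qed

theorem half_line_Poisson:
  "summable (\<lambda>j. cos_coeff (2 * pi * real (Suc j)))"
  "trapezoid_error \<longlonglongrightarrow> (\<Sum>j. 2 * cos_coeff (2 * pi * real (Suc j)))"
proof -
  define a where "a j M = 2 * (LINT t:{0..real M}|lborel. h t * cos (2 * pi * real (Suc j) * t))" for j M
  have s: "(\<lambda>j. C2_norm * (1 / (pi * real (Suc j))\<^sup>2)) sums (C2_norm * (1 / 6))"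
    using Bernoulli2_Fourier_series[of 0] by (intro sums_mult) simp
  have "eventually (\<lambda>M. summable (\<lambda>j. norm (a j M))) sequentially \<and>
      summable (\<lambda>j. norm (2 * cos_coeff (2 * pi * real (Suc j)))) \<and>
      ((\<lambda>M. \<Sum>j. a j M) \<longlonglongrightarrow> (\<Sum>j. 2 * cos_coeff (2 * pi * real (Suc j))))"
  proof (rule tannerys_theorem)
    show "(\<lambda>M. a j M) \<longlonglongrightarrow> 2 * cos_coeff (2 * pi * real (Suc j))" for j
      unfolding a_def
      by (intro tendsto_intros filterlim_compose[OF LINT_cos_tendsto] filterlim_real_sequentially) simp
    show "\<forall>\<^sub>F (j, M) in sequentially \<times>\<^sub>F sequentially. norm (a j M) \<le> C2_norm * (1 / (pi * real (Suc j))\<^sup>2)"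
      by (rule always_eventually) (use abs_LINT_cos_le in \<open>auto simp: a_def simp del: of_nat_Suc\<close>)
  qed (use sums_summable[OF s] in auto)
  moreover have "(\<Sum>j. a j M) = trapezoid_error M" for M
    using sums_unique[OF sums_trapezoid_error[of M]] by (simp add: a_def)
  ultimately show "trapezoid_error \<longlonglongrightarrow> (\<Sum>j. 2 * cos_coeff (2 * pi * real (Suc j)))"
      and "summable (\<lambda>j. cos_coeff (2 * pi * real (Suc j)))"
    using summable_norm_cancel[of "\<lambda>j. 2 * cos_coeff (2 * pi * real (Suc j))"]
      summable_mult_D[of 2 "\<lambda>j. cos_coeff (2 * pi * real (Suc j))"] by auto
qed

end

section \<open>Cosine transforms of Schwartz functions on the half-line\<close>

text \<open>The two bounds combine to the majorant 2K / (1 + t^2). Nothing is assumed at 0, where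
  \<open>ker 2\<close> below carries only a conventional value; that point is split off to get
  measurability on the closed half-line.\<close>

lemma set_integrable_decay:
  fixes g :: "real \<Rightarrow> real"
  assumes g: "continuous_on {0<..} g"
    and K: "\<And>t. t > 0 \<Longrightarrow> \<bar>g t\<bar> \<le> K" "\<And>t. t > 0 \<Longrightarrow> \<bar>t\<^sup>2 * g t\<bar> \<le> K"
  shows "set_integrable lborel {0..} g"
proof -
  have i: "integrable lborel (\<lambda>t::real. 2 * K * inverse (1 + t\<^sup>2))"
    using integrable_inverse_1_plus_square by (simp add: set_integrable_def)
  have "(\<lambda>t. indicator {0<..} t *\<^sub>R g t) \<in> borel_measurable borel"
    by (intro borel_measurable_continuous_on_indicator g) auto
  moreover have "\<bar>g t\<bar> \<le> 2 * K * inverse (1 + t\<^sup>2)" if "t > 0" for t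
  proof -
    have "\<bar>g t\<bar> * (1 + t\<^sup>2) \<le> 2 * K"
      using K[OF that] by (simp add: abs_mult algebra_simps)
    then show ?thesis by (simp add: field_simps add_pos_nonneg)
  qed
  ultimately have "integrable lborel (\<lambda>t. indicator {0<..} t *\<^sub>R g t)"
  proof (intro Bochner_Integration.integrable_bound[OF i] AE_I2)
    fix t
    have "K \<ge> 0" using K(1)[of 1] by simp
    assume "\<And>t. 0 < t \<Longrightarrow> \<bar>g t\<bar> \<le> 2 * K * inverse (1 + t\<^sup>2)"
    from this[of t] \<open>K \<ge> 0\<close> show "norm (indicator {0<..} t *\<^sub>R g t) \<le> norm (2 * K * inverse (1 + t\<^sup>2))"
      by (auto split: split_indicator)
  qed simp
  moreover have "AE t in lborel. indicator {0<..} t *\<^sub>R g t = indicator {0..} t *\<^sub>R g t"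
    by (rule AE_mp[OF AE_lborel_singleton[of 0]]) (auto split: split_indicator)
  moreover have "(\<lambda>t. indicator {0..} t *\<^sub>R g t) \<in> borel_measurable borel"
  proof -
    have "(\<lambda>t. indicator {0<..} t *\<^sub>R g t + indicator {0} t *\<^sub>R g 0) \<in> borel_measurable borel"
      by (intro borel_measurable_add borel_measurable_continuous_on_indicator g) auto
    also have "(\<lambda>t. indicator {0<..} t *\<^sub>R g t + indicator {0} t *\<^sub>R g 0) = (\<lambda>t. indicator {0..} t *\<^sub>R g t)"
      by (auto split: split_indicator simp: fun_eq_iff)
    finally show ?thesis .
  qed
  ultimately show ?thesis
    unfolding set_integrable_def by (subst integrable_cong_AE[symmetric]) auto
qed

lemma LINT_half_line_FTC:
  fixes G g :: "real \<Rightarrow> real"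
  assumes G: "continuous_on {0..} G" "\<And>x. 0 < x \<Longrightarrow> (G has_real_derivative g x) (at x)"
    and g: "set_integrable lborel {0..} g" and L: "(G \<longlongrightarrow> L) at_top"
  shows "(LINT x:{0..}|lborel. g x) = L - G 0"
proof (rule tendsto_unique)
  show "((\<lambda>b. LINT x:{0..b}|lborel. g x) \<longlongrightarrow> (LINT x:{0..}|lborel. g x)) at_top"
    by (rule tendsto_set_lebesgue_integral_at_top[OF _ g]) auto
  have "((\<lambda>b. G b - G 0) \<longlongrightarrow> L - G 0) at_top" by (intro tendsto_intros L)
  then show "((\<lambda>b. LINT x:{0..b}|lborel. g x) \<longlongrightarrow> L - G 0) at_top"
  proof (rule Lim_transform_eventually)
    show "\<forall>\<^sub>F b in at_top. G b - G 0 = (LINT x:{0..b}|lborel. g x)"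
      using eventually_ge_at_top[of 0]
    proof eventually_elim
      case (elim b)
      then show ?case
        by (intro LINT_Icc_FTC[symmetric] G set_integrable_subset[OF g] continuous_on_subset[OF G(1)]) auto
    qed
  qed
qed simp

section \<open>Cosine and sine transforms on the half-line\<close>

definition costr :: "(real \<Rightarrow> real) \<Rightarrow> real \<Rightarrow> real" where
  "costr q s = (LINT t:{0..}|lborel. q t * cos (2 * pi * s * t))"

definition sintr :: "(real \<Rightarrow> real) \<Rightarrow> real \<Rightarrow> real" where
  "sintr q s = (LINT t:{0..}|lborel. q t * sin (2 * pi * s * t))"

text \<open>Collects what one integration by parts against a sine or cosine on the half-line uses.
  The relation is preserved by sums and multiples, so derivatives of weighted functions can be
  assembled summand by summand.\<close>

definition by_parts_pair :: "(real \<Rightarrow> real) \<Rightarrow> (real \<Rightarrow> real) \<Rightarrow> bool" where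
  "by_parts_pair g g' \<longleftrightarrow> continuous_on {0..} g \<and> (\<forall>t>0. (g has_real_derivative g' t) (at t)) \<and>
     set_integrable lborel {0..} g \<and> set_integrable lborel {0..} g' \<and> (g \<longlongrightarrow> 0) at_top"

lemma
  assumes "set_integrable lborel {0..} q"
  shows abs_costr_le: "\<bar>costr q s\<bar> \<le> (LINT t:{0..}|lborel. \<bar>q t\<bar>)"
    and abs_sintr_le: "\<bar>sintr q s\<bar> \<le> (LINT t:{0..}|lborel. \<bar>q t\<bar>)"
    and set_integrable_costr: "set_integrable lborel {0..} (\<lambda>t. q t * cos (2 * pi * s * t))"
    and set_integrable_sintr: "set_integrable lborel {0..} (\<lambda>t. q t * sin (2 * pi * s * t))"
  using set_integrable_mult_bounded[OF assms, of "\<lambda>t. cos (2 * pi * s * t)" 1]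
    set_integrable_mult_bounded[OF assms, of "\<lambda>t. sin (2 * pi * s * t)" 1]
  by (simp_all add: costr_def sintr_def)

lemma
  assumes p: "by_parts_pair g g'" and s: "s > 0"
  shows costr_by_parts: "costr g s = - sintr g' s / (2 * pi * s)"
    and sintr_by_parts: "sintr g s = (g 0 + costr g' s) / (2 * pi * s)"
proof -
  define w where "w = 2 * pi * s"
  have w: "w > 0" using s by (simp add: w_def)
  have cont: "continuous_on {0..} g" and der: "\<And>t. t > 0 \<Longrightarrow> (g has_real_derivative g' t) (at t)"
    and i: "set_integrable lborel {0..} g" "set_integrable lborel {0..} g'" and lim: "(g \<longlongrightarrow> 0) at_top"
    using p unfolding by_parts_pair_def by auto
  note ints = set_integrable_costr[OF i(1), of s, folded w_def] set_integrable_sintr[OF i(1), of s, folded w_def]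
    set_integrable_costr[OF i(2), of s, folded w_def] set_integrable_sintr[OF i(2), of s, folded w_def]
  have z: "((\<lambda>T. g T * sin (w * T)) \<longlongrightarrow> 0) at_top" "((\<lambda>T. g T * cos (w * T)) \<longlongrightarrow> 0) at_top"
    by (rule Lim_null_comparison[OF _ tendsto_rabs_zero[OF lim]];
      auto simp: abs_mult intro!: always_eventually mult_left_le)+
  have "(LINT t:{0..}|lborel. w * (g t * cos (w * t)) + g' t * sin (w * t)) = 0 - g 0 * sin (w * 0)"
    by (rule LINT_half_line_FTC[where G = "\<lambda>t. g t * sin (w * t)"])
      (auto intro!: continuous_intros cont derivative_eq_intros der z set_integral_add ints)
  moreover have "(LINT t:{0..}|lborel. w * (g t * cos (w * t)) + g' t * sin (w * t)) = w * costr g s + sintr g' s"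
    by (subst set_integral_add(2)) (intro set_integrable_mult_right ints | simp add: costr_def sintr_def w_def)+
  ultimately have "w * costr g s = - sintr g' s" by simp
  then show "costr g s = - sintr g' s / (2 * pi * s)"
    using w unfolding w_def by (metis nonzero_mult_div_cancel_left less_irrefl)
  have "(LINT t:{0..}|lborel. g' t * cos (w * t) - w * (g t * sin (w * t))) = 0 - g 0 * cos (w * 0)"
    by (rule LINT_half_line_FTC[where G = "\<lambda>t. g t * cos (w * t)"])
      (auto intro!: continuous_intros cont derivative_eq_intros der z set_integral_diff ints)
  moreover have "(LINT t:{0..}|lborel. g' t * cos (w * t) - w * (g t * sin (w * t))) = costr g' s - w * sintr g s"
    by (subst set_integral_diff(2)) (intro set_integrable_mult_right ints | simp add: costr_def sintr_def w_def)+
  ultimately have "w * sintr g s = g 0 + costr g' s" by simp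
  then show "sintr g s = (g 0 + costr g' s) / (2 * pi * s)"
    using w unfolding w_def by (metis nonzero_mult_div_cancel_left less_irrefl)
qed

text \<open>Two applications of the mean value theorem, which yield the constant 1 instead of
  Taylor's 1/2; only the quadratic order in x matters below, and x may be negative.\<close>

lemma second_order_remainder:
  fixes f :: "real \<Rightarrow> real"
  assumes f: "\<And>t. (f has_real_derivative f1 t) (at t)" and f1: "\<And>t. (f1 has_real_derivative f2 t) (at t)"
    and f2: "\<And>t. \<bar>f2 t\<bar> \<le> 1"
  shows "\<bar>f (a + x) - f a - x * f1 a\<bar> \<le> x\<^sup>2"
proof (cases "x = 0")
  case False
  have mvt: "\<exists>z. \<bar>z - a\<bar> \<le> \<bar>y\<bar> \<and> g (a + y) - g a = y * g' z"
    if "\<And>t. (g has_real_derivative g' t) (at t)" for g g' :: "real \<Rightarrow> real" and y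
  proof (cases "y = 0")
    case False
    then consider "a < a + y" | "a + y < a" by linarith
    then show ?thesis
    proof cases
      case 1
      from MVT2[OF 1 that] obtain z where "a < z" "z < a + y" "g (a + y) - g a = (a + y - a) * g' z" by blast
      then show ?thesis by (intro exI[of _ z]) auto
    next
      case 2
      from MVT2[OF 2 that] obtain z where "z < a" "a + y < z" "g a - g (a + y) = (a - (a + y)) * g' z" by blast
      then show ?thesis by (intro exI[of _ z]) (auto simp: algebra_simps)
    qed
  qed auto
  obtain z where z: "\<bar>z - a\<bar> \<le> \<bar>x\<bar>" "f (a + x) - f a = x * f1 z" using mvt[OF f] by blast
  obtain z' where z': "f1 (a + (z - a)) - f1 a = (z - a) * f2 z'" using mvt[OF f1] by blast
  have "f (a + x) - f a - x * f1 a = x * (f1 (a + (z - a)) - f1 a)"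
    unfolding z(2) by (simp add: algebra_simps)
  also have "\<bar>\<dots>\<bar> \<le> \<bar>x\<bar> * (\<bar>x\<bar> * 1)"
    unfolding z' abs_mult by (intro mult_mono z f2 order_refl) auto
  finally show ?thesis by (simp add: power2_eq_square flip: abs_mult)
qed simp

text \<open>Differentiation under the integral sign with an explicit rate: the pointwise
  second-order remainder is at most
  \<open>(2 * pi * e)\<^sup>2 * \<bar>t\<^sup>2 * q t\<bar>\<close>, so the second moment of q
  bounds the error of the difference quotient by a multiple of \<open>\<bar>e\<bar>\<close>.\<close>

lemma oscillatory_integral_derivative:
  fixes \<phi> :: "real \<Rightarrow> real"
  assumes \<phi>: "\<And>t. (\<phi> has_real_derivative \<phi>1 t) (at t)" and \<phi>1: "\<And>t. (\<phi>1 has_real_derivative \<phi>2 t) (at t)"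
    and b: "\<And>t. \<bar>\<phi> t\<bar> \<le> 1" "\<And>t. \<bar>\<phi>1 t\<bar> \<le> 1" "\<And>t. \<bar>\<phi>2 t\<bar> \<le> 1"
    and q: "set_integrable lborel {0..} q" "set_integrable lborel {0..} (\<lambda>t. t * q t)" "set_integrable lborel {0..} (\<lambda>t. t\<^sup>2 * q t)"
  shows "((\<lambda>s. LINT t:{0..}|lborel. q t * \<phi> (2 * pi * s * t)) has_real_derivative
     2 * pi * (LINT t:{0..}|lborel. (t * q t) * \<phi>1 (2 * pi * s * t))) (at s)"
proof -
  define I where "I s = (LINT t:{0..}|lborel. q t * \<phi> (2 * pi * s * t))" for s
  define I1 where "I1 = (LINT t:{0..}|lborel. (t * q t) * \<phi>1 (2 * pi * s * t))"
  define Q where "Q = (LINT t:{0..}|lborel. \<bar>t\<^sup>2 * q t\<bar>)"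
  have m: "\<phi> \<in> borel_measurable borel" "\<phi>1 \<in> borel_measurable borel"
    by (auto intro!: borel_measurable_continuous_onI continuous_at_imp_continuous_on DERIV_isCont \<phi> \<phi>1)
  have i: "set_integrable lborel {0..} (\<lambda>t. q t * \<phi> (2 * pi * s * t))" for s
    by (rule set_integrable_mult_bounded(1)[OF q(1) _ b(1)]) (use m in measurable)
  have i1: "set_integrable lborel {0..} (\<lambda>t. (t * q t) * \<phi>1 (2 * pi * s * t))"
    by (rule set_integrable_mult_bounded(1)[OF q(2) _ b(2)]) (use m in measurable)
  have est: "\<bar>I (s + e) - I s - 2 * pi * e * I1\<bar> \<le> (2 * pi * e)\<^sup>2 * Q" for e
  proof -
    define R where "R t = q t * \<phi> (2 * pi * (s + e) * t) - q t * \<phi> (2 * pi * s * t) - 2 * pi * e * ((t * q t) * \<phi>1 (2 * pi * s * t))" for t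
    have i2: "set_integrable lborel {0..} R"
      unfolding R_def by (intro set_integral_diff i i1 set_integrable_mult_right)
    have eq: "I (s + e) - I s - 2 * pi * e * I1 = (LINT t:{0..}|lborel. R t)"
      unfolding I_def I1_def R_def
      by (subst set_integral_diff(2) | intro set_integral_diff(1) i i1 set_integrable_mult_right | simp)+
    have Rle: "\<bar>R t\<bar> \<le> (2 * pi * e)\<^sup>2 * \<bar>t\<^sup>2 * q t\<bar>" for t
    proof -
      have "R t = q t * (\<phi> (2 * pi * s * t + 2 * pi * e * t) - \<phi> (2 * pi * s * t) - 2 * pi * e * t * \<phi>1 (2 * pi * s * t))"
        by (simp add: R_def algebra_simps)
      then have "\<bar>R t\<bar> \<le> \<bar>q t\<bar> * (2 * pi * e * t)\<^sup>2"
        unfolding abs_mult[of "q t"] by (simp only: abs_mult, intro mult_left_mono second_order_remainder[OF \<phi> \<phi>1 b(3)]) auto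
      then show ?thesis by (simp add: abs_mult power_mult_distrib mult_ac)
    qed
    have "\<bar>LINT t:{0..}|lborel. R t\<bar> \<le> (LINT t:{0..}|lborel. \<bar>R t\<bar>)"
      using set_integral_norm_bound[OF i2] by simp
    also have "\<dots> \<le> (LINT t:{0..}|lborel. (2 * pi * e)\<^sup>2 * \<bar>t\<^sup>2 * q t\<bar>)"
      by (intro set_integral_mono set_integrable_abs[OF i2] set_integrable_mult_right set_integrable_abs q Rle)
    finally show ?thesis by (simp add: Q_def eq)
  qed
  have "(\<lambda>e. (I (s + e) - I s) / e) \<midarrow>0\<rightarrow> 2 * pi * I1"
  proof (rule Lim_transform[OF tendsto_const])
    have "((\<lambda>e. (2 * pi)\<^sup>2 * \<bar>e\<bar> * Q) \<longlongrightarrow> (2 * pi)\<^sup>2 * \<bar>0\<bar> * Q) (at 0)"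
      by (intro tendsto_intros)
    then have z: "((\<lambda>e. (2 * pi)\<^sup>2 * \<bar>e\<bar> * Q) \<longlongrightarrow> 0) (at 0)" by simp
    show "(\<lambda>e. (I (s + e) - I s) / e - 2 * pi * I1) \<midarrow>0\<rightarrow> 0"
    proof (rule Lim_null_comparison[OF _ z])
      show "\<forall>\<^sub>F e in at 0. norm ((I (s + e) - I s) / e - 2 * pi * I1) \<le> (2 * pi)\<^sup>2 * \<bar>e\<bar> * Q"
        using eventually_neq_at_within[of 0 0 UNIV]
      proof eventually_elim
        case (elim e)
        then have "(I (s + e) - I s) / e - 2 * pi * I1 = (I (s + e) - I s - 2 * pi * e * I1) / e"
          by (simp add: field_simps)
        also have "\<bar>\<dots>\<bar> \<le> (2 * pi * e)\<^sup>2 * Q / \<bar>e\<bar>"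
          unfolding abs_divide by (intro divide_right_mono est) auto
        also have "\<dots> = (2 * pi)\<^sup>2 * \<bar>e\<bar> * Q"
          using elim by (simp add: power_mult_distrib power2_eq_square field_simps)
        finally show ?case by simp
      qed
    qed
  qed
  then show ?thesis unfolding I_def[symmetric] I1_def[symmetric] DERIV_def .
qed

lemma costr_has_derivative:
  assumes "set_integrable lborel {0..} q" "set_integrable lborel {0..} (\<lambda>t. t * q t)" "set_integrable lborel {0..} (\<lambda>t. t\<^sup>2 * q t)"
  shows "(costr q has_real_derivative - 2 * pi * sintr (\<lambda>t. t * q t) s) (at s)"
proof -
  have "((\<lambda>s. LINT t:{0..}|lborel. q t * cos (2 * pi * s * t)) has_real_derivative
     2 * pi * (LINT t:{0..}|lborel. (t * q t) * - sin (2 * pi * s * t))) (at s)"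
    by (rule oscillatory_integral_derivative[of cos "\<lambda>t. - sin t" "\<lambda>t. - cos t"]) (use assms in \<open>auto intro!: derivative_eq_intros\<close>)
  moreover have "(LINT t:{0..}|lborel. (t * q t) * - sin (2 * pi * s * t)) = - sintr (\<lambda>t. t * q t) s"
    by (simp add: sintr_def set_lebesgue_integral_def)
  ultimately show ?thesis by (simp add: costr_def[abs_def])
qed

text \<open>\<open>D n\<close> plays the role of the \<open>n\<close>-th derivative of \<open>D 0\<close> on the closed half-line.\<close>

definition schwartz_seq :: "(nat \<Rightarrow> real \<Rightarrow> real) \<Rightarrow> bool" where
  "schwartz_seq D \<longleftrightarrow> (\<forall>n. continuous_on {0..} (D n)) \<and>
     (\<forall>n. \<forall>t>0. (D n has_real_derivative D (Suc n) t) (at t)) \<and>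
     (\<forall>n m. \<exists>K. \<forall>t\<ge>0. \<bar>t ^ m * D n t\<bar> \<le> K)"

section \<open>Schwartz functions on the half-line and the kernel psi\<close>

locale schwartz =
  fixes D :: "nat \<Rightarrow> real \<Rightarrow> real"
  assumes D: "schwartz_seq D"
begin

lemma cont: "continuous_on {0..} (D n)"
  and der: "t > 0 \<Longrightarrow> (D n has_real_derivative D (Suc n) t) (at t)"
  and decay: "\<exists>K. \<forall>t\<ge>0. \<bar>t ^ m * D n t\<bar> \<le> K"
  using D by (auto simp: schwartz_seq_def)

lemma power_cont: "continuous_on {0..} (\<lambda>t. t ^ m * D n t)"
  by (intro continuous_intros cont)

lemma set_integrable_power: "set_integrable lborel {0..} (\<lambda>t. t ^ m * D n t)"
proof -
  obtain K where K: "\<And>t. t \<ge> 0 \<Longrightarrow> \<bar>t ^ m * D n t\<bar> \<le> K" using decay by blast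
  obtain K' where K': "\<And>t. t \<ge> 0 \<Longrightarrow> \<bar>t ^ (2 + m) * D n t\<bar> \<le> K'" using decay by blast
  show ?thesis
  proof (rule set_integrable_decay)
    show "continuous_on {0<..} (\<lambda>t. t ^ m * D n t)"
      by (rule continuous_on_subset[OF power_cont]) auto
    show "\<bar>t ^ m * D n t\<bar> \<le> max K K'" "\<bar>t\<^sup>2 * (t ^ m * D n t)\<bar> \<le> max K K'" if "t > 0" for t
      using that K[of t] K'[of t] by (auto simp: power_add mult.assoc power2_eq_square)
  qed
qed

lemma set_integrable_D: "set_integrable lborel {0..} (D n)"
  using set_integrable_power[of 0 n] by simp

lemma power_tendsto_0: "((\<lambda>t. t ^ m * D n t) \<longlongrightarrow> 0) at_top"
proof -
  obtain K where K: "\<And>t. t \<ge> 0 \<Longrightarrow> \<bar>t ^ (Suc m) * D n t\<bar> \<le> K" using decay by blast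
  have z: "((\<lambda>t. K / t) \<longlongrightarrow> 0) at_top" by real_asymp
  show ?thesis
  proof (rule Lim_null_comparison[OF _ z])
    show "\<forall>\<^sub>F t in at_top. norm (t ^ m * D n t) \<le> K / t"
      using eventually_gt_at_top[of 0]
    proof eventually_elim
      case (elim t)
      then show ?case using K[of t] by (simp add: abs_mult field_simps)
    qed
  qed
qed

lemma by_parts_pair_power:
  "by_parts_pair (\<lambda>t. t ^ m * D n t) (\<lambda>t. real m * (t ^ (m - 1) * D n t) + t ^ m * D (Suc n) t)"
  unfolding by_parts_pair_def
proof (intro conjI allI impI power_cont set_integrable_power power_tendsto_0 set_integral_add set_integrable_mult_right)
  fix t :: real assume "t > 0"
  then show "((\<lambda>t. t ^ m * D n t) has_real_derivative real m * (t ^ (m - 1) * D n t) + t ^ m * D (Suc n) t) (at t)"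
    by (auto intro!: derivative_eq_intros der)
qed

lemma by_parts_pair_D: "by_parts_pair (D n) (D (Suc n))"
  using by_parts_pair_power[of 0 n] by simp

lemma decaying_C2_D: "decaying_C2 (D n) (D (Suc n)) (D (Suc (Suc n)))"
  using power_tendsto_0[of 0] by unfold_locales (auto intro: cont der set_integrable_D)

lemma costr_add:
  "set_integrable lborel {0..} f \<Longrightarrow> set_integrable lborel {0..} g \<Longrightarrow> costr (\<lambda>t. f t + g t) s = costr f s + costr g s"
  unfolding costr_def distrib_right
  by (rule set_integral_add(2)) (auto intro: set_integrable_costr)

lemma costr_cmult: "costr (\<lambda>t. c * f t) s = c * costr f s"
  by (simp add: costr_def mult.assoc)

text \<open>The function \<open>ker 0\<close> is \<open>psi\<close> of the introduction, and the weights are such that \<open>ker (Suc k)\<close>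
  is the derivative of \<open>ker k\<close>. Division by zero makes all of them vanish at \<open>0\<close>, which is the
  continuous extension for \<open>ker 0\<close> but not for \<open>ker 1\<close>.\<close>

definition ker :: "nat \<Rightarrow> real \<Rightarrow> real" where
  "ker k t = 2 * costr (\<lambda>v. v ^ k * D k v) (1 / t) / t ^ (k + 1)"

text \<open>Substituting v = t u shows that \<open>ker k t\<close> is twice the integral of u^k
  D_k(t u) cos(2 pi u), whose formal t-derivative is \<open>ker (Suc k) t\<close>. The proof
  differentiates \<open>costr\<close> in the frequency instead and integrates the resulting
  \<open>sintr\<close> by parts; the extra multiple \<open>k + 1\<close> of \<open>costr q\<close>
  cancels the derivative of the power of t.\<close>

lemma ker_has_derivative:
  assumes t: "t > 0"
  shows "(ker k has_real_derivative ker (Suc k) t) (at t)"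
proof -
  define q where "q v = v ^ k * D k v" for v
  have qs: "t * q t = t ^ Suc k * D k t" "t\<^sup>2 * q t = t ^ (2 + k) * D k t" for t
    by (simp_all add: q_def power_add power2_eq_square)
  have dq: "(costr q has_real_derivative - 2 * pi * sintr (\<lambda>t. t * q t) s) (at s)" for s
    by (rule costr_has_derivative; (unfold qs)?) (auto simp: q_def[abs_def] intro: set_integrable_power simp del: power_Suc)
  have s: "sintr (\<lambda>t. t * q t) (1 / t) = (real (k + 1) * costr q (1 / t) + costr (\<lambda>v. v ^ Suc k * D (Suc k) v) (1 / t)) * t / (2 * pi)"
  proof -
    have "sintr (\<lambda>t. t * q t) (1 / t) = costr (\<lambda>v. real (k + 1) * q v + v ^ Suc k * D (Suc k) v) (1 / t) / (2 * pi * (1 / t))"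
      unfolding qs using sintr_by_parts[OF by_parts_pair_power[of "Suc k" k], of "1 / t"] t by (simp add: q_def)
    also have "costr (\<lambda>v. real (k + 1) * q v + v ^ Suc k * D (Suc k) v) (1 / t) =
        real (k + 1) * costr q (1 / t) + costr (\<lambda>v. v ^ Suc k * D (Suc k) v) (1 / t)"
      unfolding q_def
      by (subst costr_add) (intro set_integrable_mult_right set_integrable_power | simp only: costr_cmult)+
    finally show ?thesis using t by simp
  qed
  have "((\<lambda>t. 2 * costr q (1 / t) / t ^ (k + 1)) has_real_derivative
     (2 * (- 2 * pi * sintr (\<lambda>t. t * q t) (1 / t) * (- 1 / t\<^sup>2)) * t ^ (k + 1) - 2 * costr q (1 / t) * (real (k + 1) * t ^ k)) / (t ^ (k + 1))\<^sup>2) (at t)"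
  proof -
    have d1: "((\<lambda>t. t ^ (k + 1)) has_real_derivative real (k + 1) * t ^ k) (at t)"
      using DERIV_pow[of "k + 1" t] by simp
    have d2: "((\<lambda>t. 2 * costr q (1 / t)) has_real_derivative 2 * (- 2 * pi * sintr (\<lambda>t. t * q t) (1 / t) * (- 1 / t\<^sup>2))) (at t)"
      using t by (auto intro!: derivative_eq_intros DERIV_chain2[OF dq] simp: power2_eq_square)
    show ?thesis
      unfolding power2_eq_square[of "t ^ (k + 1)"] by (rule DERIV_divide[OF d2 d1]) (use t in simp)
  qed
  also have "(2 * (- 2 * pi * sintr (\<lambda>t. t * q t) (1 / t) * (- 1 / t\<^sup>2)) * t ^ (k + 1) - 2 * costr q (1 / t) * (real (k + 1) * t ^ k)) / (t ^ (k + 1))\<^sup>2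
      = ker (Suc k) t"
    unfolding s ker_def using t by (simp add: field_simps power2_eq_square)
  finally show ?thesis by (simp add: ker_def[abs_def] q_def)
qed

lemma abs_ker_le:
  assumes "t > 0"
  shows "\<bar>ker k t\<bar> \<le> 2 * (LINT v:{0..}|lborel. \<bar>v ^ k * D k v\<bar>) / t ^ (k + 1)"
  using abs_costr_le[OF set_integrable_power[of k k], of "1 / t"] assms
  by (simp add: ker_def abs_mult divide_right_mono)

section \<open>Psi as a C^2 function up to the endpoint 0\<close>

lemma costr_by_parts_twice:
  assumes "by_parts_pair g g1" "by_parts_pair g1 g2" "s > 0"
  shows "costr g s = - (g1 0 + costr g2 s) / (2 * pi * s)\<^sup>2"
proof -
  have "costr g s = - ((g1 0 + costr g2 s) / (2 * pi * s)) / (2 * pi * s)"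
    using costr_by_parts[OF assms(1,3)] sintr_by_parts[OF assms(2,3)] by simp
  then show ?thesis
    by (simp only: divide_divide_eq_left minus_divide_left power2_eq_square)
qed

text \<open>Two integrations by parts make the transform O(t^2) at frequency 1/t, and
  \<open>ker 0\<close> divides it by t.\<close>

lemma ker0_near_0: "\<exists>K. \<forall>t>0. \<bar>ker 0 t\<bar> \<le> K * t"
proof -
  define K where "K = 2 * (\<bar>D 1 0\<bar> + (LINT v:{0..}|lborel. \<bar>D 2 v\<bar>)) / (2 * pi)\<^sup>2"
  have "\<bar>ker 0 t\<bar> \<le> K * t" if t: "t > 0" for t
  proof -
    define E where "E = D 1 0 + costr (D 2) (1 / t)"
    have "costr (D 0) (1 / t) = - E / (2 * pi * (1 / t))\<^sup>2"
      using costr_by_parts_twice[OF by_parts_pair_D[of 0] by_parts_pair_D[of "Suc 0"], of "1 / t"] t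
      by (simp add: E_def numeral_2_eq_2)
    then have "ker 0 t = - (2 * E / (2 * pi)\<^sup>2 * t)"
      using t by (simp add: ker_def power2_eq_square)
    then have "\<bar>ker 0 t\<bar> = 2 * \<bar>D 1 0 + costr (D 2) (1 / t)\<bar> / (2 * pi)\<^sup>2 * t"
      unfolding E_def[symmetric] using t by (simp add: abs_mult)
    also have "\<dots> \<le> K * t"
      unfolding K_def using t abs_costr_le[OF set_integrable_D[of 2], of "1 / t"]
      by (intro mult_right_mono divide_right_mono mult_left_mono) auto
    finally show ?thesis .
  qed
  then show ?thesis by blast
qed

text \<open>\<open>ker 1\<close> divides by t^2, so the boundary term \<open>D 1 0\<close> of the
  second integration by parts survives as the limit; a third integration by parts shows that the
  rest is O(t).\<close>

lemma ker1_tendsto: "(ker 1 \<longlongrightarrow> - 2 * D 1 0 / (2 * pi)\<^sup>2) (at_right 0)"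
proof -
  define g2 where "g2 v = D 2 v + (D 2 v + v * D 3 v)" for v
  define g3 where "g3 v = D 3 v + (D 3 v + (D 3 v + v * D 4 v))" for v
  have p1: "by_parts_pair (\<lambda>v. v * D 1 v) (\<lambda>v. D 1 v + v * D 2 v)"
    using by_parts_pair_power[of 1 1] by (simp add: numeral_2_eq_2)
  have add: "by_parts_pair (\<lambda>v. f v + g v) (\<lambda>v. f' v + g' v)" if "by_parts_pair f f'" "by_parts_pair g g'" for f g f' g'
    using that tendsto_add[of f 0 at_top g 0] unfolding by_parts_pair_def
    by (auto intro!: continuous_intros derivative_eq_intros set_integral_add)
  have p2: "by_parts_pair (\<lambda>v. D 1 v + v * D 2 v) g2"
    unfolding g2_def using add[OF by_parts_pair_D[of 1] by_parts_pair_power[of 1 2]]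
    by (simp add: numeral_2_eq_2 numeral_3_eq_3)
  have p3: "by_parts_pair g2 g3"
    unfolding g2_def g3_def
    using add[OF by_parts_pair_D[of 2] add[OF by_parts_pair_D[of 2] by_parts_pair_power[of 1 3]]]
    by (simp add: eval_nat_numeral)
  then have i3: "set_integrable lborel {0..} g3" by (simp add: by_parts_pair_def)
  have eq: "ker 1 t = - 2 * (D 1 0 - sintr g3 (1 / t) * t / (2 * pi)) / (2 * pi)\<^sup>2" if t: "t > 0" for t
  proof -
    define X where "X = D 1 0 - sintr g3 (1 / t) * t / (2 * pi)"
    have "costr (\<lambda>v. v * D 1 v) (1 / t) = - X / (2 * pi)\<^sup>2 * t\<^sup>2"
      unfolding X_def
      using costr_by_parts_twice[OF p1 p2, of "1 / t"] costr_by_parts[OF p3, of "1 / t"] t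
      by (simp add: power_divide power_mult_distrib field_simps)
    then show ?thesis unfolding X_def[symmetric] using t by (simp add: ker_def power2_eq_square)
  qed
  have "((\<lambda>t. sintr g3 (1 / t) * t) \<longlongrightarrow> 0) (at_right 0)"
  proof (rule Lim_null_comparison)
    show "\<forall>\<^sub>F t in at_right 0. norm (sintr g3 (1 / t) * t) \<le> (LINT v:{0..}|lborel. \<bar>g3 v\<bar>) * \<bar>t\<bar>"
      by (rule always_eventually) (auto simp: abs_mult intro!: mult_right_mono abs_sintr_le[OF i3])
    have "((\<lambda>t::real. (LINT v:{0..}|lborel. \<bar>g3 v\<bar>) * \<bar>t\<bar>) \<longlongrightarrow> (LINT v:{0..}|lborel. \<bar>g3 v\<bar>) * \<bar>0\<bar>) (at_right 0)"
      by (intro tendsto_intros)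
    then show "((\<lambda>t::real. (LINT v:{0..}|lborel. \<bar>g3 v\<bar>) * \<bar>t\<bar>) \<longlongrightarrow> 0) (at_right 0)" by simp
  qed
  then have "((\<lambda>t. - 2 * (D 1 0 - sintr g3 (1 / t) * t / (2 * pi)) / (2 * pi)\<^sup>2) \<longlongrightarrow> - 2 * (D 1 0 - 0 / (2 * pi)) / (2 * pi)\<^sup>2) (at_right 0)"
    by (intro tendsto_intros) auto
  then have "((\<lambda>t. - 2 * (D 1 0 - sintr g3 (1 / t) * t / (2 * pi)) / (2 * pi)\<^sup>2) \<longlongrightarrow> - 2 * D 1 0 / (2 * pi)\<^sup>2) (at_right 0)"
    by simp
  then show ?thesis
    by (rule Lim_transform_eventually) (use eq in \<open>auto simp: eventually_at_right_less eventually_at_filter\<close>)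
qed

text \<open>Three integrations by parts without any boundary term compensate the division by t^3: in
  the first and the third the sine vanishes at 0, in the second the derivative of
  \<open>v\<^sup>2 * D 2 v\<close> does.\<close>

lemma ker2_bounded: "\<exists>K. \<forall>t>0. \<bar>ker 2 t\<bar> \<le> K"
proof -
  \<comment> \<open>\<open>g2\<close> and \<open>g3\<close> are the second and third derivatives of
    \<open>v\<^sup>2 * D 2 v\<close>, left unsimplified so that the closure rules \<open>add\<close>
    and \<open>twice\<close> match their shape.\<close>
  define g2 where "g2 v = (2 * D 2 v + 2 * (v * D 3 v)) + (2 * (v * D 3 v) + v\<^sup>2 * D 4 v)" for v
  define g3 where "g3 v = (2 * D 3 v + 2 * (D 3 v + v * D 4 v)) + (2 * (D 3 v + v * D 4 v) + (2 * (v * D 4 v) + v\<^sup>2 * D 5 v))" for v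
  have add: "by_parts_pair (\<lambda>v. f v + g v) (\<lambda>v. f' v + g' v)" if "by_parts_pair f f'" "by_parts_pair g g'" for f g f' g'
    using that tendsto_add[of f 0 at_top g 0] unfolding by_parts_pair_def
    by (auto intro!: continuous_intros derivative_eq_intros set_integral_add)
  have twice: "by_parts_pair (\<lambda>v. 2 * f v) (\<lambda>v. 2 * f' v)" if "by_parts_pair f f'" for f f'
    using that tendsto_mult_right_zero[of f at_top 2] unfolding by_parts_pair_def
    by (auto intro!: continuous_intros derivative_eq_intros)
  have d: "by_parts_pair (D 2) (D 3)" "by_parts_pair (D 3) (D 4)" "by_parts_pair (D 4) (D 5)"
    using by_parts_pair_D[of 2] by_parts_pair_D[of 3] by_parts_pair_D[of 4] by (simp_all add: eval_nat_numeral)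
  have v: "by_parts_pair (\<lambda>v. v * D 2 v) (\<lambda>v. D 2 v + v * D 3 v)" "by_parts_pair (\<lambda>v. v * D 3 v) (\<lambda>v. D 3 v + v * D 4 v)"
    using by_parts_pair_power[of 1 2] by_parts_pair_power[of 1 3] by (simp_all add: eval_nat_numeral)
  have v2: "by_parts_pair (\<lambda>v. v\<^sup>2 * D 2 v) (\<lambda>v. 2 * (v * D 2 v) + v\<^sup>2 * D 3 v)"
     "by_parts_pair (\<lambda>v. v\<^sup>2 * D 3 v) (\<lambda>v. 2 * (v * D 3 v) + v\<^sup>2 * D 4 v)"
     "by_parts_pair (\<lambda>v. v\<^sup>2 * D 4 v) (\<lambda>v. 2 * (v * D 4 v) + v\<^sup>2 * D 5 v)"
    using by_parts_pair_power[of 2 2] by_parts_pair_power[of 2 3] by_parts_pair_power[of 2 4] by (simp_all add: eval_nat_numeral)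
  have p2: "by_parts_pair (\<lambda>v. 2 * (v * D 2 v) + v\<^sup>2 * D 3 v) g2"
    using add[OF twice[OF v(1)] v2(2)] unfolding g2_def distrib_left .
  have p3: "by_parts_pair g2 g3"
    unfolding g2_def g3_def by (intro add twice d v v2)
  then have i3: "set_integrable lborel {0..} g3" by (simp add: by_parts_pair_def)
  have eq: "ker 2 t = 2 * sintr g3 (1 / t) / (2 * pi) ^ 3" if t: "t > 0" for t
  proof -
    have "costr (\<lambda>v. v\<^sup>2 * D 2 v) (1 / t) = sintr g3 (1 / t) / (2 * pi) ^ 3 * t ^ 3"
      using costr_by_parts_twice[OF v2(1) p2, of "1 / t"] costr_by_parts[OF p3, of "1 / t"] t
      by (simp add: power_divide power_mult_distrib power2_eq_square power3_eq_cube)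
    then show ?thesis using t by (simp add: ker_def power3_eq_cube)
  qed
  have "\<bar>ker 2 t\<bar> \<le> 2 * (LINT v:{0..}|lborel. \<bar>g3 v\<bar>) / (2 * pi) ^ 3" if t: "t > 0" for t
    unfolding eq[OF t] abs_mult abs_divide using abs_sintr_le[OF i3, of "1 / t"]
    by (auto intro!: divide_right_mono)
  then show ?thesis by blast
qed

definition ker_derivative :: "real \<Rightarrow> real" where
  "ker_derivative t = (if t = 0 then - 2 * D 1 0 / (2 * pi)\<^sup>2 else ker 1 t)"

lemma ker_tendsto_0: "(ker k \<longlongrightarrow> 0) at_top"
proof (rule Lim_null_comparison)
  show "\<forall>\<^sub>F t in at_top. norm (ker k t) \<le> 2 * (LINT v:{0..}|lborel. \<bar>v ^ k * D k v\<bar>) / t ^ (k + 1)"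
    using eventually_gt_at_top[of 0] by eventually_elim (use abs_ker_le in auto)
  show "((\<lambda>t::real. 2 * (LINT v:{0..}|lborel. \<bar>v ^ k * D k v\<bar>) / t ^ (k + 1)) \<longlongrightarrow> 0) at_top"
    by (intro tendsto_divide_0[OF tendsto_const] filterlim_at_top_imp_at_infinity filterlim_pow_at_top filterlim_ident) auto
qed

lemma ker_continuous: "continuous_on {0<..} (ker k)"
  by (auto intro!: continuous_at_imp_continuous_on DERIV_isCont[OF ker_has_derivative])

text \<open>Boundedness serves on ]0, 1], the decay t^-3 from \<open>abs_ker_le\<close> beyond
  1.\<close>

lemma set_integrable_ker2: "set_integrable lborel {0..} (ker 2)"
proof -
  obtain K where K: "\<And>t. t > 0 \<Longrightarrow> \<bar>ker 2 t\<bar> \<le> K" using ker2_bounded by blast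
  define L where "L = 2 * (LINT v:{0..}|lborel. \<bar>v\<^sup>2 * D 2 v\<bar>)"
  show ?thesis
  proof (rule set_integrable_decay[OF ker_continuous])
    show "\<bar>ker 2 t\<bar> \<le> max K L" if "t > 0" for t using K[OF that] by simp
    show "\<bar>t\<^sup>2 * ker 2 t\<bar> \<le> max K L" if t: "t > 0" for t
    proof (cases "t \<le> 1")
      case True
      then have "t\<^sup>2 * \<bar>ker 2 t\<bar> \<le> 1 * K" using t K[OF t] by (intro mult_mono power_le_one) auto
      then show ?thesis by (simp add: abs_mult)
    next
      case False
      have "\<bar>ker 2 t\<bar> \<le> L / t ^ 3" using abs_ker_le[OF t, of 2] by (simp add: L_def eval_nat_numeral)
      then have "t\<^sup>2 * \<bar>ker 2 t\<bar> \<le> t\<^sup>2 * (L / t ^ 3)" by (intro mult_left_mono) auto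
      also have "\<dots> = L / t" using t by (simp add: power2_eq_square power3_eq_cube)
      also have "L \<ge> 0" by (simp add: L_def set_lebesgue_integral_def Bochner_Integration.integral_nonneg)
      then have "L / t \<le> L" using False mult_left_mono[of 1 t L] by (simp add: divide_le_eq)
      finally show ?thesis by (simp add: abs_mult)
    qed
  qed
qed

lemma ker_0 [simp]: "ker k 0 = 0"
  by (simp add: ker_def)

lemma decaying_C2_ker: "decaying_C2 (ker 0) ker_derivative (ker 2)"
proof
  have ext: "continuous_on {0..} f" if "continuous_on {0<..} f" "(f \<longlongrightarrow> f 0) (at_right 0)" for f :: "real \<Rightarrow> real"
  proof -
    have "continuous (at x within {0..}) f" if "x \<ge> 0" for x
    proof (cases "x = 0")
      case True
      then show ?thesis using \<open>(f \<longlongrightarrow> f 0) (at_right 0)\<close> by (simp add: continuous_within at_within_Ici_at_right)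
    next
      case False
      then have "isCont f x"
        using \<open>continuous_on {0<..} f\<close> that by (intro continuous_on_interior) (auto simp: interior_open)
      then show ?thesis by (rule continuous_at_imp_continuous_at_within)
    qed
    then show ?thesis by (simp add: continuous_on_eq_continuous_within)
  qed
  obtain K where K: "\<And>t. t > 0 \<Longrightarrow> \<bar>ker 0 t\<bar> \<le> K * t" using ker0_near_0 by blast
  show "continuous_on {0..} (ker 0)"
  proof (rule ext[OF ker_continuous])
    have "((\<lambda>t. K * t) \<longlongrightarrow> K * 0) (at_right 0)" by (intro tendsto_intros)
    then have z: "((\<lambda>t. K * t) \<longlongrightarrow> 0) (at_right 0)" by simp
    show "(ker 0 \<longlongrightarrow> ker 0 0) (at_right 0)"
      unfolding ker_0
      by (rule Lim_null_comparison[OF _ z]) (use K in \<open>auto simp: eventually_at_filter\<close>)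
  qed
  show "continuous_on {0..} ker_derivative"
  proof (rule ext)
    show "continuous_on {0<..} ker_derivative"
      by (rule continuous_on_eq[OF ker_continuous[of 1]]) (auto simp: ker_derivative_def)
    show "(ker_derivative \<longlongrightarrow> ker_derivative 0) (at_right 0)"
      using ker1_tendsto unfolding ker_derivative_def[of 0] if_P[OF refl]
      by (rule Lim_transform_eventually) (auto simp: ker_derivative_def eventually_at_filter)
  qed
  show "(ker 0 has_real_derivative ker_derivative t) (at t)" if "t > 0" for t
    using ker_has_derivative[OF that, of 0] that by (simp add: ker_derivative_def)
  show "(ker_derivative has_real_derivative ker 2 t) (at t)" if "t > 0" for t
  proof -
    have "(ker 1 has_real_derivative ker 2 t) (at t)"
      using ker_has_derivative[OF that, of 1] by (simp add: numeral_2_eq_2)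
    then show ?thesis
      by (rule has_field_derivative_transform_within_open[where S = "{0<..}"]) (use that in \<open>auto simp: ker_derivative_def\<close>)
  qed
  show "(ker 0 \<longlongrightarrow> 0) at_top" by (rule ker_tendsto_0)
  show "(ker_derivative \<longlongrightarrow> 0) at_top"
    using ker_tendsto_0[of 1]
  proof (rule Lim_transform_eventually)
    show "\<forall>\<^sub>F t in at_top. ker 1 t = ker_derivative t"
      using eventually_gt_at_top[of 0] by eventually_elim (simp add: ker_derivative_def)
  qed
qed (rule set_integrable_ker2)

end

section \<open>Iterating Poisson summation\<close>

lemma
  fixes g :: "real \<Rightarrow> 'a::{banach, second_countable_topology}"
  assumes r: "r > 0"
  shows set_integrable_scale: "set_integrable lborel A g \<Longrightarrow> set_integrable lborel {t. r * t \<in> A} (\<lambda>t. g (r * t))"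
    and LINT_scale: "(LINT t:{t. r * t \<in> A}|lborel. g (r * t)) = (LINT t:A|lborel. g t) /\<^sub>R r"
proof -
  have ind: "indicator {t. r * t \<in> A} t = (indicator A (r * t) :: real)" for t
    by (auto simp: indicator_def)
  show "set_integrable lborel {t. r * t \<in> A} (\<lambda>t. g (r * t))" if "set_integrable lborel A g"
    using lborel_integrable_real_affine[of "\<lambda>t. indicator A t *\<^sub>R g t" r 0] that r
    by (simp add: set_integrable_def ind)
  show "(LINT t:{t. r * t \<in> A}|lborel. g (r * t)) = (LINT t:A|lborel. g t) /\<^sub>R r"
    using lborel_integral_real_affine[of r "\<lambda>t. indicator A t *\<^sub>R g t" 0] r
    by (simp add: set_lebesgue_integral_def ind)
qed

lemma scale_atLeast: "r > 0 \<Longrightarrow> {t. r * t \<in> {0..}} = {0::real..}"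
  by (auto simp: zero_le_mult_iff)

lemma LINT_scale_atLeast:
  fixes g :: "real \<Rightarrow> real"
  assumes "r > 0"
  shows "(LINT t:{0..}|lborel. g (r * t)) = (LINT t:{0..}|lborel. g t) / r"
  using LINT_scale[OF assms, of "{0..}" g] unfolding scale_atLeast[OF assms] by (simp add: divide_inverse)

lemma scale_Icc: "r > 0 \<Longrightarrow> {t. r * t \<in> {r * a..r * b}} = {a::real..b}"
  by auto

text \<open>Used with c = 1 and r = t for the dilates of f, and with c = r = 1/k for psi_k. In the
  latter case the coefficient formula has prefactor 1 and merely multiplies the frequency by
  k.\<close>

lemma
  assumes h: "decaying_C2 h h1 h2" and r: "r > 0" and c: "c > 0"
  shows decaying_C2_scale: "decaying_C2 (\<lambda>t. c * h (r * t)) (\<lambda>t. c * r * h1 (r * t)) (\<lambda>t. c * r\<^sup>2 * h2 (r * t))"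
    and C2_norm_scale: "decaying_C2.C2_norm (\<lambda>t. c * r * h1 (r * t)) (\<lambda>t. c * r\<^sup>2 * h2 (r * t)) = c * r * decaying_C2.C2_norm h1 h2"
    and cos_coeff_scale: "decaying_C2.cos_coeff (\<lambda>t. c * r * h1 (r * t)) (\<lambda>t. c * r\<^sup>2 * h2 (r * t)) w = c / r * decaying_C2.cos_coeff h1 h2 (w / r)"
proof -
  interpret decaying_C2 h h1 h2 by (rule h)
  have r': "filterlim (\<lambda>t. r * t) at_top at_top"
    using r by (intro filterlim_tendsto_pos_mult_at_top[OF tendsto_const] filterlim_ident) auto
  show s: "decaying_C2 (\<lambda>t. c * h (r * t)) (\<lambda>t. c * r * h1 (r * t)) (\<lambda>t. c * r\<^sup>2 * h2 (r * t))"
  proof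
    show "continuous_on {0..} (\<lambda>t. c * h (r * t))" "continuous_on {0..} (\<lambda>t. c * r * h1 (r * t))"
      using r by (auto intro!: continuous_intros continuous_on_compose2[OF cont] continuous_on_compose2[OF cont1])
    fix t :: real assume "t > 0"
    then have rt: "r * t > 0" using r by simp
    have "((\<lambda>t. h (r * t)) has_real_derivative h1 (r * t) * r) (at t)"
      by (rule DERIV_chain2[where f = h and g = "\<lambda>t. r * t", OF der[OF rt] DERIV_cmult_Id])
    from DERIV_cmult[OF this, of c]
    show "((\<lambda>t. c * h (r * t)) has_real_derivative c * r * h1 (r * t)) (at t)" by (simp add: mult_ac)
    have "((\<lambda>t. h1 (r * t)) has_real_derivative h2 (r * t) * r) (at t)"
      by (rule DERIV_chain2[where f = h1 and g = "\<lambda>t. r * t", OF der1[OF rt] DERIV_cmult_Id])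
    from DERIV_cmult[OF this, of "c * r"]
    show "((\<lambda>t. c * r * h1 (r * t)) has_real_derivative c * r\<^sup>2 * h2 (r * t)) (at t)"
      by (simp add: mult_ac power2_eq_square)
  next
    show "set_integrable lborel {0..} (\<lambda>t. c * r\<^sup>2 * h2 (r * t))"
      using set_integrable_scale[OF r int2] r by (auto simp: scale_atLeast simp del: atLeast_iff)
    show "((\<lambda>t. c * h (r * t)) \<longlongrightarrow> 0) at_top" "((\<lambda>t. c * r * h1 (r * t)) \<longlongrightarrow> 0) at_top"
      by (intro tendsto_mult_right_zero filterlim_compose[OF lim r'] filterlim_compose[OF lim1 r'])+
  qed
  interpret s: decaying_C2 "\<lambda>t. c * h (r * t)" "\<lambda>t. c * r * h1 (r * t)" "\<lambda>t. c * r\<^sup>2 * h2 (r * t)" by (rule s)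
  note i = LINT_scale_atLeast[OF r]
  show "s.C2_norm = c * r * C2_norm"
    unfolding s.C2_norm_def C2_norm_def using i[of "\<lambda>t. \<bar>h2 t\<bar>"] r c
    by (simp add: abs_mult power2_eq_square field_simps)
  have ie: "(LINT t:{0..}|lborel. c * r\<^sup>2 * h2 (r * t) * cos (w * t)) = c * r * (LINT t:{0..}|lborel. h2 t * cos (w / r * t))"
  proof -
    have "(LINT t:{0..}|lborel. c * r\<^sup>2 * h2 (r * t) * cos (w * t)) = c * r\<^sup>2 * (LINT t:{0..}|lborel. h2 (r * t) * cos (w / r * (r * t)))"
      using r by (simp add: mult.assoc)
    also have "\<dots> = c * r * (LINT t:{0..}|lborel. h2 t * cos (w / r * t))"
      using r i[of "\<lambda>t. h2 t * cos (w / r * t)"] by (simp add: power2_eq_square)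
    finally show ?thesis .
  qed
  show "s.cos_coeff w = c / r * cos_coeff (w / r)"
    \<comment> \<open>For \<open>w = 0\<close> both sides vanish because of division by
      zero.\<close>
    unfolding s.cos_coeff_def cos_coeff_def ie using r by (cases "w = 0") (simp_all add: power2_eq_square field_simps)
qed

context decaying_C2
begin

lemma cos_coeff_eq_LINT:
  assumes "set_integrable lborel {0..} h" "w \<noteq> 0"
  shows "cos_coeff w = (LINT t:{0..}|lborel. h t * cos (w * t))"
proof (rule tendsto_unique)
  show "((\<lambda>T. LINT t:{0..T}|lborel. h t * cos (w * t)) \<longlongrightarrow> cos_coeff w) at_top"
    by (rule LINT_cos_tendsto) fact
  show "((\<lambda>T. LINT t:{0..T}|lborel. h t * cos (w * t)) \<longlongrightarrow> (LINT t:{0..}|lborel. h t * cos (w * t))) at_top"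
    by (rule tendsto_set_lebesgue_integral_at_top) (auto intro!: set_integrable_mult_bounded(1)[where K = 1] assms)
qed simp

lemma sum_trapezoid: "(\<Sum>m<M. (h (real m) + h (real m + 1)) / 2) = h 0 / 2 + (\<Sum>m<M. h (real (Suc m))) - h (real M) / 2"
  by (induction M) (auto simp: field_simps add.commute)

text \<open>With an integrable h and summable values the limit of the trapezoidal error splits into
  its parts, and the half weight at the endpoint M disappears in the limit.\<close>

lemma Poisson_summation:
  assumes i: "set_integrable lborel {0..} h" and s: "summable (\<lambda>m. h (real (Suc m)))"
  shows "(\<lambda>j. 2 * cos_coeff (2 * pi * real (Suc j))) sums (h 0 / 2 + (\<Sum>m. h (real (Suc m))) - (LINT t:{0..}|lborel. h t))"
proof -
  have "trapezoid_error \<longlonglongrightarrow> h 0 / 2 + (\<Sum>m. h (real (Suc m))) - 0 / 2 - (LINT t:{0..}|lborel. h t)"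
    unfolding trapezoid_error_def[abs_def] sum_trapezoid
    by (intro tendsto_intros summable_LIMSEQ s filterlim_compose[OF lim] filterlim_real_sequentially
        filterlim_compose[OF tendsto_set_lebesgue_integral_at_top] i) auto
  then have "(\<Sum>j. 2 * cos_coeff (2 * pi * real (Suc j))) = h 0 / 2 + (\<Sum>m. h (real (Suc m))) - (LINT t:{0..}|lborel. h t)"
    using LIMSEQ_unique[OF half_line_Poisson(2)] by simp
  then show ?thesis
    using summable_sums[OF summable_mult[OF half_line_Poisson(1), of 2]] by simp
qed

end

lemma series_of_integrals:
  fixes f :: "nat \<Rightarrow> real \<Rightarrow> real"
  assumes f: "\<And>k. continuous_on {a..b} (f k)" and B: "\<And>k t. t \<in> {a..b} \<Longrightarrow> \<bar>f k t\<bar> \<le> B k" and sB: "summable B"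
    and ab: "a \<le> b"
  shows "continuous_on {a..b} (\<lambda>t. \<Sum>k. f k t)"
    and "(\<lambda>k. LINT t:{a..b}|lborel. f k t) sums (LINT t:{a..b}|lborel. (\<Sum>k. f k t))"
proof -
  have unif: "uniform_limit {a..b} (\<lambda>n t. \<Sum>k<n. f k t) (\<lambda>t. \<Sum>k. f k t) sequentially"
    using B sB by (intro Weierstrass_m_test) auto
  have c: "continuous_on {a..b} (\<lambda>t. \<Sum>k<n. f k t)" for n by (intro continuous_intros f)
  show cs: "continuous_on {a..b} (\<lambda>t. \<Sum>k. f k t)"
    by (rule uniform_limit_theorem[OF always_eventually unif]) (auto intro: c)
  have eq: "(LINT t:{a..b}|lborel. g t) = integral {a..b} g" if "continuous_on {a..b} g" for g :: "real \<Rightarrow> real"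
    by (intro set_borel_integral_eq_integral borel_integrable_atLeastAtMost' that)
  obtain I J where IJ: "\<And>n. ((\<lambda>t. \<Sum>k<n. f k t) has_integral I n) {a..b}" "((\<lambda>t. \<Sum>k. f k t) has_integral J) {a..b}" "I \<longlonglongrightarrow> J"
    using uniform_limit_integral[OF unif c sequentially_bot] by blast
  have "(\<lambda>n. integral {a..b} (\<lambda>t. \<Sum>k<n. f k t)) \<longlonglongrightarrow> integral {a..b} (\<lambda>t. \<Sum>k. f k t)"
    unfolding integral_unique[OF IJ(1)] integral_unique[OF IJ(2)] by (rule IJ(3))
  moreover have "integral {a..b} (\<lambda>t. \<Sum>k<n. f k t) = (\<Sum>k<n. LINT t:{a..b}|lborel. f k t)" for n
    unfolding eq[OF f]
    by (rule Henstock_Kurzweil_Integration.integral_sum) (intro finite_lessThan integrable_continuous_interval f)+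
  ultimately show "(\<lambda>k. LINT t:{a..b}|lborel. f k t) sums (LINT t:{a..b}|lborel. (\<Sum>k. f k t))"
    unfolding sums_def by (simp add: eq[OF cs])
qed

section \<open>Poisson summation for the dilates of f and for psi_k\<close>

context schwartz
begin

definition multiples_sum :: "real \<Rightarrow> real" where
  "multiples_sum t = (\<Sum>k. D 0 (real (Suc k) * t))"

text \<open>The index is shifted: \<open>psi k\<close> is psi_(k+1) of the introduction. Writing the
  argument as a factor times t lets \<open>decaying_C2_scale\<close> apply literally.\<close>

definition psi :: "nat \<Rightarrow> real \<Rightarrow> real" where
  "psi k t = 1 / real (Suc k) * ker 0 (1 / real (Suc k) * t)"

definition mass :: real where
  "mass = (LINT t:{0..}|lborel. D 0 t)"

lemma D0_quadratic_decay: "\<exists>K\<ge>0. \<forall>t>0. \<bar>D 0 t\<bar> \<le> K / t\<^sup>2"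
proof -
  obtain K where K: "\<And>t. t \<ge> 0 \<Longrightarrow> \<bar>t\<^sup>2 * D 0 t\<bar> \<le> K" using decay by blast
  have "\<bar>D 0 t\<bar> \<le> K / t\<^sup>2" if "t > 0" for t
    using K[of t] that by (simp add: abs_mult field_simps)
  moreover have "K \<ge> 0" using K[of 0] by simp
  ultimately show ?thesis by blast
qed

lemma D0_multiples_le:
  obtains K where "K \<ge> 0" "\<And>k t. t > 0 \<Longrightarrow> \<bar>D 0 (real (Suc k) * t)\<bar> \<le> K / t\<^sup>2 / (real (Suc k))\<^sup>2"
proof -
  obtain K where K: "K \<ge> 0" "\<And>t. t > 0 \<Longrightarrow> \<bar>D 0 t\<bar> \<le> K / t\<^sup>2" using D0_quadratic_decay by blast
  show ?thesis
  proof (rule that[OF K(1)])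
    show "\<bar>D 0 (real (Suc k) * t)\<bar> \<le> K / t\<^sup>2 / (real (Suc k))\<^sup>2" if "t > 0" for k t
      using K(2)[of "real (Suc k) * t"] that by (simp add: power_mult_distrib mult_ac)
  qed
qed

lemma summable_multiples: "t > 0 \<Longrightarrow> summable (\<lambda>k. D 0 (real (Suc k) * t))"
proof -
  assume t: "t > 0"
  obtain K where K: "\<And>k t. t > 0 \<Longrightarrow> \<bar>D 0 (real (Suc k) * t)\<bar> \<le> K / t\<^sup>2 / (real (Suc k))\<^sup>2"
    using D0_multiples_le by metis
  show ?thesis
    by (rule summable_comparison_test'[OF summable_inverse_Suc_squares[of "K / t\<^sup>2"], of 0])
      (use K[OF t] in simp)
qed

lemma psi_sums:
  assumes t: "t > 0"
  shows "(\<lambda>k. psi k t) sums (D 0 0 / 2 + multiples_sum t - mass / t)"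
proof -
  interpret p: decaying_C2 "\<lambda>v. 1 * D 0 (t * v)" "\<lambda>v. 1 * t * D 1 (t * v)" "\<lambda>v. 1 * t\<^sup>2 * D 2 (t * v)"
    using decaying_C2_scale[OF decaying_C2_D[of 0] t, of 1] by (simp add: numeral_2_eq_2)
  have i: "set_integrable lborel {0..} (\<lambda>v. 1 * D 0 (t * v))"
    using set_integrable_scale[OF t set_integrable_D[of 0]] t by (simp add: scale_atLeast del: atLeast_iff)
  have s: "summable (\<lambda>m. 1 * D 0 (t * real (Suc m)))"
    using summable_multiples[OF t] by (simp add: mult.commute)
  \<comment> \<open>The Fourier coefficient of the dilate is \<open>costr (D 0)\<close> at frequency
    (k+1)/t divided by t; this is the origin of the formula for \<open>ker 0\<close>.\<close>
  have "2 * p.cos_coeff (2 * pi * real (Suc k)) = psi k t" for k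
  proof -
    have "p.cos_coeff (2 * pi * real (Suc k)) = (LINT v:{0..}|lborel. D 0 (t * v) * cos (2 * pi * (real (Suc k) / t) * (t * v)))"
      using p.cos_coeff_eq_LINT[OF i, of "2 * pi * real (Suc k)"] t by (simp add: mult_ac)
    also have "\<dots> = costr (D 0) (real (Suc k) / t) / t"
      unfolding costr_def by (rule LINT_scale_atLeast[OF t])
    finally show ?thesis by (simp add: psi_def ker_def del: of_nat_Suc)
  qed
  moreover have "(LINT v:{0..}|lborel. 1 * D 0 (t * v)) = mass / t"
    unfolding mass_def using LINT_scale_atLeast[OF t, of "D 0"] by simp
  ultimately show ?thesis
    using p.Poisson_summation[OF i s] by (simp add: multiples_sum_def mult.commute)
qed

definition psi_sum :: "real \<Rightarrow> real" where
  "psi_sum t = (\<Sum>k. psi k t)"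

text \<open>One factor 1/(k+1) is explicit in \<open>psi\<close>; the other comes from the linear
  vanishing of \<open>ker 0\<close> at 0.\<close>

lemma psi_le:
  obtains K where "K \<ge> 0" "\<And>k t. t \<ge> 0 \<Longrightarrow> \<bar>psi k t\<bar> \<le> K * t / (real (Suc k))\<^sup>2"
proof -
  obtain K where K: "\<And>t. t > 0 \<Longrightarrow> \<bar>ker 0 t\<bar> \<le> K * t" using ker0_near_0 by blast
  have "\<bar>psi k t\<bar> \<le> K * t / (real (Suc k))\<^sup>2" if "t \<ge> 0" for k t
  proof (cases "t = 0")
    case False
    then have "\<bar>psi k t\<bar> \<le> 1 / real (Suc k) * (K * (1 / real (Suc k) * t))"
      unfolding psi_def abs_mult using that by (intro mult_mono K) auto
    then show ?thesis by (simp add: power2_eq_square)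
  qed (simp add: psi_def)
  moreover have "K \<ge> 0" using K[of 1] by simp
  ultimately show ?thesis using that by blast
qed

text \<open>J(n) of the introduction. The integral is improper at infinity, hence the detour through
  \<open>cos_coeff\<close>.\<close>

definition voronoi_coeff :: "nat \<Rightarrow> real" where
  "voronoi_coeff n = decaying_C2.cos_coeff ker_derivative (ker 2) (2 * pi * real n)"

lemma abs_voronoi_coeff_le: "\<exists>K. \<forall>n. \<bar>voronoi_coeff n\<bar> \<le> K / (real n)\<^sup>2"
proof -
  interpret k: decaying_C2 "ker 0" ker_derivative "ker 2" by (rule decaying_C2_ker)
  show ?thesis
    unfolding voronoi_coeff_def
    using k.abs_cos_coeff_le[of "2 * pi * real _"]
    by (intro exI[of _ "k.C2_norm / (2 * pi)\<^sup>2"]) (simp add: power_mult_distrib)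
qed

text \<open>Poisson summation for each \<open>psi k\<close>, summed over k by Tannery's theorem.
  Since \<open>psi_sum\<close> tends to \<open>D 0 0 / 2\<close>, sum and integral grow with M in
  general, and only this combination has a limit.\<close>

lemma double_Poisson:
  "(\<lambda>M. (\<Sum>m<M. psi_sum (real (Suc m))) - psi_sum (real M) / 2 - (LINT t:{0..real M}|lborel. psi_sum t))
     \<longlonglongrightarrow> (\<Sum>k. \<Sum>j. 2 * voronoi_coeff (Suc j * Suc k))"
proof -
  have dec: "decaying_C2 (psi k) (\<lambda>t. 1 / real (Suc k) * (1 / real (Suc k)) * ker_derivative (1 / real (Suc k) * t))
       (\<lambda>t. 1 / real (Suc k) * (1 / real (Suc k))\<^sup>2 * ker 2 (1 / real (Suc k) * t))" for k
    unfolding psi_def[abs_def] by (rule decaying_C2_scale[OF decaying_C2_ker]) auto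
  define E where "E k = decaying_C2.trapezoid_error (psi k)" for k
  define C where "C = decaying_C2.C2_norm ker_derivative (ker 2)"
  have E_le: "\<bar>E k M\<bar> \<le> (C / 6) / (real (Suc k))\<^sup>2" for k M
  proof -
    have "\<bar>E k M\<bar> \<le> (1 / real (Suc k) * (1 / real (Suc k)) * C) / 6"
      unfolding E_def C_def using decaying_C2.abs_trapezoid_error_le[OF dec[of k], of M]
      by (subst (asm) C2_norm_scale[OF decaying_C2_ker]) auto
    then show ?thesis by (simp add: power2_eq_square mult_ac del: of_nat_Suc)
  qed
  \<comment> \<open>With c = r = 1/(k+1) the frequency 2 pi (j+1) becomes 2 pi (j+1)(k+1): here the
    products of indices arise that are later counted by divisors.\<close>
  have E_lim: "(\<lambda>M. E k M) \<longlonglongrightarrow> (\<Sum>j. 2 * voronoi_coeff (Suc j * Suc k))" for k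
    using decaying_C2.half_line_Poisson(2)[OF dec[of k]]
      cos_coeff_scale[OF decaying_C2_ker, of "1 / real (Suc k)" "1 / real (Suc k)"]
    by (simp add: E_def voronoi_coeff_def mult.assoc del: of_nat_Suc mult_Suc mult_Suc_right)
  have T: "(\<lambda>M. \<Sum>k. E k M) \<longlonglongrightarrow> (\<Sum>k. \<Sum>j. 2 * voronoi_coeff (Suc j * Suc k))"
  proof -
    have "eventually (\<lambda>M. summable (\<lambda>k. norm (E k M))) sequentially \<and>
        summable (\<lambda>k. norm (\<Sum>j. 2 * voronoi_coeff (Suc j * Suc k))) \<and>
        ((\<lambda>M. \<Sum>k. E k M) \<longlonglongrightarrow> (\<Sum>k. \<Sum>j. 2 * voronoi_coeff (Suc j * Suc k)))"
    proof (rule tannerys_theorem[OF E_lim])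
      show "\<forall>\<^sub>F (k, M) in sequentially \<times>\<^sub>F sequentially. norm (E k M) \<le> (C / 6) / (real (Suc k))\<^sup>2"
        by (rule always_eventually) (use E_le in \<open>auto simp del: of_nat_Suc\<close>)
    qed (rule summable_inverse_Suc_squares sequentially_bot)+
    then show ?thesis by blast
  qed
  have "(\<Sum>k. E k M) = (\<Sum>m<M. psi_sum (real (Suc m))) - psi_sum (real M) / 2 - (LINT t:{0..real M}|lborel. psi_sum t)" for M
  proof -
    obtain K where K: "K \<ge> 0" "\<And>k t. t \<ge> 0 \<Longrightarrow> \<bar>psi k t\<bar> \<le> K * t / (real (Suc k))\<^sup>2" using psi_le by blast
    have "(\<lambda>k. LINT t:{0..real M}|lborel. psi k t) sums (LINT t:{0..real M}|lborel. psi_sum t)"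
      unfolding psi_sum_def
    proof (rule series_of_integrals(2))
      show "continuous_on {0..real M} (psi k)" for k
        by (rule continuous_on_subset[OF decaying_C2.cont[OF dec]]) auto
      show "\<bar>psi k t\<bar> \<le> (K * real M) / (real (Suc k))\<^sup>2" if "t \<in> {0..real M}" for k t
      proof -
        have "\<bar>psi k t\<bar> \<le> K * t / (real (Suc k))\<^sup>2" using that K(2) by auto
        also have "\<dots> \<le> K * real M / (real (Suc k))\<^sup>2" using that K(1) by (intro divide_right_mono mult_left_mono) auto
        finally show ?thesis .
      qed
      show "summable (\<lambda>k. K * real M / (real (Suc k))\<^sup>2)" by (rule summable_inverse_Suc_squares)
    qed simp
    moreover have "(\<lambda>k. psi k t) sums psi_sum t" if "t \<ge> 0" for t
      unfolding psi_sum_def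
      by (rule summable_sums, rule summable_comparison_test'[OF summable_inverse_Suc_squares[of "K * t"], of 0])
        (use K(2)[OF that] in simp)
    ultimately have "(\<lambda>k. psi k 0 / 2 + (\<Sum>m<M. psi k (real (Suc m))) - psi k (real M) / 2 - (LINT t:{0..real M}|lborel. psi k t)) sums
       (psi_sum 0 / 2 + (\<Sum>m<M. psi_sum (real (Suc m))) - psi_sum (real M) / 2 - (LINT t:{0..real M}|lborel. psi_sum t))"
      by (intro sums_diff sums_add sums_sum sums_divide) auto
    moreover have "E k M = psi k 0 / 2 + (\<Sum>m<M. psi k (real (Suc m))) - psi k (real M) / 2 - (LINT t:{0..real M}|lborel. psi k t)" for k
      unfolding E_def decaying_C2.trapezoid_error_def[OF dec] decaying_C2.sum_trapezoid[OF dec] ..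
    \<comment> \<open>Every \<open>psi k\<close> vanishes at 0, so the half weight of the
      trapezoidal rule there contributes nothing.\<close>
    moreover have "psi_sum 0 = 0" by (simp add: psi_sum_def psi_def)
    ultimately show ?thesis by (simp add: sums_iff)
  qed
  then show ?thesis using T by simp
qed

end

section \<open>The logarithmic term\<close>

lemma harm_floor_sums:
  fixes z :: real
  assumes "z \<ge> 0"
  shows "(\<lambda>k. if real (Suc k) \<le> z then 1 / real (Suc k) else 0) sums harm (nat \<lfloor>z\<rfloor>)"
proof -
  have eq: "{k. real (Suc k) \<le> z} = {..<nat \<lfloor>z\<rfloor>}"
    using assms by (auto simp: le_floor_iff nat_less_iff zless_nat_eq_int_zless) (linarith+)?
  show ?thesis
    using sums_If_finite[of "\<lambda>k. real (Suc k) \<le> z" "\<lambda>k. 1 / real (Suc k)"]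
    unfolding eq by (simp add: harm_altdef inverse_eq_divide)
qed

lemma harm_le_real: "harm n \<le> real n"
proof (induction n)
  case (Suc n)
  have "inverse (1 + real n) \<le> 1" by (simp add: field_simps)
  with Suc show ?case by (simp add: harm_Suc)
qed (simp add: harm_def)

lemma harm_floor_bounds:
  fixes z :: real
  assumes "z \<ge> 1"
  shows "ln z \<le> harm (nat \<lfloor>z\<rfloor>)" "harm (nat \<lfloor>z\<rfloor>) \<le> 1 + ln z"
proof -
  define n where "n = nat \<lfloor>z\<rfloor>"
  have n: "real n \<le> z" "z < real n + 1" "n \<ge> 1"
    using assms by (simp_all add: n_def le_nat_iff)
  have "ln z \<le> ln (real n + 1)" using n assms by simp
  also have "\<dots> \<le> harm n" by (rule ln_le_harm)
  finally show "ln z \<le> harm (nat \<lfloor>z\<rfloor>)" by (simp add: n_def)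
  \<comment> \<open>The decreasing sequence is indexed from n = 1, where its value is H_1 - ln 1 =
    1.\<close>
  have "harm n - ln (real n) \<le> 1"
    using decseqD[OF decseq_harm_diff_ln, of 0 "n - 1"] n by (simp add: harm_def)
  moreover have "ln (real n) \<le> ln z" using n by simp
  ultimately show "harm (nat \<lfloor>z\<rfloor>) \<le> 1 + ln z" by (simp add: n_def)
qed

lemma integrable_ln_0_1: "set_integrable lborel {0<..<1::real} (\<lambda>u. - ln u)"
proof -
  have "set_integrable lborel (einterval 0 1) (\<lambda>u. - ln u)"
  proof (rule interval_integral_FTC_nonneg(1))
    show "((\<lambda>u. u - u * ln u) has_real_derivative - ln x) (at x)" if "0 < ereal x" for x
      using that by (auto intro!: derivative_eq_intros)
    show "isCont (\<lambda>u. - ln u) x" if "0 < ereal x" for x using that by (auto intro!: continuous_intros)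
    show "AE x in lborel. 0 < ereal x \<longrightarrow> ereal x < 1 \<longrightarrow> 0 \<le> - ln x" by (auto simp: one_ereal_def)
    have "((\<lambda>u::real. u - u * ln u) \<longlongrightarrow> 0) (at_right 0)" by real_asymp
    then show "(((\<lambda>u. u - u * ln u) \<circ> real_of_ereal) \<longlongrightarrow> 0) (at_right 0)"
      unfolding zero_ereal_def ereal_tendsto_simps .
    have "((\<lambda>u::real. u - u * ln u) \<longlongrightarrow> 1) (at_left 1)" by real_asymp
    then show "(((\<lambda>u. u - u * ln u) \<circ> real_of_ereal) \<longlongrightarrow> 1) (at_left 1)"
      unfolding one_ereal_def ereal_tendsto_simps .
  qed auto
  then show ?thesis by (simp add: einterval_def one_ereal_def zero_ereal_def greaterThanLessThan_def greaterThan_def lessThan_def Int_def conj_commute)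
qed

lemma harm_floor_ln_tendsto:
  fixes u :: real
  assumes u: "u > 0"
  shows "(\<lambda>N. harm (nat \<lfloor>u * real (Suc N)\<rfloor>) - ln (real (Suc N))) \<longlonglongrightarrow> euler_mascheroni + ln u"
proof -
  define n where "n N = nat \<lfloor>u * real (Suc N)\<rfloor>" for N
  have big: "filterlim n sequentially sequentially"
    unfolding n_def using u by real_asymp
  have l1: "(\<lambda>N. harm (n N) - ln (real (n N))) \<longlonglongrightarrow> euler_mascheroni"
    by (rule filterlim_compose[OF euler_mascheroni_LIMSEQ big])
  have "(\<lambda>N. of_int \<lfloor>u * real (Suc N)\<rfloor> / real (Suc N)) \<longlonglongrightarrow> u"
    using u by real_asymp
  then have l2: "(\<lambda>N. real (n N) / real (Suc N)) \<longlonglongrightarrow> u"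
    using u by (simp add: n_def)
  \<comment> \<open>The floor is absorbed by comparing with ln n for n =
    \<open>nat \<lfloor>u * real (Suc N)\<rfloor>\<close>: H_n - ln n tends to Euler's constant and
    n / (N+1) tends to u.\<close>
  have l3: "(\<lambda>N. (harm (n N) - ln (real (n N))) + ln (real (n N) / real (Suc N))) \<longlonglongrightarrow> euler_mascheroni + ln u"
    using u by (intro tendsto_intros l1 l2) auto
  show ?thesis unfolding n_def[symmetric]
  proof (rule Lim_transform_eventually[OF l3])
    show "\<forall>\<^sub>F N in sequentially. harm (n N) - ln (real (n N)) + ln (real (n N) / real (Suc N)) = harm (n N) - ln (real (Suc N))"
      by (rule eventually_mono[OF big[unfolded filterlim_at_top, rule_format, of 1]]) (simp add: ln_div del: of_nat_Suc)
  qed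
qed

text \<open>A majorant independent of N for dominated convergence. When u (N+1) < 1 the harmonic sum
  is empty and ln (N+1) lies between 0 and - ln u.\<close>

lemma harm_floor_ln_bound:
  fixes u :: real
  assumes u: "u > 0"
  shows "\<bar>harm (nat \<lfloor>u * real (Suc N)\<rfloor>) - ln (real (Suc N))\<bar> \<le> 1 + \<bar>ln u\<bar>"
proof (cases "u * real (Suc N) \<ge> 1")
  case True
  have "ln (u * real (Suc N)) = ln u + ln (real (Suc N))" using u by (subst ln_mult) auto
  then show ?thesis using harm_floor_bounds[OF True] by linarith
next
  case False
  then have "nat \<lfloor>u * real (Suc N)\<rfloor> = 0" using u by simp
  moreover have "ln (u * real (Suc N)) \<le> ln 1" using u False by (subst ln_le_cancel_iff) auto
  then have "ln u + ln (real (Suc N)) \<le> 0" using u by (subst (asm) ln_mult) auto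
  moreover have "ln (real (Suc N)) \<ge> 0" by simp
  ultimately show ?thesis by (simp add: harm_def del: of_nat_Suc)
qed

lemma LINT_atLeast_split:
  fixes f :: "real \<Rightarrow> real"
  assumes "a \<le> b" "set_integrable lborel {a..} f"
  shows "(LINT x:{a..}|lborel. f x) = (LINT x:{a..b}|lborel. f x) + (LINT x:{b..}|lborel. f x)"
proof (rule tendsto_unique)
  show "((\<lambda>T. LINT x:{a..T}|lborel. f x) \<longlongrightarrow> (LINT x:{a..}|lborel. f x)) at_top"
    by (rule tendsto_set_lebesgue_integral_at_top) (use assms in auto)
  have i: "set_integrable lborel {b..} f" by (rule set_integrable_subset[OF assms(2)]) (use assms in auto)
  have "((\<lambda>T. (LINT x:{a..b}|lborel. f x) + (LINT x:{b..T}|lborel. f x)) \<longlongrightarrow> (LINT x:{a..b}|lborel. f x) + (LINT x:{b..}|lborel. f x)) at_top"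
    by (intro tendsto_intros tendsto_set_lebesgue_integral_at_top i) auto
  then show "((\<lambda>T. LINT x:{a..T}|lborel. f x) \<longlongrightarrow> (LINT x:{a..b}|lborel. f x) + (LINT x:{b..}|lborel. f x)) at_top"
  proof (rule Lim_transform_eventually)
    show "\<forall>\<^sub>F T in at_top. (LINT x:{a..b}|lborel. f x) + (LINT x:{b..T}|lborel. f x) = (LINT x:{a..T}|lborel. f x)"
      using eventually_ge_at_top[of b]
      by eventually_elim (subst LINT_Icc_split[of a b], use assms in \<open>auto intro: set_integrable_subset[OF assms(2)]\<close>)
  qed
qed simp

section \<open>Integrals of sum_k f(kt) and of sum_k psi_k\<close>

context schwartz
begin

text \<open>This is the sum over k of the integrals of f(kt) over t > x: substitute u = kt and
  interchange, so that 1/k is counted for all k up to u/x.\<close>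

definition harm_integral :: "real \<Rightarrow> real" where
  "harm_integral x = (LINT u:{0..}|lborel. D 0 u * harm (nat \<lfloor>u / x\<rfloor>))"

lemma
  assumes x: "x > 0"
  shows harm_integral_sums: "(\<lambda>k. 1 / real (Suc k) * (LINT u:{real (Suc k) * x..}|lborel. D 0 u)) sums harm_integral x"
    and set_integrable_harm: "set_integrable lborel {0..} (\<lambda>u. D 0 u * harm (nat \<lfloor>u / x\<rfloor>))"
proof -
  define I where "I = (LINT u:{0..}|lborel. \<bar>u ^ 1 * D 0 u\<bar>)"
  define f where "f k u = indicator {real (Suc k) * x..} u *\<^sub>R (1 / real (Suc k) * D 0 u)" for k u
  have ints: "integrable lborel (f k)" for k
  proof -
    have "set_integrable lborel {real (Suc k) * x..} (D 0)"
      by (rule set_integrable_subset[OF set_integrable_D[of 0]]) (use x in auto)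
    then have "set_integrable lborel {real (Suc k) * x..} (\<lambda>u. 1 / real (Suc k) * D 0 u)" by (rule set_integrable_mult_right) 
    then show ?thesis unfolding set_integrable_def f_def .
  qed
  \<comment> \<open>On the support u \<ge> (k+1) x one has 1/(k+1) \<le> u / (x (k+1)^2): a factor
    u, paid by the first moment of f, buys summability over k.\<close>
  have fle: "norm (f k u) \<le> (1 / x) / (real (Suc k))\<^sup>2 * (indicator {0..} u *\<^sub>R \<bar>u ^ 1 * D 0 u\<bar>)" for k u
  proof (cases "real (Suc k) * x \<le> u")
    case True
    then have u: "u \<ge> 0" using x by (intro order_trans[OF _ True]) auto
    have "1 / real (Suc k) \<le> (1 / x) / (real (Suc k))\<^sup>2 * u"
    proof -
      have "1 \<le> u / (real (Suc k) * x)" using True x by (subst le_divide_eq_1_pos) auto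
      from mult_left_mono[OF this, of "1 / real (Suc k)"] show ?thesis
        by (simp add: power2_eq_square mult_ac del: of_nat_Suc)
    qed
    from mult_right_mono[OF this, of "\<bar>D 0 u\<bar>"] show ?thesis
      using True u by (simp add: f_def abs_mult mult_ac del: of_nat_Suc)
  qed (use x in \<open>auto simp: f_def\<close>)
  have f_sums: "(\<lambda>k. f k u) sums (indicator {0..} u *\<^sub>R (D 0 u * harm (nat \<lfloor>u / x\<rfloor>)))" for u
  proof (cases "u \<ge> 0")
    case True
    have "f k u = D 0 u * (if real (Suc k) \<le> u / x then 1 / real (Suc k) else 0)" for k
      using x by (simp add: f_def pos_le_divide_eq del: of_nat_Suc)
    then show ?thesis using sums_mult[OF harm_floor_sums[of "u / x"], of "D 0 u"] True x by simp
  next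
    case False
    then have "\<not> real (Suc k) * x \<le> u" for k using x by (smt (verit) mult_nonneg_nonneg of_nat_0_le_iff)
    then have "f k u = 0" for k by (simp add: f_def)
    then show ?thesis using False by simp
  qed
  have sI: "summable (\<lambda>k. LINT u|lborel. norm (f k u))"
  proof (rule summable_comparison_test'[OF summable_inverse_Suc_squares[of "1 / x * I"], of 0])
    fix k
    have "(LINT u|lborel. norm (f k u)) \<le> (LINT u|lborel. (1 / x) / (real (Suc k))\<^sup>2 * (indicator {0..} u *\<^sub>R \<bar>u ^ 1 * D 0 u\<bar>))"
      using set_integrable_abs[OF set_integrable_power[of 1 0]]
      by (intro integral_mono integrable_norm ints fle integrable_mult_right) (simp add: set_integrable_def)
    then show "norm (LINT u|lborel. norm (f k u)) \<le> 1 / x * I / (real (Suc k))\<^sup>2"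
      by (simp add: I_def set_lebesgue_integral_def Bochner_Integration.integral_nonneg)
  qed
  have AE: "AE u in lborel. summable (\<lambda>k. norm (f k u))"
  proof (rule AE_I2)
    fix u
    show "summable (\<lambda>k. norm (f k u))"
      by (rule summable_comparison_test'[OF summable_mult2[OF summable_inverse_Suc_squares[of "1 / x"], of "indicator {0..} u *\<^sub>R \<bar>u ^ 1 * D 0 u\<bar>"], of 0])
        (use fle[of _ u] in \<open>simp del: of_nat_Suc\<close>)
  qed
  have eq: "(\<Sum>k. f k u) = indicator {0..} u *\<^sub>R (D 0 u * harm (nat \<lfloor>u / x\<rfloor>))" for u
    using f_sums by (simp add: sums_iff)
  have "(\<lambda>k. integral\<^sup>L lborel (f k)) sums harm_integral x"
    using sums_integral[OF ints AE sI] unfolding eq harm_integral_def set_lebesgue_integral_def .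
  moreover have "integral\<^sup>L lborel (f k) = 1 / real (Suc k) * (LINT u:{real (Suc k) * x..}|lborel. D 0 u)" for k
    unfolding f_def set_lebesgue_integral_def by (simp add: mult_ac del: of_nat_Suc)
  ultimately show "(\<lambda>k. 1 / real (Suc k) * (LINT u:{real (Suc k) * x..}|lborel. D 0 u)) sums harm_integral x" by simp
  show "set_integrable lborel {0..} (\<lambda>u. D 0 u * harm (nat \<lfloor>u / x\<rfloor>))"
    using integrable_suminf[OF ints AE sI] unfolding eq set_integrable_def .
qed

lemma LINT_multiples_sum:
  assumes a: "0 < a" "a \<le> b"
  shows "(LINT t:{a..b}|lborel. multiples_sum t) = harm_integral a - harm_integral b"
    and "continuous_on {a..b} multiples_sum"
proof -
  obtain K where K: "K \<ge> 0" "\<And>k t. t > 0 \<Longrightarrow> \<bar>D 0 (real (Suc k) * t)\<bar> \<le> K / t\<^sup>2 / (real (Suc k))\<^sup>2"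
    using D0_multiples_le by metis
  have *: "continuous_on {a..b} (\<lambda>t. D 0 (real (Suc k) * t))" for k
    using a by (intro continuous_on_compose2[OF cont[of 0]] continuous_intros) auto
  have **: "\<bar>D 0 (real (Suc k) * t)\<bar> \<le> (K / a\<^sup>2) / (real (Suc k))\<^sup>2" if "t \<in> {a..b}" for k t
  proof -
    have "\<bar>D 0 (real (Suc k) * t)\<bar> \<le> K / t\<^sup>2 / (real (Suc k))\<^sup>2" using that a K(2)[of t k] by auto
    also have "\<dots> \<le> (K / a\<^sup>2) / (real (Suc k))\<^sup>2"
      using that a K(1) by (intro divide_right_mono divide_left_mono power_mono) auto
    finally show ?thesis .
  qed
  note s = series_of_integrals[of a b "\<lambda>k t. D 0 (real (Suc k) * t)", OF * ** summable_inverse_Suc_squares a(2)]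
  from s(1) show "continuous_on {a..b} multiples_sum" unfolding multiples_sum_def[abs_def] by simp
  have "(LINT t:{a..b}|lborel. D 0 (real (Suc k) * t)) =
    1 / real (Suc k) * (LINT u:{real (Suc k) * a..}|lborel. D 0 u) - 1 / real (Suc k) * (LINT u:{real (Suc k) * b..}|lborel. D 0 u)" for k
  proof -
    have "(LINT t:{a..b}|lborel. D 0 (real (Suc k) * t)) = (LINT u:{real (Suc k) * a..real (Suc k) * b}|lborel. D 0 u) / real (Suc k)"
      using LINT_scale[of "real (Suc k)" "{real (Suc k) * a..real (Suc k) * b}" "D 0"] scale_Icc[of "real (Suc k)" a b]
      by (simp add: divide_inverse del: of_nat_Suc)
    moreover have "(LINT u:{real (Suc k) * a..}|lborel. D 0 u) = (LINT u:{real (Suc k) * a..real (Suc k) * b}|lborel. D 0 u) + (LINT u:{real (Suc k) * b..}|lborel. D 0 u)"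
      using a by (intro LINT_atLeast_split set_integrable_subset[OF set_integrable_D[of 0]]) auto
    ultimately show ?thesis by (simp add: field_simps del: of_nat_Suc)
  qed
  with s(2) have "(\<lambda>k. 1 / real (Suc k) * (LINT u:{real (Suc k) * a..}|lborel. D 0 u) - 1 / real (Suc k) * (LINT u:{real (Suc k) * b..}|lborel. D 0 u))
     sums (LINT t:{a..b}|lborel. multiples_sum t)"
    by (simp only: multiples_sum_def)
  moreover have "(\<lambda>k. 1 / real (Suc k) * (LINT u:{real (Suc k) * a..}|lborel. D 0 u) - 1 / real (Suc k) * (LINT u:{real (Suc k) * b..}|lborel. D 0 u))
     sums (harm_integral a - harm_integral b)"
    using a by (intro sums_diff harm_integral_sums) auto
  ultimately show "(LINT t:{a..b}|lborel. multiples_sum t) = harm_integral a - harm_integral b"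
    by (rule sums_unique2)
qed

lemma LINT_psi_sum_away_from_0:
  assumes a: "0 < a" "a \<le> b"
  shows "(LINT t:{a..b}|lborel. psi_sum t) = (b - a) * D 0 0 / 2 + (harm_integral a - harm_integral b) - mass * (ln b - ln a)"
proof -
  have "(LINT t:{a..b}|lborel. psi_sum t) = (LINT t:{a..b}|lborel. D 0 0 / 2 + multiples_sum t - mass / t)"
    by (intro set_lebesgue_integral_cong) (use a psi_sums in \<open>auto simp: psi_sum_def sums_iff\<close>)
  also have "\<dots> = (LINT t:{a..b}|lborel. D 0 0 / 2) + (LINT t:{a..b}|lborel. multiples_sum t) - (LINT t:{a..b}|lborel. mass / t)"
  proof -
    have "set_integrable lborel {a..b} (\<lambda>t. mass / t)"
      using a by (intro borel_integrable_atLeastAtMost' continuous_intros) auto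
    moreover have "set_integrable lborel {a..b} multiples_sum"
      by (intro borel_integrable_atLeastAtMost' LINT_multiples_sum(2) a)
    moreover have "set_integrable lborel {a..b} (\<lambda>t. D 0 0 / 2)"
      by (intro borel_integrable_atLeastAtMost' continuous_intros)
    ultimately show ?thesis
      by (simp only: set_integral_add set_integral_diff)
  qed
  also have "(LINT t:{a..b}|lborel. D 0 0 / 2) = b * (D 0 0 / 2) - a * (D 0 0 / 2)"
    using a by (intro LINT_Icc_FTC borel_integrable_atLeastAtMost') (auto intro!: continuous_intros derivative_eq_intros)
  also have "(LINT t:{a..b}|lborel. mass / t) = mass * ln b - mass * ln a"
    using a by (intro LINT_Icc_FTC borel_integrable_atLeastAtMost') (auto intro!: continuous_intros derivative_eq_intros)
  finally show ?thesis unfolding LINT_multiples_sum(1)[OF a] by (simp add: field_simps)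
qed

text \<open>Continuity up to 0 comes from the series, not from the closed form in
  \<open>psi_sums\<close>, where the terms \<open>multiples_sum t\<close> and
  \<open>mass / t\<close> may blow up at 0. It is what permits the lower limit of integration to
  tend to 0.\<close>

lemma psi_sum_continuous: "continuous_on {0..b} psi_sum"
proof (cases "b \<ge> 0")
  case True
  obtain K where K: "K \<ge> 0" "\<And>k t. t \<ge> 0 \<Longrightarrow> \<bar>psi k t\<bar> \<le> K * t / (real (Suc k))\<^sup>2" using psi_le by blast
  have "continuous_on {0..b} (\<lambda>t. \<Sum>k. psi k t)"
  proof (rule series_of_integrals(1))
    show "continuous_on {0..b} (psi k)" for k
      unfolding psi_def[abs_def]
      by (intro continuous_intros continuous_on_compose2[OF decaying_C2.cont[OF decaying_C2_ker]]) auto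
    show "\<bar>psi k t\<bar> \<le> (K * b) / (real (Suc k))\<^sup>2" if "t \<in> {0..b}" for k t
    proof -
      have "\<bar>psi k t\<bar> \<le> K * t / (real (Suc k))\<^sup>2" using that K(2) by auto
      also have "\<dots> \<le> K * b / (real (Suc k))\<^sup>2" using that K(1) by (intro divide_right_mono mult_left_mono) auto
      finally show ?thesis .
    qed
  qed (use True summable_inverse_Suc_squares[of "K * b"] in \<open>auto simp del: of_nat_Suc\<close>)
  then show ?thesis by (simp add: psi_sum_def[abs_def])
qed simp

lemma LINT_psi_sum_tendsto:
  assumes b: "b \<ge> 1"
  shows "(\<lambda>N. LINT t:{1 / real (Suc N)..b}|lborel. psi_sum t) \<longlonglongrightarrow> (LINT t:{0..b}|lborel. psi_sum t)"
proof -
  have i: "set_integrable lborel {0..b} psi_sum"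
    by (intro borel_integrable_atLeastAtMost' psi_sum_continuous)
  have "continuous_on {0..b} (\<lambda>x. integral {0..x} psi_sum)"
    by (intro indefinite_integral_continuous_1 integrable_continuous_interval psi_sum_continuous)
  moreover have "(\<lambda>N. 1 / real (Suc N)) \<longlonglongrightarrow> 0" by real_asymp
  moreover have mem: "1 / real (Suc N) \<in> {0..b}" for N using b by (auto simp: field_simps intro: order_trans[of _ "b * 1"])
  ultimately have "(\<lambda>N. integral {0..1 / real (Suc N)} psi_sum) \<longlonglongrightarrow> integral {0..0} psi_sum"
    using b by (intro continuous_on_tendsto_compose[of "{0..b}" "\<lambda>x. integral {0..x} psi_sum"]) auto
  then have "(\<lambda>N. (LINT t:{0..b}|lborel. psi_sum t) - integral {0..1 / real (Suc N)} psi_sum) \<longlonglongrightarrow> (LINT t:{0..b}|lborel. psi_sum t) - integral {0..0} psi_sum"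
    by (intro tendsto_intros)
  moreover have "(LINT t:{0..b}|lborel. psi_sum t) - integral {0..1 / real (Suc N)} psi_sum = (LINT t:{1 / real (Suc N)..b}|lborel. psi_sum t)" for N
    using LINT_Icc_split[of 0 "1 / real (Suc N)" b psi_sum] mem[of N] i
      set_borel_integral_eq_integral(2)[OF set_integrable_subset[OF i, of "{0..1 / real (Suc N)}"]]
    by (auto simp del: of_nat_Suc)
  ultimately show ?thesis by simp
qed

text \<open>The crude bound H(z) \<le> z suffices: the contribution of the upper limit b decays like
  1/b.\<close>

lemma abs_harm_integral_le:
  assumes x: "x > 0"
  shows "\<bar>harm_integral x\<bar> \<le> (LINT u:{0..}|lborel. \<bar>u ^ 1 * D 0 u\<bar>) / x"
proof -
  have "\<bar>harm_integral x\<bar> \<le> (LINT u:{0..}|lborel. \<bar>D 0 u * harm (nat \<lfloor>u / x\<rfloor>)\<bar>)"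
    unfolding harm_integral_def using set_integral_norm_bound[OF set_integrable_harm[OF x]] by simp
  also have "\<dots> \<le> (LINT u:{0..}|lborel. 1 / x * \<bar>u ^ 1 * D 0 u\<bar>)"
  proof (intro set_integral_mono set_integrable_abs set_integrable_harm x set_integrable_mult_right set_integrable_power)
    fix u :: real assume "u \<in> {0..}"
    then have u: "u \<ge> 0" by simp
    have "harm (nat \<lfloor>u / x\<rfloor>) \<le> real (nat \<lfloor>u / x\<rfloor>)" by (rule harm_le_real)
    also have "\<dots> \<le> u / x" using u x by simp
    finally have "\<bar>D 0 u\<bar> * harm (nat \<lfloor>u / x\<rfloor>) \<le> \<bar>D 0 u\<bar> * (u / x)" by (intro mult_left_mono) auto
    then show "\<bar>D 0 u * harm (nat \<lfloor>u / x\<rfloor>)\<bar> \<le> 1 / x * \<bar>u ^ 1 * D 0 u\<bar>"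
      using u by (simp add: abs_mult mult_ac)
  qed
  finally show ?thesis by simp
qed

lemma set_integrable_ln: "set_integrable lborel {0..} (\<lambda>u. D 0 u * \<bar>ln u\<bar>)"
proof -
  obtain K where K: "\<And>t. t \<ge> 0 \<Longrightarrow> \<bar>t ^ 0 * D 0 t\<bar> \<le> K" using decay by blast
  \<comment> \<open>On ]0, 1[ the function \<open>D 0\<close> is bounded and - ln u integrable; from
    1 on, ln u \<le> u.\<close>
  define w where "w u = K * (indicator {0<..<1} u *\<^sub>R - ln u) + indicator {0..} u *\<^sub>R \<bar>u ^ 1 * D 0 u\<bar>" for u
  have "integrable lborel w"
    unfolding w_def
    using integrable_ln_0_1 set_integrable_abs[OF set_integrable_power[of 1 0]]
    by (intro Bochner_Integration.integrable_add integrable_mult_right) (simp_all add: set_integrable_def)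
  moreover have "(\<lambda>u. indicator {0..} u *\<^sub>R (D 0 u * \<bar>ln u\<bar>)) \<in> borel_measurable lborel"
  proof -
    have "(\<lambda>u. (indicator {0..} u *\<^sub>R D 0 u) * \<bar>ln u\<bar>) \<in> borel_measurable lborel"
      by (rule borel_measurable_times[OF borel_measurable_integrable[OF set_integrable_D[of 0, unfolded set_integrable_def]]]) simp
    then show ?thesis by (simp add: mult.assoc)
  qed
  moreover have "norm (indicator {0..} u *\<^sub>R (D 0 u * \<bar>ln u\<bar>)) \<le> norm (w u)" for u
  proof -
    consider "u \<le> 0" | "0 < u" "u < 1" | "u \<ge> 1" by linarith
    then show ?thesis
    proof cases
      case 1
      then show ?thesis by (cases "u = 0") (auto)
    next
      case 2
      then have "\<bar>D 0 u\<bar> * \<bar>ln u\<bar> \<le> K * - ln u"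
        using K[of u] by (simp add: mult_right_mono)
      moreover have "w u = K * - ln u + u * \<bar>D 0 u\<bar>" using 2 by (simp add: w_def abs_mult)
      moreover have "u * \<bar>D 0 u\<bar> \<ge> 0" using 2 by simp
      ultimately have "\<bar>D 0 u\<bar> * \<bar>ln u\<bar> \<le> \<bar>w u\<bar>" by linarith
      then show ?thesis using 2 by (simp add: abs_mult)
    next
      case 3
      then have "\<bar>D 0 u\<bar> * \<bar>ln u\<bar> \<le> \<bar>D 0 u\<bar> * u" by (intro mult_left_mono) (use ln_le_minus_one[of u] in auto)
      then show ?thesis using 3 by (simp add: w_def abs_mult mult_ac)
    qed
  qed
  ultimately show ?thesis
    unfolding set_integrable_def using Bochner_Integration.integrable_bound[of lborel w] by blast
qed

lemma set_integrable_ln_plus: "set_integrable lborel {0..} (\<lambda>u. D 0 u * (ln u + c))"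
proof -
  \<comment> \<open>The sign of the logarithm is a bounded factor, so integrability passes from
    \<open>\<bar>ln u\<bar>\<close> to \<open>ln u\<close>.\<close>
  have "set_integrable lborel {0..} (\<lambda>u. (D 0 u * \<bar>ln u\<bar>) * sgn (ln u))"
    by (rule set_integrable_mult_bounded(1)[OF set_integrable_ln, where K = 1]) (auto simp: sgn_real_def)
  then have "set_integrable lborel {0..} (\<lambda>u. D 0 u * ln u + c * D 0 u)"
    using set_integrable_D[of 0] by (intro set_integral_add set_integrable_mult_right) (simp_all add: mult.assoc abs_mult_sgn)
  then show ?thesis by (simp add: algebra_simps)
qed

lemma harm_integral_tendsto:
  "(\<lambda>N. harm_integral (1 / real (Suc N)) - mass * ln (real (Suc N))) \<longlonglongrightarrow> (LINT u:{0..}|lborel. D 0 u * (ln u + euler_mascheroni))"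
proof -
  have iN: "set_integrable lborel {0..} (\<lambda>u. D 0 u * harm (nat \<lfloor>u * real (Suc N)\<rfloor>))" for N
    using set_integrable_harm[of "1 / real (Suc N)"] by simp
  have iD: "set_integrable lborel {0..} (\<lambda>u. ln (real (Suc N)) * D 0 u)" for N
    by (intro set_integrable_mult_right set_integrable_D)
  have i2: "set_integrable lborel {0..} (\<lambda>u. D 0 u * (harm (nat \<lfloor>u * real (Suc N)\<rfloor>) - ln (real (Suc N))))" for N
    using set_integral_diff(1)[OF iN[of N] iD[of N]] by (simp add: right_diff_distrib mult.commute del: of_nat_Suc)
  have eq: "harm_integral (1 / real (Suc N)) - mass * ln (real (Suc N)) =
      (LINT u:{0..}|lborel. D 0 u * (harm (nat \<lfloor>u * real (Suc N)\<rfloor>) - ln (real (Suc N))))" for N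
    using set_integral_diff(2)[OF iN[of N] iD[of N]]
    by (simp add: harm_integral_def mass_def right_diff_distrib mult_ac del: of_nat_Suc)
  define w where "w u = indicator {0..} u *\<^sub>R \<bar>D 0 u\<bar> + norm (indicator {0..} u *\<^sub>R (D 0 u * \<bar>ln u\<bar>))" for u
  show ?thesis
    unfolding eq unfolding set_lebesgue_integral_def
  proof (rule integral_dominated_convergence[where w = w])
    show "(\<lambda>u. indicator {0..} u *\<^sub>R (D 0 u * (ln u + euler_mascheroni))) \<in> borel_measurable lborel"
      using set_integrable_ln_plus unfolding set_integrable_def by (rule borel_measurable_integrable)
    show "(\<lambda>u. indicator {0..} u *\<^sub>R (D 0 u * (harm (nat \<lfloor>u * real (Suc N)\<rfloor>) - ln (real (Suc N))))) \<in> borel_measurable lborel" for N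
      using i2[of N] unfolding set_integrable_def by (rule borel_measurable_integrable)
    show "integrable lborel w"
      unfolding w_def using set_integrable_abs[OF set_integrable_D[of 0]] integrable_norm[OF set_integrable_ln[unfolded set_integrable_def]]
      by (intro Bochner_Integration.integrable_add) (simp_all add: set_integrable_def)
    \<comment> \<open>At u = 0 the sequence is \<open>- D 0 0 * ln (real (Suc N))\<close>, which
      diverges unless \<open>D 0 0 = 0\<close>; this null set has to be left out.\<close>
    have pw: "(\<lambda>N. indicator {0..} u *\<^sub>R (D 0 u * (harm (nat \<lfloor>u * real (Suc N)\<rfloor>) - ln (real (Suc N)))))
        \<longlonglongrightarrow> indicator {0..} u *\<^sub>R (D 0 u * (ln u + euler_mascheroni))" if "u \<noteq> 0" for u
    proof (cases "u > 0")
      case True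
      then show ?thesis
        using harm_floor_ln_tendsto[OF True] by (intro tendsto_intros) (simp add: add.commute)
    qed (use that in simp)
    show "AE u in lborel. (\<lambda>N. indicator {0..} u *\<^sub>R (D 0 u * (harm (nat \<lfloor>u * real (Suc N)\<rfloor>) - ln (real (Suc N)))))
        \<longlonglongrightarrow> indicator {0..} u *\<^sub>R (D 0 u * (ln u + euler_mascheroni))"
      by (rule AE_mp[OF AE_lborel_singleton[of 0]], rule AE_I2, rule impI, erule pw)
    have wb: "norm (indicator {0..} u *\<^sub>R (D 0 u * (harm (nat \<lfloor>u * real (Suc N)\<rfloor>) - ln (real (Suc N))))) \<le> w u" if "u \<noteq> 0" for u N
    proof (cases "u > 0")
      case True
      then show ?thesis
        using mult_left_mono[OF harm_floor_ln_bound[OF True, of N], of "\<bar>D 0 u\<bar>"]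
        by (simp add: w_def abs_mult distrib_left del: of_nat_Suc)
    qed (use that in \<open>simp add: w_def\<close>)
    show "AE u in lborel. norm (indicator {0..} u *\<^sub>R (D 0 u * (harm (nat \<lfloor>u * real (Suc N)\<rfloor>) - ln (real (Suc N))))) \<le> w u" for N
      by (rule AE_mp[OF AE_lborel_singleton[of 0]], rule AE_I2, rule impI, erule wb)
  qed
qed

text \<open>With lower limit 1/(N+1), the logarithm in \<open>LINT_psi_sum_away_from_0\<close>
  supplies exactly the term - mass ln (N+1) that makes
  \<open>harm_integral (1 / real (Suc N))\<close> convergent.\<close>

lemma LINT_psi_sum:
  assumes b: "b \<ge> 1"
  shows "(LINT t:{0..b}|lborel. psi_sum t) =
     b * D 0 0 / 2 + (LINT u:{0..}|lborel. D 0 u * (ln u + euler_mascheroni)) - harm_integral b - mass * ln b"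
proof (rule LIMSEQ_unique[OF LINT_psi_sum_tendsto[OF b]])
  have eq: "(LINT t:{1 / real (Suc N)..b}|lborel. psi_sum t) =
     (b - 1 / real (Suc N)) * D 0 0 / 2 + (harm_integral (1 / real (Suc N)) - mass * ln (real (Suc N))) - harm_integral b - mass * ln b" for N
  proof -
    have "1 / real (Suc N) \<le> b" using b by (auto simp: field_simps intro: order_trans[of _ "b * 1"])
    then show ?thesis
      by (subst LINT_psi_sum_away_from_0) (auto simp: ln_div algebra_simps simp del: of_nat_Suc)
  qed
  have "(\<lambda>N. 1 / real (Suc N)) \<longlonglongrightarrow> 0" by real_asymp
  then have "(\<lambda>N. (b - 1 / real (Suc N)) * D 0 0 / 2 + (harm_integral (1 / real (Suc N)) - mass * ln (real (Suc N))) - harm_integral b - mass * ln b)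
     \<longlonglongrightarrow> (b - 0) * D 0 0 / 2 + (LINT u:{0..}|lborel. D 0 u * (ln u + euler_mascheroni)) - harm_integral b - mass * ln b"
    by (intro tendsto_intros harm_integral_tendsto) auto
  then show "(\<lambda>N. LINT t:{1 / real (Suc N)..b}|lborel. psi_sum t) \<longlonglongrightarrow>
    b * D 0 0 / 2 + (LINT u:{0..}|lborel. D 0 u * (ln u + euler_mascheroni)) - harm_integral b - mass * ln b"
    unfolding eq by simp
qed

lemma summable_multiples_sum: "summable (\<lambda>m. multiples_sum (real (Suc m)))"
proof -
  obtain K where K: "K \<ge> 0" "\<And>k t. t > 0 \<Longrightarrow> \<bar>D 0 (real (Suc k) * t)\<bar> \<le> K / t\<^sup>2 / (real (Suc k))\<^sup>2"
    using D0_multiples_le by metis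
  define Z where "Z = (\<Sum>k. 1 / (real (Suc k))\<^sup>2)"
  have "\<bar>multiples_sum t\<bar> \<le> K / t\<^sup>2 * Z" if t: "t > 0" for t
  proof -
    have "norm (\<Sum>k. D 0 (real (Suc k) * t)) \<le> (\<Sum>k. K / t\<^sup>2 / (real (Suc k))\<^sup>2)"
      by (rule norm_suminf_le) (use K(2)[OF t] summable_inverse_Suc_squares[of "K / t\<^sup>2"] in \<open>auto simp del: of_nat_Suc\<close>)
    also have "\<dots> = K / t\<^sup>2 * Z"
      unfolding Z_def using suminf_mult[OF summable_inverse_Suc_squares[of 1], of "K / t\<^sup>2"] by simp
    finally show ?thesis by (simp add: multiples_sum_def)
  qed
  from this[of "real (Suc _)"] show ?thesis
    by (intro summable_comparison_test'[OF summable_inverse_Suc_squares[of "K * Z"], of 0]) (simp del: of_nat_Suc)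
qed

theorem Voronoi_iterated:
  "(\<Sum>m. multiples_sum (real (Suc m))) =
     (LINT u:{0..}|lborel. D 0 u * (ln u + 2 * euler_mascheroni)) + D 0 0 / 4 + (\<Sum>k. \<Sum>j. 2 * voronoi_coeff (Suc j * Suc k))"
proof -
  define B where "B = (LINT u:{0..}|lborel. D 0 u * (ln u + euler_mascheroni))"
  define X where "X M = (\<Sum>m<M. psi_sum (real (Suc m))) - psi_sum (real M) / 2 - (LINT t:{0..real M}|lborel. psi_sum t)" for M
  \<comment> \<open>\<open>X M\<close> with the closed form of \<open>psi_sum\<close> and of its
    integral inserted: the terms \<open>M * D 0 0 / 2\<close> have cancelled, and
    \<open>mass * harm M\<close> from the points meets \<open>mass * ln M\<close> from the integral.
    Half of the last value contributes \<open>D 0 0 / 4\<close> and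
    \<open>mass / (2 * M)\<close>.\<close>
  define Y where "Y M = (\<Sum>m<M. multiples_sum (real (Suc m))) - mass * (harm M - ln (real M)) - multiples_sum (real M) / 2
     - D 0 0 / 4 + mass / 2 * (1 / real M) - B + harm_integral (real M)" for M
  have psi_sum_eq: "psi_sum t = D 0 0 / 2 + multiples_sum t - mass / t" if "t > 0" for t
    using psi_sums[OF that] by (simp add: psi_sum_def sums_iff)
  have XY: "X M = Y M" if "M > 0" for M
  proof -
    have psum: "(\<Sum>m<M. psi_sum (real (Suc m))) = real M * (D 0 0 / 2) + (\<Sum>m<M. multiples_sum (real (Suc m))) - mass * harm M"
    proof -
      have "(\<Sum>m<M. psi_sum (real (Suc m))) = (\<Sum>m<M. D 0 0 / 2 + multiples_sum (real (Suc m)) - mass / real (Suc m))"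
        by (intro sum.cong refl psi_sum_eq) simp
      also have "\<dots> = real M * (D 0 0 / 2) + (\<Sum>m<M. multiples_sum (real (Suc m))) - mass * harm M"
        unfolding harm_altdef by (simp add: sum.distrib sum_subtractf sum_distrib_left inverse_eq_divide)
      finally show ?thesis .
    qed
    have "psi_sum (real M) = D 0 0 / 2 + multiples_sum (real M) - mass / real M" "real M \<ge> 1"
      using that psi_sum_eq[of "real M"] by simp_all
    then show ?thesis
      unfolding X_def Y_def B_def psum by (subst LINT_psi_sum) (simp_all add: field_simps del: of_nat_Suc)
  qed
  have z: "(\<lambda>M. multiples_sum (real M)) \<longlonglongrightarrow> 0"
    by (rule LIMSEQ_imp_Suc[OF summable_LIMSEQ_zero[OF summable_multiples_sum]])
  have "(\<lambda>M. (LINT u:{0..}|lborel. \<bar>u ^ 1 * D 0 u\<bar>) / real M) \<longlonglongrightarrow> 0" by (rule lim_const_over_n)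
  then have q: "(\<lambda>M. harm_integral (real M)) \<longlonglongrightarrow> 0"
  proof (rule Lim_null_comparison[rotated])
    show "\<forall>\<^sub>F M in sequentially. norm (harm_integral (real M)) \<le> (LINT u:{0..}|lborel. \<bar>u ^ 1 * D 0 u\<bar>) / real M"
      using eventually_gt_at_top[of 0] by eventually_elim (use abs_harm_integral_le in auto)
  qed
  have "(\<lambda>M. 1 / real M) \<longlonglongrightarrow> 0" by (rule lim_const_over_n)
  then have "Y \<longlonglongrightarrow> (\<Sum>m. multiples_sum (real (Suc m))) - mass * euler_mascheroni - 0 / 2 - D 0 0 / 4 + mass / 2 * 0 - B + 0"
    unfolding Y_def by (intro tendsto_intros summable_LIMSEQ summable_multiples_sum euler_mascheroni_LIMSEQ z q) auto
  then have "X \<longlonglongrightarrow> (\<Sum>m. multiples_sum (real (Suc m))) - mass * euler_mascheroni - 0 / 2 - D 0 0 / 4 + mass / 2 * 0 - B + 0"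
    by (rule Lim_transform_eventually) (use XY in \<open>auto intro!: eventually_mono[OF eventually_gt_at_top[of 0]]\<close>)
  moreover have "X \<longlonglongrightarrow> (\<Sum>k. \<Sum>j. 2 * voronoi_coeff (Suc j * Suc k))"
    unfolding X_def by (rule double_Poisson)
  ultimately have "(\<Sum>m. multiples_sum (real (Suc m))) - mass * euler_mascheroni - D 0 0 / 4 - B = (\<Sum>k. \<Sum>j. 2 * voronoi_coeff (Suc j * Suc k))"
    using LIMSEQ_unique by fastforce
  moreover have "(LINT u:{0..}|lborel. D 0 u * (ln u + 2 * euler_mascheroni)) = B + mass * euler_mascheroni"
  proof -
    have "(LINT u:{0..}|lborel. D 0 u * (ln u + 2 * euler_mascheroni)) = (LINT u:{0..}|lborel. D 0 u * (ln u + euler_mascheroni) + euler_mascheroni * D 0 u)"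
      by (simp add: algebra_simps)
    also have "\<dots> = B + mass * euler_mascheroni"
      unfolding B_def mass_def
      by (subst set_integral_add(2)) (auto intro!: set_integrable_ln_plus set_integrable_mult_right set_integrable_D simp: mult.commute)
    finally show ?thesis .
  qed
  ultimately show ?thesis by linarith
qed

end

section \<open>Voronoi summation\<close>

text \<open>Indices start at 0, so the pairs stand for ordered factorizations of n + 1, each
  determined by its first factor.\<close>

lemma card_divisor_pairs:
  "finite {p. Suc (fst p) * Suc (snd p) = Suc n}" "card {p. Suc (fst p) * Suc (snd p) = Suc n} = divisor_count (Suc n)"
proof -
  have b: "bij_betw (\<lambda>p. Suc (fst p)) {p. Suc (fst p) * Suc (snd p) = Suc n} {k. k dvd Suc n}"
    unfolding bij_betw_def
  proof
    show "inj_on (\<lambda>p. Suc (fst p)) {p. Suc (fst p) * Suc (snd p) = Suc n}"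
    proof (rule inj_onI)
      fix p q assume pq: "p \<in> {p. Suc (fst p) * Suc (snd p) = Suc n}" "q \<in> {p. Suc (fst p) * Suc (snd p) = Suc n}" "Suc (fst p) = Suc (fst q)"
      then have "Suc (fst p) * Suc (snd p) = Suc (fst p) * Suc (snd q)" by simp
      then have "Suc (snd p) = Suc (snd q)" by (subst (asm) mult_cancel1) simp
      with pq(3) show "p = q" by (simp add: prod_eq_iff)
    qed
    have "k \<in> (\<lambda>p. Suc (fst p)) ` {p. Suc (fst p) * Suc (snd p) = Suc n}" if k: "k dvd Suc n" for k
    proof -
      obtain m where m: "Suc n = k * m" using k by (rule dvdE)
      then obtain k' m' where "k = Suc k'" "m = Suc m'" by (cases k; cases m) auto
      then show ?thesis using m by (intro image_eqI[of _ _ "(k', m')"]) auto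
    qed
    then show "(\<lambda>p. Suc (fst p)) ` {p. Suc (fst p) * Suc (snd p) = Suc n} = {k. k dvd Suc n}"
      by (auto simp del: mult_Suc mult_Suc_right) (metis dvd_triv_left)
  qed
  have "finite {k. k dvd Suc n}" by (rule finite_divisors_nat) simp
  then show "finite {p. Suc (fst p) * Suc (snd p) = Suc n}" using bij_betw_finite[OF b] by blast
  show "card {p. Suc (fst p) * Suc (snd p) = Suc n} = divisor_count (Suc n)"
    using bij_betw_same_card[OF b] by (simp add: divisor_count_def)
qed

text \<open>The quadratic bound makes the double series absolutely summable over all pairs, which
  may then be grouped by rows or along the hyperbolas jk = n. Applied to the values f(n) and to the
  coefficients 2 J(n).\<close>

lemma divisor_count_sums:
  fixes a :: "nat \<Rightarrow> real"
  assumes a: "\<And>n. n > 0 \<Longrightarrow> \<bar>a n\<bar> \<le> K / (real n)\<^sup>2"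
  shows "(\<lambda>n. real (divisor_count (Suc n)) * a (Suc n)) sums (\<Sum>k. \<Sum>j. a (Suc j * Suc k))"
proof -
  define f where "f p = a (Suc (snd p) * Suc (fst p))" for p :: "nat \<times> nat"
  have K: "K \<ge> 0" using a[of 1] by simp
  define b where "b p = K / (real (Suc (fst p)))\<^sup>2 / (real (Suc (snd p)))\<^sup>2" for p :: "nat \<times> nat"
  have fb: "norm (f p) \<le> b p" for p
    using a[of "Suc (snd p) * Suc (fst p)"] by (simp only: f_def b_def real_norm_def of_nat_mult power_mult_distrib) (simp add: mult.commute)
  have "b summable_on (UNIV \<times> UNIV)"
  proof (rule summable_on_SigmaI)
    show "((\<lambda>j. b (k, j)) has_sum (\<Sum>j. b (k, j))) UNIV" for k
      using summable_inverse_Suc_squares[of "K / (real (Suc k))\<^sup>2"] K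
      by (intro norm_summable_imp_has_sum summable_sums) (simp_all add: b_def del: of_nat_Suc)
    have "(\<Sum>j. b (k, j)) = (K * (\<Sum>j. 1 / (real (Suc j))\<^sup>2)) / (real (Suc k))\<^sup>2" for k
      using suminf_mult[OF summable_inverse_Suc_squares[of 1], of "K / (real (Suc k))\<^sup>2"] by (simp add: b_def del: of_nat_Suc)
    moreover have "(\<Sum>j. 1 / (real (Suc j))\<^sup>2) \<ge> 0"
      by (rule suminf_nonneg[OF summable_inverse_Suc_squares]) simp
    ultimately show "(\<lambda>k. \<Sum>j. b (k, j)) summable_on UNIV"
      using K summable_inverse_Suc_squares[of "K * (\<Sum>j. 1 / (real (Suc j))\<^sup>2)"]
      by (subst summable_on_UNIV_nonneg_real_iff) auto
    show "b (k, j) \<ge> 0" for k j using K by (simp add: b_def)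
  qed
  then have "(\<lambda>p. norm (f p)) summable_on (UNIV \<times> UNIV)"
    by (rule summable_on_comparison_test) (use fb in auto)
  then have "f summable_on (UNIV \<times> UNIV)" by (rule abs_summable_summable)
  then obtain S where S: "(f has_sum S) (UNIV \<times> UNIV)" by (auto simp: summable_on_def)
  have rows: "((\<lambda>k. \<Sum>j. f (k, j)) has_sum S) UNIV"
  proof (rule has_sum_SigmaD[OF S])
    fix k
    have sn: "summable (\<lambda>j. norm (f (k, j)))"
      by (rule summable_comparison_test'[OF summable_inverse_Suc_squares[of "K / (real (Suc k))\<^sup>2"], of 0])
        (use fb[of "(k, _)"] in \<open>simp add: b_def del: of_nat_Suc\<close>)
    show "((\<lambda>j. f (k, j)) has_sum (\<Sum>j. f (k, j))) UNIV"
      by (rule norm_summable_imp_has_sum[OF sn summable_sums[OF summable_norm_cancel[OF sn]]])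
  qed
  then have S_eq: "S = (\<Sum>k. \<Sum>j. a (Suc j * Suc k))"
    using sums_unique[OF has_sum_imp_sums[OF rows]] by (simp only: f_def fst_conv snd_conv)
  define P where "P n = {p. Suc (fst p) * Suc (snd p) = Suc n}" for n
  \<comment> \<open>The sets \<open>P n\<close> partition all pairs: a pair lies in exactly the
    \<open>P n\<close> whose n + 1 is the product of its shifted entries.\<close>
  have b: "bij_betw snd (Sigma UNIV P) (UNIV \<times> UNIV)"
    unfolding bij_betw_def
  proof
    show "inj_on snd (Sigma UNIV P)" by (auto simp: inj_on_def P_def)
    have mem: "p \<in> snd ` Sigma UNIV P" for p
      by (intro image_eqI[of _ _ "(Suc (fst p) * Suc (snd p) - 1, p)"]) (auto simp: P_def)
    show "snd ` Sigma UNIV P = UNIV \<times> UNIV"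
      unfolding UNIV_Times_UNIV by (rule UNIV_eq_I[symmetric], rule mem)
  qed
  have "((\<lambda>n. real (divisor_count (Suc n)) * a (Suc n)) has_sum S) UNIV"
  proof (rule has_sum_SigmaD)
    show "((\<lambda>x. f (snd x)) has_sum S) (Sigma UNIV P)"
      using S by (simp only: has_sum_reindex_bij_betw[OF b])
    fix n
    have "(\<Sum>p\<in>P n. f p) = (\<Sum>p\<in>P n. a (Suc n))"
      by (intro sum.cong refl) (simp only: f_def P_def mem_Collect_eq mult.commute)
    then show "((\<lambda>p. f (snd (n, p))) has_sum (real (divisor_count (Suc n)) * a (Suc n))) (P n)"
      using has_sum_finite[of "P n" f] card_divisor_pairs[of n] by (simp add: P_def)
  qed
  then show ?thesis unfolding S_eq by (rule has_sum_imp_sums)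
qed

section \<open>Transfer from F and its Fourier transform to the half-line\<close>

lemma continuous_vanishing_at_bot_bounded:
  fixes g :: "real \<Rightarrow> real"
  assumes c: "continuous_on {..0} g" and lim: "(g \<longlongrightarrow> 0) at_bot"
  shows "\<exists>K. \<forall>x\<le>0. \<bar>g x\<bar> \<le> K"
proof -
  from tendstoD[OF lim, of 1] obtain R where R: "\<And>x. x \<le> R \<Longrightarrow> \<bar>g x\<bar> < 1"
    by (auto simp: eventually_at_bot_linorder)
  obtain K where K: "\<And>x. x \<in> {min R 0..0} \<Longrightarrow> \<bar>g x\<bar> \<le> K"
  proof -
    have "compact (g ` {min R 0..0})"
      by (intro compact_continuous_image continuous_on_subset[OF c]) auto
    then obtain K where "\<forall>z\<in>g ` {min R 0..0}. norm z \<le> K"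
      using compact_imp_bounded bounded_iff by blast
    then show ?thesis using that[of K] by auto
  qed
  have "\<bar>g x\<bar> \<le> max 1 K" if "x \<le> 0" for x
    using R[of x] K[of x] that by (cases "x \<le> R") auto
  then show ?thesis by blast
qed

text \<open>The map t to - y t reflects the left half-line, where the derivatives are given, and
  absorbs the dilation by y; the powers of \<open>- y\<close> come from the chain rule.\<close>

lemma schwartz_seq_of_left:
  assumes F: "F \<in> schwartz_left" and y: "y > 0"
  shows "schwartz_seq (\<lambda>n t. (- y) ^ n * left_deriv n F (- y * t))"
  unfolding schwartz_seq_def
proof (intro conjI allI impI)
  fix n m
  have diff: "left_deriv n F differentiable_on {..0}" for n
    using F by (simp add: schwartz_left_def smooth_left_def)
  have lim: "((\<lambda>t. \<bar>t\<bar> ^ m * left_deriv n F t) \<longlongrightarrow> 0) at_bot" for n m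
    using F by (simp add: schwartz_left_def)
  have cont: "continuous_on {..0} (left_deriv n F)" for n
    by (rule differentiable_imp_continuous_on[OF diff])
  show "continuous_on {0..} (\<lambda>t. (- y) ^ n * left_deriv n F (- y * t))"
    using y by (intro continuous_intros continuous_on_compose2[OF cont]) (auto simp: mult_nonneg_nonneg)
  show "((\<lambda>t. (- y) ^ n * left_deriv n F (- y * t)) has_real_derivative (- y) ^ Suc n * left_deriv (Suc n) F (- y * t)) (at t)"
    if "t > 0" for t
  proof -
    have neg: "- y * t < 0" using that y by simp
    have "(left_deriv n F has_vector_derivative left_deriv (Suc n) F (- y * t)) (at (- y * t) within {..0})"
      using diff[of n] neg unfolding differentiable_on_def
      by (simp add: left_deriv_def flip: vector_derivative_works)
    then have d: "(left_deriv n F has_real_derivative left_deriv (Suc n) F (- y * t)) (at (- y * t))"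
      using at_within_interior[of "- y * t" "{..0}"] neg
      by (simp add: has_real_derivative_iff_has_vector_derivative)
    have "((\<lambda>t. left_deriv n F (- y * t)) has_real_derivative left_deriv (Suc n) F (- y * t) * - y) (at t)"
      by (rule DERIV_chain2[where f = "left_deriv n F" and g = "\<lambda>t. - y * t", OF d DERIV_cmult_Id])
    from DERIV_cmult[OF this, of "(- y) ^ n"] show ?thesis by (simp add: mult_ac)
  qed
  show "\<exists>K. \<forall>t\<ge>0. \<bar>t ^ m * ((- y) ^ n * left_deriv n F (- y * t))\<bar> \<le> K"
  proof -
    have "continuous_on {..0} (\<lambda>t. \<bar>t\<bar> ^ m * left_deriv n F t)"
      by (intro continuous_intros cont)
    then obtain K where K: "\<And>x. x \<le> 0 \<Longrightarrow> \<bar>\<bar>x\<bar> ^ m * left_deriv n F x\<bar> \<le> K"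
      using continuous_vanishing_at_bot_bounded[OF _ lim[of m n]] by blast
    have "\<bar>t ^ m * ((- y) ^ n * left_deriv n F (- y * t))\<bar> \<le> y ^ n / y ^ m * K" if "t \<ge> 0" for t
    proof -
      have "\<bar>t ^ m * ((- y) ^ n * left_deriv n F (- y * t))\<bar> = y ^ n / y ^ m * \<bar>\<bar>- y * t\<bar> ^ m * left_deriv n F (- y * t)\<bar>"
        using y that by (simp add: abs_mult power_abs power_mult_distrib)
      also have "\<dots> \<le> y ^ n / y ^ m * K"
        using y that by (intro mult_left_mono K) auto
      finally show ?thesis .
    qed
    then show ?thesis by blast
  qed
qed

lemma LINT_atLeast_eq_greaterThan:
  fixes f :: "real \<Rightarrow> 'a::{banach, second_countable_topology}"
  assumes "set_integrable lborel {a..} f"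
  shows "(LINT x:{a<..}|lborel. f x) = (LINT x:{a..}|lborel. f x)"
proof (rule set_integral_cong_set)
  have "set_integrable lborel {a<..} f"
    by (rule set_integrable_subset[OF assms]) auto
  then show "set_borel_measurable lborel {a<..} f" "set_borel_measurable lborel {a..} f"
    using assms unfolding set_integrable_def set_borel_measurable_def by (auto dest: borel_measurable_integrable)
  show "AE x in lborel. x \<in> {a..} \<longleftrightarrow> x \<in> {a<..}"
    by (rule AE_mp[OF AE_lborel_singleton[of a]]) auto
qed

lemma fourier_even:
  fixes F :: "real \<Rightarrow> real"
  assumes even: "\<And>t. F (- t) = F t" and int: "set_integrable lborel {0..} F"
  shows "fourier F x = complex_of_real (2 * (LINT u:{0..}|lborel. F u * cos (x * u)))"
proof -
  define \<phi> where "\<phi> u = complex_of_real (F u) * cis (- (x * u))" for u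
  have \<phi>: "complex_of_real (F u) * exp (- (\<i> * complex_of_real x * complex_of_real u)) = \<phi> u" for u
    by (simp add: \<phi>_def cis_conv_exp mult_ac)
  \<comment> \<open>The line is cut into the closed half-line and its mirror image. The point 0 is
    counted twice, so the decomposition of \<open>\<phi>\<close> holds only almost
    everywhere.\<close>
  define \<psi> where "\<psi> u = indicator {0..} u *\<^sub>R \<phi> u" for u
  define \<eta> where "\<eta> u = indicator {0..} u *\<^sub>R \<phi> (- u)" for u
  have m: "(\<lambda>u. indicator {0..} u *\<^sub>R F u) \<in> borel_measurable lborel"
    using int unfolding set_integrable_def by (rule borel_measurable_integrable)
  have int': "integrable lborel (\<lambda>u. (complex_of_real (indicator {0..} u *\<^sub>R F u)) * cis (c * u))" for c
  proof (rule Bochner_Integration.integrable_bound)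
    show "integrable lborel (\<lambda>u. indicator {0..} u *\<^sub>R F u)" using int by (simp add: set_integrable_def)
    have "(\<lambda>u. cis (c * u)) \<in> borel_measurable borel"
      by (intro borel_measurable_continuous_onI) (auto simp: cis_conv_exp intro!: continuous_intros)
    then show "(\<lambda>u. (complex_of_real (indicator {0..} u *\<^sub>R F u)) * cis (c * u)) \<in> borel_measurable lborel"
      using borel_measurable_integrable[OF integrable_of_real[OF int[unfolded set_integrable_def]], where ?'a1 = complex]
      by (intro borel_measurable_times) simp_all
  qed (simp add: norm_mult)
  have i\<psi>: "integrable lborel \<psi>"
    using int'[of "- x"] by (simp add: \<psi>_def[abs_def] \<phi>_def scaleR_conv_of_real mult_ac)
  have i\<eta>: "integrable lborel \<eta>"
    using int'[of x] by (simp add: \<eta>_def[abs_def] \<phi>_def even scaleR_conv_of_real mult_ac)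
  have i\<eta>': "integrable lborel (\<lambda>u. \<eta> (- u))"
    using lborel_integrable_real_affine[OF i\<eta>, of "-1" 0] by simp
  have "fourier F x = (LINT u|lborel. \<phi> u)"
    by (simp add: fourier_def \<phi>)
  also have "\<dots> = (LINT u|lborel. \<psi> u + \<eta> (- u))"
  proof (rule integral_cong_AE)
    have "AE u in lborel. \<phi> u = \<psi> u + \<eta> (- u)"
      by (rule AE_mp[OF AE_lborel_singleton[of 0]]) (auto simp: \<psi>_def \<eta>_def indicator_def)
    then show "AE u in lborel. \<phi> u = \<psi> u + \<eta> (- u)" .
    show "(\<lambda>u. \<psi> u + \<eta> (- u)) \<in> borel_measurable lborel"
      using i\<psi> i\<eta>' by (intro borel_measurable_add borel_measurable_integrable)
    \<comment> \<open>Measurability of \<open>\<phi>\<close> needs an exact identity: the doubly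
      counted value at 0 is subtracted.\<close>
    have "\<phi> = (\<lambda>u. (\<psi> u + \<eta> (- u)) - indicator {0} u *\<^sub>R \<phi> 0)"
      by (auto simp: fun_eq_iff \<psi>_def \<eta>_def indicator_def)
    moreover have "(\<lambda>u. (\<psi> u + \<eta> (- u)) - indicator {0} u *\<^sub>R \<phi> 0) \<in> borel_measurable lborel"
      using i\<psi> i\<eta>' by (intro borel_measurable_diff borel_measurable_add borel_measurable_integrable borel_measurable_scaleR) auto
    ultimately show "\<phi> \<in> borel_measurable lborel" by simp
  qed
  also have "\<dots> = (LINT u|lborel. \<psi> u) + (LINT u|lborel. \<eta> (- u))"
    by (rule Bochner_Integration.integral_add[OF i\<psi> i\<eta>'])
  also have "(LINT u|lborel. \<eta> (- u)) = (LINT u|lborel. \<eta> u)"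
    using lborel_integral_real_affine[of "-1" \<eta> 0] by simp
  also have "(LINT u|lborel. \<psi> u) + (LINT u|lborel. \<eta> u) = (LINT u|lborel. \<psi> u + \<eta> u)"
    by (rule Bochner_Integration.integral_add[OF i\<psi> i\<eta>, symmetric])
  also have "\<dots> = (LINT u|lborel. complex_of_real (2 * (indicator {0..} u *\<^sub>R (F u * cos (x * u)))))"
    by (intro Bochner_Integration.integral_cong refl)
      (auto simp: \<psi>_def \<eta>_def \<phi>_def even complex_eq_iff indicator_def)
  also have "\<dots> = complex_of_real (2 * (LINT u:{0..}|lborel. F u * cos (x * u)))"
    unfolding integral_complex_of_real by (simp add: set_lebesgue_integral_def)
  finally show ?thesis .
qed

text \<open>The substitution t = c / x exchanges the ends: the cutoff e near 0 becomes the upper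
  limit c / e, and continuity of h at 0 gives absolute convergence at x = oo.\<close>

lemma reciprocal_substitution:
  fixes h :: "real \<Rightarrow> real"
  assumes c: "c > 0" and e: "e > 0" and h: "continuous_on {0..} h"
  shows "set_integrable lborel {e<..} (\<lambda>x. c / x\<^sup>2 * h (c / x))"
    and "(LINT x:{e<..}|lborel. c / x\<^sup>2 * h (c / x)) = (LINT t:{0..c / e}|lborel. h t)"
proof -
  have im: "(\<lambda>x. c / x) ` {e<..} = {0<..<c / e}"
  proof
    show "(\<lambda>x. c / x) ` {e<..} \<subseteq> {0<..<c / e}"
      using c e by (auto intro!: divide_strict_left_mono)
    show "{0<..<c / e} \<subseteq> (\<lambda>x. c / x) ` {e<..}"
    proof
      fix t assume t: "t \<in> {0<..<c / e}"
      then have "e < c / t" using e by (simp add: field_simps)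
      then show "t \<in> (\<lambda>x. c / x) ` {e<..}" using t c by (intro image_eqI[of _ _ "c / t"]) auto
    qed
  qed
  have ih: "set_integrable lborel {0..c / e} h"
    by (intro borel_integrable_atLeastAtMost' continuous_on_subset[OF h]) auto
  have ih': "set_integrable lborel {0<..<c / e} h"
    by (rule set_integrable_subset[OF ih]) auto
  have "h absolutely_integrable_on {0<..<c / e}"
    using ih' unfolding set_integrable_def by (intro integrable_completion[THEN iffD2]) (auto dest: borel_measurable_integrable)
  then have "(\<lambda>x. \<bar>- c / x\<^sup>2\<bar> * h (c / x)) absolutely_integrable_on {e<..} \<and>
      integral {e<..} (\<lambda>x. \<bar>- c / x\<^sup>2\<bar> * h (c / x)) = integral {0<..<c / e} h"
  proof (subst has_absolute_integral_change_of_variables_1'[where g = "\<lambda>x. c / x"])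
    show "((\<lambda>x. c / x) has_real_derivative - c / x\<^sup>2) (at x within {e<..})" if "x \<in> {e<..}" for x
      using that e by (auto intro!: derivative_eq_intros simp: power2_eq_square)
    show "inj_on (\<lambda>x. c / x) {e<..}"
      using c e by (auto simp: inj_on_def field_simps)
  qed (simp_all add: im)
  moreover have "\<bar>- c / x\<^sup>2\<bar> = c / x\<^sup>2" for x using c by simp
  ultimately have a: "(\<lambda>x. c / x\<^sup>2 * h (c / x)) absolutely_integrable_on {e<..}"
    "integral {e<..} (\<lambda>x. c / x\<^sup>2 * h (c / x)) = integral {0<..<c / e} h" by (simp_all only:)
  \<comment> \<open>The change of variables yields integrability for the completed measure only;
    Borel measurability is supplied separately.\<close>
  have "(\<lambda>x. indicator {e<..} x *\<^sub>R (c / x\<^sup>2 * h (c / x))) \<in> borel_measurable borel"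
    using c e by (intro borel_measurable_continuous_on_indicator continuous_intros continuous_on_compose2[OF h]) auto
  then show i: "set_integrable lborel {e<..} (\<lambda>x. c / x\<^sup>2 * h (c / x))"
    using a(1) unfolding set_integrable_def by (subst (asm) integrable_completion) auto
  have "(LINT x:{e<..}|lborel. c / x\<^sup>2 * h (c / x)) = (LINT t:{0<..<c / e}|lborel. h t)"
    unfolding set_borel_integral_eq_integral(2)[OF i] set_borel_integral_eq_integral(2)[OF ih'] by (rule a(2))
  also have "\<dots> = (LINT t:{0..c / e}|lborel. h t)"
    unfolding set_borel_integral_eq_integral(2)[OF ih] set_borel_integral_eq_integral(2)[OF ih']
    by (rule integral_open_interval_real[symmetric])
  finally show "(LINT x:{e<..}|lborel. c / x\<^sup>2 * h (c / x)) = (LINT t:{0..c / e}|lborel. h t)" .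
qed

lemma improper_integral_eqI: "has_improper_integral f I \<Longrightarrow> improper_integral f = I"
  unfolding improper_integral_def
  by (rule the_equality) (auto simp: has_improper_integral_def intro: tendsto_unique[OF trivial_limit_at_right_real])

lemma has_improper_integral_voronoi:
  fixes F :: "real \<Rightarrow> real"
  assumes D: "schwartz D" and D0: "\<And>t. t \<ge> 0 \<Longrightarrow> D 0 t = F (y * t)"
    and even: "\<And>t. F (- t) = F t" and y: "y > 0" and n: "n > 0"
  shows "has_improper_integral (voronoi_integrand F y n) (complex_of_real (y * schwartz.voronoi_coeff D n))"
proof -
  interpret schwartz D by (rule D)
  interpret k: decaying_C2 "ker 0" ker_derivative "ker 2" by (rule decaying_C2_ker)
  \<comment> \<open>This choice turns 4 pi^2 n / (x y) into 2 pi n (c / x) and makes x / c the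
    frequency at which \<open>costr (D 0)\<close> gives the Fourier transform; the factor 1 / x then
    becomes the Jacobian c / x^2 times the reciprocal in \<open>ker 0\<close>.\<close>
  define c where "c = 2 * pi / y"
  have c: "c > 0" using y by (simp add: c_def)
  define h where "h t = ker 0 t * cos (2 * pi * real n * t)" for t
  have h: "continuous_on {0..} h"
    unfolding h_def by (intro continuous_intros k.cont)
  have iF: "set_integrable lborel {0..} F"
  proof -
    have "set_integrable lborel {t. 1 / y * t \<in> {0..}} (\<lambda>t. D 0 (1 / y * t))"
      using y by (intro set_integrable_scale set_integrable_D) auto
    also have "{t. 1 / y * t \<in> {0..}} = {0..}" using y by (intro scale_atLeast) auto
    finally show ?thesis
      by (rule set_integrable_cong[THEN iffD1, rotated -1]) (use y D0 in auto)
  qed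
  have eq: "voronoi_integrand F y n x = complex_of_real (y * (c / x\<^sup>2 * h (c / x)))" if x: "x > 0" for x
  proof -
    have "(LINT u:{0..}|lborel. F u * cos (x * u)) = y * (LINT v:{0..}|lborel. F (y * v) * cos (x * (y * v)))"
      using LINT_scale_atLeast[OF y, of "\<lambda>u. F u * cos (x * u)"] y by simp
    also have "(LINT v:{0..}|lborel. F (y * v) * cos (x * (y * v))) = costr (D 0) (x / c)"
      unfolding costr_def by (intro set_lebesgue_integral_cong) (use D0 y in \<open>auto simp: c_def mult_ac\<close>)
    finally have "fourier F x = complex_of_real (2 * (y * costr (D 0) (x / c)))"
      using fourier_even[OF even iF, of x] by simp
    moreover have "4 * pi\<^sup>2 * real n / (x * y) = 2 * pi * real n * (c / x)"
      using y x by (simp add: c_def power2_eq_square field_simps)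
    ultimately have "voronoi_integrand F y n x = complex_of_real (cos (2 * pi * real n * (c / x)) * (2 * (y * costr (D 0) (x / c))) / x)"
      by (simp add: voronoi_integrand_def)
    also have "cos (2 * pi * real n * (c / x)) * (2 * (y * costr (D 0) (x / c))) / x = y * (c / x\<^sup>2 * h (c / x))"
      using c x by (simp add: h_def ker_def power2_eq_square)
    finally show ?thesis .
  qed
  show ?thesis
    unfolding has_improper_integral_def
  proof (intro conjI allI impI)
    fix e :: real assume e: "e > 0"
    have "integrable lborel (\<lambda>x. complex_of_real (y * (indicator {e<..} x *\<^sub>R (c / x\<^sup>2 * h (c / x)))))"
      using reciprocal_substitution(1)[OF c e h] unfolding set_integrable_def
      by (intro integrable_of_real integrable_mult_right)
    then have "integrable lborel (\<lambda>x. indicator {e<..} x *\<^sub>R complex_of_real (y * (c / x\<^sup>2 * h (c / x))))"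
      by (simp add: scaleR_conv_of_real mult_ac)
    then have "set_integrable lborel {e<..} (\<lambda>x. complex_of_real (y * (c / x\<^sup>2 * h (c / x))))"
      unfolding set_integrable_def .
    then show "set_integrable lborel {e<..} (voronoi_integrand F y n)"
      by (rule set_integrable_cong[THEN iffD1, rotated -1]) (use e eq in auto)
  next
    have val: "(LINT x:{e<..}|lborel. voronoi_integrand F y n x) = complex_of_real (y * (LINT t:{0..c / e}|lborel. h t))" if e: "e > 0" for e
    proof -
      have "(LINT x:{e<..}|lborel. voronoi_integrand F y n x) = (LINT x:{e<..}|lborel. complex_of_real (y * (c / x\<^sup>2 * h (c / x))))"
        by (intro set_lebesgue_integral_cong) (use e eq in auto)
      also have "\<dots> = complex_of_real (y * (LINT x:{e<..}|lborel. c / x\<^sup>2 * h (c / x)))"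
        by (simp only: set_integral_complex_of_real set_integral_mult_right)
      finally show ?thesis unfolding reciprocal_substitution(2)[OF c e h] .
    qed
    have "filterlim (\<lambda>e. c / e) at_top (at_right 0)"
      using c by real_asymp
    then have "((\<lambda>e. LINT t:{0..c / e}|lborel. ker 0 t * cos (2 * pi * real n * t)) \<longlongrightarrow> voronoi_coeff n) (at_right 0)"
      unfolding voronoi_coeff_def
      by (rule filterlim_compose[OF k.LINT_cos_tendsto, rotated]) (use n in simp)
    then have "((\<lambda>e. complex_of_real (y * (LINT t:{0..c / e}|lborel. h t))) \<longlongrightarrow> complex_of_real (y * voronoi_coeff n)) (at_right 0)"
      unfolding h_def by (intro tendsto_intros)
    then show "((\<lambda>e. LINT x:{e<..}|lborel. voronoi_integrand F y n x) \<longlongrightarrow> complex_of_real (y * voronoi_coeff n)) (at_right 0)"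
      by (rule Lim_transform_eventually) (use val in \<open>auto simp: eventually_at_filter\<close>)
  qed
qed

theorem mainTheorem5:
  fixes F :: "real \<Rightarrow> real" and y :: real
  assumes "F \<in> schwartz_left"
    and "\<And>t. F (- t) = F t"
    and "y > 0"
  shows "summable (\<lambda>n. real (divisor_count (Suc n)) * F (real (Suc n) * y)) \<and>
    set_integrable lborel {0<..} (\<lambda>u. F u * (ln (u / y) + 2 * euler_mascheroni)) \<and>
    (\<forall>n\<ge>1. \<exists>I. has_improper_integral (voronoi_integrand F y n) I) \<and>
    summable (\<lambda>n. of_nat (divisor_count (Suc n)) * improper_integral (voronoi_integrand F y (Suc n))) \<and>
    complex_of_real (\<Sum>n. real (divisor_count (Suc n)) * F (real (Suc n) * y)) =
      complex_of_real
        (1 / y * (LINT u:{0<..}|lborel. F u * (ln (u / y) + 2 * euler_mascheroni)) + F 0 / 4) +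
      complex_of_real (2 / y) *
        (\<Sum>n. of_nat (divisor_count (Suc n)) * improper_integral (voronoi_integrand F y (Suc n)))"
proof -
  define D where "D n t = (- y) ^ n * left_deriv n F (- y * t)" for n t
  interpret schwartz D
    unfolding D_def[abs_def] by (intro schwartz.intro schwartz_seq_of_left assms)
  \<comment> \<open>Evenness enters here: \<open>D 0 t\<close> is by definition a value on the left
    half-line.\<close>
  have D0: "D 0 t = F (y * t)" for t
    using assms(2)[of "y * t"] by (simp add: D_def left_deriv_def)
  have sD: "schwartz D" by unfold_locales
  obtain K where K: "\<And>t. t > 0 \<Longrightarrow> \<bar>D 0 t\<bar> \<le> K / t\<^sup>2" using D0_quadratic_decay by blast
  have s1: "(\<lambda>n. real (divisor_count (Suc n)) * D 0 (real (Suc n))) sums (\<Sum>k. multiples_sum (real (Suc k)))"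
    using divisor_count_sums[of "\<lambda>n. D 0 (real n)" K] K
    by (simp add: multiples_sum_def del: of_nat_Suc mult_Suc mult_Suc_right)
  obtain K' where K': "\<And>n. \<bar>voronoi_coeff n\<bar> \<le> K' / (real n)\<^sup>2" using abs_voronoi_coeff_le by blast
  have s2: "(\<lambda>n. real (divisor_count (Suc n)) * (2 * voronoi_coeff (Suc n))) sums (\<Sum>k. \<Sum>j. 2 * voronoi_coeff (Suc j * Suc k))"
    by (rule divisor_count_sums[where K = "2 * K'"]) (use mult_left_mono[OF K', of 2] in \<open>auto simp: abs_mult\<close>)
  note imp = has_improper_integral_voronoi[OF sD D0 assms(2,3)]
  have imp': "improper_integral (voronoi_integrand F y (Suc n)) = complex_of_real (y * voronoi_coeff (Suc n))" for n
    by (rule improper_integral_eqI[OF imp]) simp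
  \<comment> \<open>Each improper integral equals y J(n), while the double series carries 2 J(n);
    the resulting y / 2 cancels the prefactor 2 / y of the statement.\<close>
  have s3: "(\<lambda>n. of_nat (divisor_count (Suc n)) * improper_integral (voronoi_integrand F y (Suc n))) sums
     complex_of_real (y / 2 * (\<Sum>k. \<Sum>j. 2 * voronoi_coeff (Suc j * Suc k)))"
    using sums_of_real[OF sums_mult[OF s2, of "y / 2"], where ?'a = complex] unfolding imp' by (simp add: mult_ac)
  define w where "w u = F u * (ln (u / y) + 2 * euler_mascheroni)" for u
  \<comment> \<open>The substitution u = y t reduces ln (u / y) to ln t, the form in which the
    logarithmic term was computed.\<close>
  have w_scale: "w (y * t) = D 0 t * (ln t + 2 * euler_mascheroni)" for t
    using assms(3) by (simp add: w_def D0)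
  have iw: "set_integrable lborel {0..} w"
  proof -
    have "set_integrable lborel {t. 1 / y * t \<in> {0..}} (\<lambda>u. w (y * (1 / y * u)))"
      using set_integrable_scale[of "1 / y" "{0..}" "\<lambda>t. w (y * t)"] set_integrable_ln_plus[of "2 * euler_mascheroni"] assms(3)
      unfolding w_scale by simp
    also have "{t. 1 / y * t \<in> {0..}} = {0..}" using assms(3) by (intro scale_atLeast) auto
    finally show ?thesis using assms(3) by simp
  qed
  have "(LINT u:{0<..}|lborel. w u) = y * (LINT t:{0..}|lborel. D 0 t * (ln t + 2 * euler_mascheroni))"
    using LINT_scale_atLeast[OF assms(3), of w] assms(3)
    unfolding LINT_atLeast_eq_greaterThan[OF iw] w_scale by (simp add: field_simps)
  then have main: "(\<Sum>k. multiples_sum (real (Suc k))) = 1 / y * (LINT u:{0<..}|lborel. w u) + F 0 / 4 + (\<Sum>k. \<Sum>j. 2 * voronoi_coeff (Suc j * Suc k))"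
    using Voronoi_iterated assms(3) D0[of 0] by simp
  have s1': "(\<lambda>n. real (divisor_count (Suc n)) * F (real (Suc n) * y)) sums (\<Sum>k. multiples_sum (real (Suc k)))"
    using s1 unfolding D0 by (simp only: mult.commute[of y])
  have iw': "set_integrable lborel {0<..} w"
    by (rule set_integrable_subset[OF iw]) auto
  show ?thesis
    unfolding w_def[symmetric] sums_unique[OF s1', symmetric] sums_unique[OF s3, symmetric] main
    using sums_summable[OF s1'] sums_summable[OF s3] iw' imp assms(3) by (auto simp: Suc_le_eq)
qed

end
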